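(* Let $G_\Gamma$ be a graph product of finitely generated groups. The action of $G_\Gamma$ on $C(\Gamma)$ by left multiplication is acylindrical.
   Context: Let $\Gamma$ be a finite non-empty simplicial graph with each vertex $v$ labelled by a non-trivial finitely generated group $G_v$. The graph product is $G_\Gamma=\left(\ast_{v\in V(\Gamma)}G_v\right)/\langle\langle [g_v,g_w] : g_v\in G_v,\ g_w\in G_w,\ \{v,w\}\in E(\Gamma)\rangle\rangle$. Fix a finite generating set $S_v$ of each $G_v$ and let $S=\bigcup_vS_v$. Subgraphs are non-empty and induced; for $\Lambda\subseteq\Gamma$, $\langle\Lambda\rangle$ is the subgroup generated by $\{G_v:v\in V(\Lambda)\}$. $C(\Gamma)$ is the graph (edges of length 1) with vertex set $G_\Gamma$ in which distinct $x,y$ are joined by an edge if $x^{-1}y\in\langle\Lambda\rangle$ for some proper subgraph $\Lambda\subsetneq\Gamma$, or $x^{-1}y\in S\cup S^{-1}$. The action of a group $G$ on a metric space $X$ is acylindrical if for all $\epsilon\ge0$ there exist $R,N\ge0$ such that whenever $x,y\in X$ satisfy $\mathsf d_X(x,y)\ge R$, there are at most $N$ elements $g\in G$ with $\mathsf d_X(x,gx)\le\epsilon$ and $\mathsf d_X(y,gy)\le\epsilon$. *)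

theory Defs
  imports
    "HOL-Algebra.Group_Action"
    "HOL-Algebra.Generated_Groups"
    "HOL-Analysis.Abstract_Metric_Spaces"
    "Graph_Theory.Pair_Digraph"
begin

section \<open>Free products and graph products of groups\<close>

text \<open>The free product consists of the words in pairs of a vertex \<open>v\<close> and an element of \<open>G v\<close>, modulo
  the congruence generated by deleting identity letters and multiplying adjacent letters of the
  same vertex group.\<close>

definition fp_words :: "'v set \<Rightarrow> ('v \<Rightarrow> ('a, 'b) monoid_scheme) \<Rightarrow> ('v \<times> 'a) list set" where
  "fp_words V G = lists (SIGMA v:V. carrier (G v))"

inductive_set fp_step :: "'v set \<Rightarrow> ('v \<Rightarrow> ('a, 'b) monoid_scheme) \<Rightarrow> ('v \<times> 'a) list rel"
  for V G where
  fp_one: "\<lbrakk>u \<in> fp_words V G; w \<in> fp_words V G; v \<in> V\<rbrakk>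
    \<Longrightarrow> (u @ [(v, \<one>\<^bsub>G v\<^esub>)] @ w, u @ w) \<in> fp_step V G"
| fp_mult: "\<lbrakk>u \<in> fp_words V G; w \<in> fp_words V G; v \<in> V; g \<in> carrier (G v); h \<in> carrier (G v)\<rbrakk>
    \<Longrightarrow> (u @ [(v, g), (v, h)] @ w, u @ [(v, g \<otimes>\<^bsub>G v\<^esub> h)] @ w) \<in> fp_step V G"

definition fp_rel :: "'v set \<Rightarrow> ('v \<Rightarrow> ('a, 'b) monoid_scheme) \<Rightarrow> ('v \<times> 'a) list rel" where
  "fp_rel V G = Restr ((fp_step V G \<union> (fp_step V G)\<inverse>)\<^sup>*) (fp_words V G)"

definition free_product :: "'v set \<Rightarrow> ('v \<Rightarrow> ('a, 'b) monoid_scheme) \<Rightarrow> ('v \<times> 'a) list set monoid" where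
  "free_product V G =
    \<lparr>carrier = fp_words V G // fp_rel V G,
     monoid.mult = (\<lambda>X Y. \<Union>x\<in>X. \<Union>y\<in>Y. fp_rel V G `` {x @ y}),
     monoid.one = fp_rel V G `` {[]}\<rparr>"

definition fp_incl :: "'v set \<Rightarrow> ('v \<Rightarrow> ('a, 'b) monoid_scheme) \<Rightarrow> 'v \<Rightarrow> 'a \<Rightarrow> ('v \<times> 'a) list set" where
  "fp_incl V G v g = fp_rel V G `` {[(v, g)]}"

definition normal_closure :: "('a, 'b) monoid_scheme \<Rightarrow> 'a set \<Rightarrow> 'a set" where
  "normal_closure F R = (\<lambda>N. N \<lhd> F) hull R"

definition commutator :: "('a, 'b) monoid_scheme \<Rightarrow> 'a \<Rightarrow> 'a \<Rightarrow> 'a" where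
  "commutator F x y = x \<otimes>\<^bsub>F\<^esub> y \<otimes>\<^bsub>F\<^esub> inv\<^bsub>F\<^esub> x \<otimes>\<^bsub>F\<^esub> inv\<^bsub>F\<^esub> y"

definition gp_relators ::
  "'v pair_pre_digraph \<Rightarrow> ('v \<Rightarrow> ('a, 'b) monoid_scheme) \<Rightarrow> ('v \<times> 'a) list set set" where
  "gp_relators \<Gamma> G =
    {commutator (free_product (pverts \<Gamma>) G) (fp_incl (pverts \<Gamma>) G v g) (fp_incl (pverts \<Gamma>) G w h)
      | v g w h. (v, w) \<in> parcs \<Gamma> \<and> g \<in> carrier (G v) \<and> h \<in> carrier (G w)}"

definition gp_kernel ::
  "'v pair_pre_digraph \<Rightarrow> ('v \<Rightarrow> ('a, 'b) monoid_scheme) \<Rightarrow> ('v \<times> 'a) list set set" where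
  "gp_kernel \<Gamma> G = normal_closure (free_product (pverts \<Gamma>) G) (gp_relators \<Gamma> G)"

definition graph_product ::
  "'v pair_pre_digraph \<Rightarrow> ('v \<Rightarrow> ('a, 'b) monoid_scheme) \<Rightarrow> ('v \<times> 'a) list set set monoid" where
  "graph_product \<Gamma> G = free_product (pverts \<Gamma>) G Mod gp_kernel \<Gamma> G"

definition gp_incl ::
  "'v pair_pre_digraph \<Rightarrow> ('v \<Rightarrow> ('a, 'b) monoid_scheme) \<Rightarrow> 'v \<Rightarrow> 'a \<Rightarrow> ('v \<times> 'a) list set set" where
  "gp_incl \<Gamma> G v g = gp_kernel \<Gamma> G #>\<^bsub>free_product (pverts \<Gamma>) G\<^esub> fp_incl (pverts \<Gamma>) G v g"

text \<open>An induced subgraph is given by its vertex set \<open>W\<close>.\<close>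

definition gp_subgroup ::
  "'v pair_pre_digraph \<Rightarrow> ('v \<Rightarrow> ('a, 'b) monoid_scheme) \<Rightarrow> 'v set \<Rightarrow> ('v \<times> 'a) list set set set" where
  "gp_subgroup \<Gamma> G W = generate (graph_product \<Gamma> G) (\<Union>v\<in>W. gp_incl \<Gamma> G v ` carrier (G v))"

definition gp_generators ::
  "'v pair_pre_digraph \<Rightarrow> ('v \<Rightarrow> ('a, 'b) monoid_scheme) \<Rightarrow> ('v \<Rightarrow> 'a set) \<Rightarrow> ('v \<times> 'a) list set set set" where
  "gp_generators \<Gamma> G S = (\<Union>v\<in>pverts \<Gamma>. gp_incl \<Gamma> G v ` S v)"

definition C_graph ::
  "'v pair_pre_digraph \<Rightarrow> ('v \<Rightarrow> ('a, 'b) monoid_scheme) \<Rightarrow> ('v \<Rightarrow> 'a set)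
    \<Rightarrow> ('v \<times> 'a) list set set pair_pre_digraph" where
  "C_graph \<Gamma> G S = (let P = graph_product \<Gamma> G; T = gp_generators \<Gamma> G S in
    \<lparr>pverts = carrier P,
     parcs = {(x, y). x \<in> carrier P \<and> y \<in> carrier P \<and> x \<noteq> y \<and>
       ((\<exists>W. W \<noteq> {} \<and> W \<subset> pverts \<Gamma> \<and> inv\<^bsub>P\<^esub> x \<otimes>\<^bsub>P\<^esub> y \<in> gp_subgroup \<Gamma> G W) \<or>
        inv\<^bsub>P\<^esub> x \<otimes>\<^bsub>P\<^esub> y \<in> T \<union> m_inv P ` T)}\<rparr>)"


section \<open>Graphs as metric spaces\<close>

text \<open>A graph is turned into a metric space by making every edge a unit interval.
  A point is given by its barycentric coordinates: it is a nonnegative function on the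
  vertices, of total mass 1, supported on a vertex or on the two ends of an edge.\<close>

definition geom_cells :: "'x pair_pre_digraph \<Rightarrow> 'x set set" where
  "geom_cells C = {{x} | x. x \<in> pverts C} \<union> {{x, y} | x y. (x, y) \<in> parcs C}"

definition cell_points :: "'x set \<Rightarrow> ('x \<Rightarrow> real) set" where
  "cell_points c = {p. (\<forall>x. 0 \<le> p x) \<and> (\<forall>x. x \<notin> c \<longrightarrow> p x = 0) \<and> (\<Sum>x\<in>c. p x) = 1}"

definition realization :: "'x pair_pre_digraph \<Rightarrow> ('x \<Rightarrow> real) set" where
  "realization C = (\<Union>c\<in>geom_cells C. cell_points c)"

text \<open>Two points on the same edge \<open>{x, y}\<close> satisfy \<open>p y - q y = - (p x - q x)\<close>,
  so \<open>segment_length p q\<close> is their distance \<open>\<bar>p x - q x\<bar>\<close> along this edge.\<close>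

definition segment_length :: "('x \<Rightarrow> real) \<Rightarrow> ('x \<Rightarrow> real) \<Rightarrow> real" where
  "segment_length p q = (\<Sum>x | p x \<noteq> 0 \<or> q x \<noteq> 0. \<bar>p x - q x\<bar>) / 2"

inductive chain_length :: "'x pair_pre_digraph \<Rightarrow> ('x \<Rightarrow> real) \<Rightarrow> ('x \<Rightarrow> real) \<Rightarrow> real \<Rightarrow> bool"
  for C p where
  chain_refl: "chain_length C p p 0"
| chain_step: "\<lbrakk>chain_length C p q l; c \<in> geom_cells C; q \<in> cell_points c; r \<in> cell_points c\<rbrakk>
    \<Longrightarrow> chain_length C p r (l + segment_length q r)"

text \<open>The path metric of a connected graph: the infimum of the lengths of chains of segments from
  \<open>p\<close> to \<open>q\<close>. The value \<open>0\<close> outside of the realization is a dummy.\<close>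

definition path_dist :: "'x pair_pre_digraph \<Rightarrow> ('x \<Rightarrow> real) \<Rightarrow> ('x \<Rightarrow> real) \<Rightarrow> real" where
  "path_dist C p q =
    (if p \<in> realization C \<and> q \<in> realization C then Inf {l. chain_length C p q l} else 0)"

text \<open>Left multiplication by \<open>g\<close>, extended affinely over the edges: the push-forward of \<open>p\<close>
  along \<open>x \<mapsto> g x\<close>.\<close>

definition left_mult_action :: "('x, 'b) monoid_scheme \<Rightarrow> 'x pair_pre_digraph \<Rightarrow> 'x \<Rightarrow> ('x \<Rightarrow> real) \<Rightarrow> 'x \<Rightarrow> real" where
  "left_mult_action P C g =
    (\<lambda>p\<in>realization C. \<lambda>x. if x \<in> carrier P then p (inv\<^bsub>P\<^esub> g \<otimes>\<^bsub>P\<^esub> x) else 0)"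

definition acylindrical_action ::
  "('g, 'b) monoid_scheme \<Rightarrow> 'x set \<Rightarrow> ('x \<Rightarrow> 'x \<Rightarrow> real) \<Rightarrow> ('g \<Rightarrow> 'x \<Rightarrow> 'x) \<Rightarrow> bool" where
  "acylindrical_action P M d \<phi> \<longleftrightarrow>
    (\<forall>\<epsilon>\<ge>0. \<exists>R\<ge>0. \<exists>N::nat. \<forall>x\<in>M. \<forall>y\<in>M. d x y \<ge> R \<longrightarrow>
      finite {g \<in> carrier P. d x (\<phi> g x) \<le> \<epsilon> \<and> d y (\<phi> g y) \<le> \<epsilon>} \<and>
      card {g \<in> carrier P. d x (\<phi> g x) \<le> \<epsilon> \<and> d y (\<phi> g y) \<le> \<epsilon>} \<le> N)"


section \<open>The graph product is a group generated by the images of the \<open>S v\<close>\<close>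

locale vertex_groups =
  fixes V :: "'v set" and G :: "'v \<Rightarrow> ('a, 'b) monoid_scheme"
  assumes group_G: "v \<in> V \<Longrightarrow> group (G v)"
begin

lemma words_Nil: "[] \<in> fp_words V G" by (simp add: fp_words_def)

lemma words_Cons: "(v, g) # w \<in> fp_words V G \<longleftrightarrow> v \<in> V \<and> g \<in> carrier (G v) \<and> w \<in> fp_words V G"
  by (auto simp: fp_words_def)

lemma words_append: "u @ w \<in> fp_words V G \<longleftrightarrow> u \<in> fp_words V G \<and> w \<in> fp_words V G"
  by (simp add: fp_words_def)

lemmas words_simps = words_Nil words_Cons words_append

lemma step_words: "(x, y) \<in> fp_step V G \<Longrightarrow> x \<in> fp_words V G \<and> y \<in> fp_words V G"
  by (induction rule: fp_step.induct)
    (auto simp: words_simps group.is_monoid group_G intro!: monoid.m_closed monoid.one_closed)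

lemma step_append:
  assumes "(x, y) \<in> fp_step V G" "a \<in> fp_words V G" "b \<in> fp_words V G"
  shows "(a @ x @ b, a @ y @ b) \<in> fp_step V G"
  using assms(1)
proof cases
  case (fp_one u w v)
  then show ?thesis
    using fp_step.fp_one[of "a @ u" V G "w @ b" v] assms by (simp add: words_simps)
next
  case (fp_mult u w v g h)
  then show ?thesis
    using fp_step.fp_mult[of "a @ u" V G "w @ b" v g h] assms by (simp add: words_simps)
qed

lemma equiv_rel: "equiv (fp_words V G) (fp_rel V G)"
proof (rule equivI)
  have "sym ((fp_step V G \<union> (fp_step V G)\<inverse>)\<^sup>*)"
    by (rule sym_rtrancl) (rule sym_Un_converse)
  then show "sym (fp_rel V G)" unfolding fp_rel_def sym_def by blast
  show "trans (fp_rel V G)" unfolding fp_rel_def trans_def by (auto intro: rtrancl_trans)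
qed (auto simp: fp_rel_def refl_on_def)

lemma rel_append:
  assumes "(x, y) \<in> fp_rel V G" "a \<in> fp_words V G" "b \<in> fp_words V G"
  shows "(a @ x @ b, a @ y @ b) \<in> fp_rel V G"
proof -
  have "(x, y) \<in> (fp_step V G \<union> (fp_step V G)\<inverse>)\<^sup>*" using assms by (simp add: fp_rel_def)
  then have "(a @ x @ b, a @ y @ b) \<in> (fp_step V G \<union> (fp_step V G)\<inverse>)\<^sup>*"
    by induction (use step_append[OF _ assms(2,3)] in \<open>auto intro: rtrancl_into_rtrancl\<close>)
  then show ?thesis using assms by (auto simp: fp_rel_def words_simps)
qed

lemma step_rel: "(x, y) \<in> fp_step V G \<Longrightarrow> (x, y) \<in> fp_rel V G"
  by (auto simp: fp_rel_def dest: step_words)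

abbreviation cls :: "('v \<times> 'a) list \<Rightarrow> ('v \<times> 'a) list set" where
  "cls w \<equiv> fp_rel V G `` {w}"

lemma cls_eq: "(x, y) \<in> fp_rel V G \<Longrightarrow> cls x = cls y"
  by (rule equiv_class_eq[OF equiv_rel])

lemma congruent_append: "(\<lambda>x y. cls (x @ y)) respects2 fp_rel V G"
proof (rule congruent2I[OF equiv_rel equiv_rel])
  fix y z w assume "w \<in> fp_words V G" "(y, z) \<in> fp_rel V G"
  then show "cls (y @ w) = cls (z @ w)" "cls (w @ y) = cls (w @ z)"
    using rel_append[of y z "[]" w] rel_append[of y z w "[]"]
    by (simp_all add: words_simps cls_eq)
qed

lemma mult_cls:
  "x \<in> fp_words V G \<Longrightarrow> y \<in> fp_words V G \<Longrightarrow> cls x \<otimes>\<^bsub>free_product V G\<^esub> cls y = cls (x @ y)"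
  using UN_equiv_class2[OF equiv_rel equiv_rel congruent_append] by (simp add: free_product_def)

lemma carrier_cls: "X \<in> carrier (free_product V G) \<longleftrightarrow> (\<exists>w\<in>fp_words V G. X = cls w)"
  by (auto simp: free_product_def quotient_def)

lemma one_cls: "\<one>\<^bsub>free_product V G\<^esub> = cls []"
  by (simp add: free_product_def)

lemma left_inverse_word: "w \<in> fp_words V G \<Longrightarrow> \<exists>w'\<in>fp_words V G. cls (w' @ w) = cls []"
proof (induction w)
  case Nil
  then show ?case by (auto intro: bexI[of _ "[]"])
next
  case (Cons a w)
  obtain v g where a: "a = (v, g)" by force
  with Cons have v: "v \<in> V" "g \<in> carrier (G v)" and w: "w \<in> fp_words V G" by (auto simp: words_simps)
  from Cons.IH[OF w] obtain w' where w': "w' \<in> fp_words V G" "cls (w' @ w) = cls []" by blast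
  interpret Gv: group "G v" using group_G v by blast
  let ?w = "w' @ [(v, inv\<^bsub>G v\<^esub> g)]"
  have "cls (?w @ a # w) = cls (w' @ [(v, \<one>\<^bsub>G v\<^esub>)] @ w)"
    using step_rel[OF fp_step.fp_mult[of w' V G w v "inv\<^bsub>G v\<^esub> g" g]] v w w' a by (simp add: cls_eq)
  also have "\<dots> = cls (w' @ w)"
    using v w w' by (intro cls_eq step_rel fp_step.fp_one)
  finally show ?case using v w' by (intro bexI[of _ ?w]) (auto simp: words_simps)
qed

lemma group_free_product: "group (free_product V G)"
proof (rule groupI)
  fix x y z
  assume "x \<in> carrier (free_product V G)" "y \<in> carrier (free_product V G)" "z \<in> carrier (free_product V G)"
  then show "x \<otimes>\<^bsub>free_product V G\<^esub> y \<otimes>\<^bsub>free_product V G\<^esub> z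
      = x \<otimes>\<^bsub>free_product V G\<^esub> (y \<otimes>\<^bsub>free_product V G\<^esub> z)"
    by (auto simp: carrier_cls mult_cls words_simps)
next
  fix x assume "x \<in> carrier (free_product V G)"
  then obtain w where w: "w \<in> fp_words V G" "x = cls w" by (auto simp: carrier_cls)
  then obtain w' where w': "w' \<in> fp_words V G" "cls (w' @ w) = cls []" using left_inverse_word by blast
  have "cls w' \<otimes>\<^bsub>free_product V G\<^esub> x = \<one>\<^bsub>free_product V G\<^esub>"
    using w w' by (simp add: mult_cls one_cls)
  moreover have "cls w' \<in> carrier (free_product V G)" using w' by (auto simp only: carrier_cls)
  ultimately show "\<exists>y\<in>carrier (free_product V G). y \<otimes>\<^bsub>free_product V G\<^esub> x = \<one>\<^bsub>free_product V G\<^esub>"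
    by (rule bexI)
next
  show "\<one>\<^bsub>free_product V G\<^esub> \<in> carrier (free_product V G)"
    using words_Nil by (auto simp only: carrier_cls one_cls)
next
  fix x y assume "x \<in> carrier (free_product V G)" "y \<in> carrier (free_product V G)"
  then obtain u w where "u \<in> fp_words V G" "x = cls u" "w \<in> fp_words V G" "y = cls w"
    unfolding carrier_cls by blast
  then show "x \<otimes>\<^bsub>free_product V G\<^esub> y \<in> carrier (free_product V G)"
    using words_append[of u w] by (auto simp only: carrier_cls mult_cls)
next
  fix x assume "x \<in> carrier (free_product V G)"
  then show "\<one>\<^bsub>free_product V G\<^esub> \<otimes>\<^bsub>free_product V G\<^esub> x = x"
    by (auto simp: carrier_cls one_cls mult_cls words_Nil)
qed

lemma fp_incl_hom: "v \<in> V \<Longrightarrow> fp_incl V G v \<in> hom (G v) (free_product V G)"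
proof (rule homI)
  fix x y assume v: "v \<in> V" "x \<in> carrier (G v)" "y \<in> carrier (G v)"
  then show "fp_incl V G v (x \<otimes>\<^bsub>G v\<^esub> y) = fp_incl V G v x \<otimes>\<^bsub>free_product V G\<^esub> fp_incl V G v y"
    using step_rel[OF fp_step.fp_mult[of "[]" V G "[]" v x y]]
    by (simp add: fp_incl_def mult_cls words_simps cls_eq)
qed (auto simp: fp_incl_def carrier_cls words_simps)

lemma fp_generated: 
  "generate (free_product V G) (\<Union>v\<in>V. fp_incl V G v ` carrier (G v)) = carrier (free_product V G)"
  (is "generate ?F ?H = _")
proof
  interpret F: group ?F by (rule group_free_product)
  have H: "?H \<subseteq> carrier ?F" using fp_incl_hom by (auto simp: hom_def)
  then show "generate ?F ?H \<subseteq> carrier ?F" by (rule F.generate_incl)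
  have "cls w \<in> generate ?F ?H" if "w \<in> fp_words V G" for w
    using that
  proof (induction w)
    case Nil
    show ?case using generate.one[of ?F ?H] by (simp add: one_cls)
  next
    case (Cons a w)
    obtain v g where a: "a = (v, g)" by force
    with Cons have v: "v \<in> V" "g \<in> carrier (G v)" "w \<in> fp_words V G" by (auto simp: words_simps)
    then have "fp_incl V G v g \<otimes>\<^bsub>?F\<^esub> cls w \<in> generate ?F ?H"
      using Cons.IH by (blast intro: generate.eng generate.incl)
    then show ?case using v a by (simp add: fp_incl_def mult_cls words_simps)
  qed
  then show "carrier ?F \<subseteq> generate ?F ?H" by (auto simp: carrier_cls)
qed

end

lemma (in group) normal_closure_normal:
  assumes "R \<subseteq> carrier G"
  shows "normal_closure G R \<lhd> G"
proof (rule normal_invI)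
  let ?A = "{N. N \<lhd> G \<and> R \<subseteq> N}"
  have eq: "normal_closure G R = \<Inter>?A" by (simp add: normal_closure_def hull_def)
  have ne: "carrier G \<in> ?A"
    using assms by (auto intro!: normal_invI simp: subgroup_self)
  show "subgroup (normal_closure G R) G"
    unfolding eq using ne by (intro subgroups_Inter) (auto simp: normal_imp_subgroup)
  show "x \<otimes> h \<otimes> inv x \<in> normal_closure G R" if "x \<in> carrier G" "h \<in> normal_closure G R" for x h
    using that by (auto simp: eq normal_invE)
qed

locale graph_product_setup =
  fixes \<Gamma> :: "'v pair_pre_digraph" and G :: "'v \<Rightarrow> ('a, 'b) monoid_scheme" and S :: "'v \<Rightarrow> 'a set"
  assumes graph_Gamma: "pair_graph \<Gamma>"
    and groups: "v \<in> pverts \<Gamma> \<Longrightarrow> group (G v)"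
    and generators_subset: "v \<in> pverts \<Gamma> \<Longrightarrow> S v \<subseteq> carrier (G v)"
    and generators: "v \<in> pverts \<Gamma> \<Longrightarrow> generate (G v) (S v) = carrier (G v)"
begin

sublocale vertex_groups "pverts \<Gamma>" G by (rule vertex_groups.intro) (rule groups)

abbreviation "F \<equiv> free_product (pverts \<Gamma>) G"
abbreviation "P \<equiv> graph_product \<Gamma> G"

lemma gp_relators_subset: "gp_relators \<Gamma> G \<subseteq> carrier F"
proof -
  interpret F: group F by (rule group_free_product)
  interpret \<Gamma>: pair_graph \<Gamma> by (rule graph_Gamma)
  show ?thesis
    using fp_incl_hom by (auto simp: gp_relators_def commutator_def hom_def Pi_iff dest: \<Gamma>.in_arcsD1 \<Gamma>.in_arcsD2
      intro!: F.m_closed F.inv_closed)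
qed

lemma gp_kernel_normal: "gp_kernel \<Gamma> G \<lhd> F"
  unfolding gp_kernel_def
  by (rule group.normal_closure_normal[OF group_free_product gp_relators_subset])

lemma group_graph_product: "group P"
  unfolding graph_product_def by (rule normal.factorgroup_is_group[OF gp_kernel_normal])

lemma quotient_hom: "(\<lambda>x. gp_kernel \<Gamma> G #>\<^bsub>F\<^esub> x) \<in> hom F P"
  unfolding graph_product_def by (rule normal.r_coset_hom_Mod[OF gp_kernel_normal])

lemma gp_incl_hom: "v \<in> pverts \<Gamma> \<Longrightarrow> gp_incl \<Gamma> G v \<in> hom (G v) P"
  using hom_compose[OF fp_incl_hom quotient_hom, of v] by (simp add: gp_incl_def[abs_def] o_def)

lemma gp_incl_commute:
  assumes "(v, w) \<in> parcs \<Gamma>" "g \<in> carrier (G v)" "h \<in> carrier (G w)"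
  shows "gp_incl \<Gamma> G v g \<otimes>\<^bsub>P\<^esub> gp_incl \<Gamma> G w h = gp_incl \<Gamma> G w h \<otimes>\<^bsub>P\<^esub> gp_incl \<Gamma> G v g"
proof -
  interpret F: group F by (rule group_free_product)
  interpret \<Gamma>: pair_graph \<Gamma> by (rule graph_Gamma)
  interpret P: group P by (rule group_graph_product)
  interpret K: normal "gp_kernel \<Gamma> G" F by (rule gp_kernel_normal)
  define a b where "a = fp_incl (pverts \<Gamma>) G v g" and "b = fp_incl (pverts \<Gamma>) G w h"
  have ab: "a \<in> carrier F" "b \<in> carrier F"
    using assms fp_incl_hom \<Gamma>.in_arcsD1 \<Gamma>.in_arcsD2 unfolding a_def b_def hom_def by blast+
  let ?q = "\<lambda>x. gp_kernel \<Gamma> G #>\<^bsub>F\<^esub> x"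
  have "commutator F a b \<in> gp_relators \<Gamma> G"
    using assms unfolding gp_relators_def a_def b_def by blast
  then have "commutator F a b \<in> gp_kernel \<Gamma> G"
    unfolding gp_kernel_def normal_closure_def by (rule hull_inc)
  then have "?q (commutator F a b \<otimes>\<^bsub>F\<^esub> (b \<otimes>\<^bsub>F\<^esub> a)) = ?q (b \<otimes>\<^bsub>F\<^esub> a)"
    using ab by (subst F.coset_mult_assoc[symmetric]) (auto simp: K.rcos_const[OF F.group_axioms] K.subset commutator_def)
  moreover have "commutator F a b \<otimes>\<^bsub>F\<^esub> (b \<otimes>\<^bsub>F\<^esub> a) = a \<otimes>\<^bsub>F\<^esub> b"
    using ab by (simp add: commutator_def F.m_assoc F.inv_solve_left')
  ultimately have "?q (a \<otimes>\<^bsub>F\<^esub> b) = ?q (b \<otimes>\<^bsub>F\<^esub> a)" by simp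
  then show ?thesis
    using ab hom_mult[OF quotient_hom] by (simp add: gp_incl_def a_def[symmetric] b_def[symmetric])
qed

lemma gp_generators_subset: "gp_generators \<Gamma> G S \<subseteq> carrier P"
  using gp_incl_hom generators_subset by (fastforce simp: gp_generators_def hom_def)

lemma gp_generated: "generate P (gp_generators \<Gamma> G S) = carrier P"
proof
  interpret P: group P by (rule group_graph_product)
  interpret F: group F by (rule group_free_product)
  show "generate P (gp_generators \<Gamma> G S) \<subseteq> carrier P"
    by (rule P.generate_incl[OF gp_generators_subset])
  let ?q = "\<lambda>x. gp_kernel \<Gamma> G #>\<^bsub>F\<^esub> x"
  let ?H = "\<Union>v\<in>pverts \<Gamma>. fp_incl (pverts \<Gamma>) G v ` carrier (G v)"
  interpret q: group_hom F P ?q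
    by unfold_locales (rule quotient_hom)
  have H: "?H \<subseteq> carrier F" using fp_incl_hom by (auto simp: hom_def)
  have "carrier P = ?q ` carrier F" by (simp add: graph_product_def carrier_FactGroup)
  also have "\<dots> = generate P (?q ` ?H)" using q.generate_img[OF H] by (simp add: fp_generated)
  also have "\<dots> \<subseteq> generate P (gp_generators \<Gamma> G S)"
  proof (rule P.generate_subgroup_incl)
    show "subgroup (generate P (gp_generators \<Gamma> G S)) P"
      by (rule P.generate_is_subgroup[OF gp_generators_subset])
    show "?q ` ?H \<subseteq> generate P (gp_generators \<Gamma> G S)"
    proof clarify
      fix v g assume v: "v \<in> pverts \<Gamma>" "g \<in> carrier (G v)"
      interpret i: group_hom "G v" P "gp_incl \<Gamma> G v"
        using v by (simp add: group_hom_def group_hom_axioms_def groups group_graph_product gp_incl_hom)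
      have "gp_incl \<Gamma> G v g \<in> generate P (gp_incl \<Gamma> G v ` S v)"
        using v i.generate_img[OF generators_subset] generators by auto
      also have "\<dots> \<subseteq> generate P (gp_generators \<Gamma> G S)"
        using v by (intro P.mono_generate) (auto simp: gp_generators_def)
      finally show "?q (fp_incl (pverts \<Gamma>) G v g) \<in> generate P (gp_generators \<Gamma> G S)"
        by (simp add: gp_incl_def)
    qed
  qed
  finally show "carrier P \<subseteq> generate P (gp_generators \<Gamma> G S)" .
qed

end


section \<open>The path metric of a connected graph is a metric\<close>

lemma segment_length_nonneg: "0 \<le> segment_length p q"
  by (simp add: segment_length_def sum_nonneg)

lemma segment_length_commute: "segment_length p q = segment_length q p"
  by (simp add: segment_length_def abs_minus_commute disj_commute)

lemma segment_length_eq: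
  assumes "finite c" "p \<in> cell_points c" "q \<in> cell_points c"
  shows "segment_length p q = (\<Sum>x\<in>c. \<bar>p x - q x\<bar>) / 2"
  unfolding segment_length_def using assms
  by (intro arg_cong2[of _ _ _ _ "(/)"] sum.mono_neutral_left) (auto simp: cell_points_def)

definition vertex_point :: "'x \<Rightarrow> 'x \<Rightarrow> real" where
  "vertex_point x = (\<lambda>z. if z = x then 1 else 0)"

lemma vertex_point_cell: "finite c \<Longrightarrow> x \<in> c \<Longrightarrow> vertex_point x \<in> cell_points c"
  by (auto simp: vertex_point_def cell_points_def)

lemma cell_points_single: "cell_points {x} = {vertex_point x}"
  by (auto simp: vertex_point_def cell_points_def fun_eq_iff)

locale connected_graph = pair_bidirected_digraph C for C :: "'x pair_pre_digraph" +
  assumes connected: "x \<in> pverts C \<Longrightarrow> y \<in> pverts C \<Longrightarrow> (x, y) \<in> (parcs C)\<^sup>*"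
begin

lemma cell_facts: "c \<in> geom_cells C \<Longrightarrow> finite c \<and> c \<noteq> {} \<and> c \<subseteq> pverts C"
  by (auto simp: geom_cells_def dest: in_arcsD1 in_arcsD2)

lemma segment_bound:
  assumes "c \<in> geom_cells C" "q \<in> cell_points c" "r \<in> cell_points c"
  shows "\<bar>q x - r x\<bar> \<le> 2 * segment_length q r"
proof (cases "x \<in> c")
  case True
  then show ?thesis
    using member_le_sum[of x c "\<lambda>x. \<bar>q x - r x\<bar>"] cell_facts[OF assms(1)] segment_length_eq[of c q r] assms
    by simp
next
  case False
  then show ?thesis using assms segment_length_nonneg[of q r] by (simp add: cell_points_def)
qed

lemma chain_bound: "chain_length C p q l \<Longrightarrow> \<bar>p x - q x\<bar> \<le> 2 * l"
proof (induction rule: chain_length.induct)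
  case (chain_step q l c r)
  then show ?case using segment_bound[of c q r x] by (simp add: abs_if split: if_splits)
qed simp

lemma chain_trans: "chain_length C q r m \<Longrightarrow> chain_length C p q l \<Longrightarrow> chain_length C p r (l + m)"
proof (induction rule: chain_length.induct)
  case (chain_step r m c t)
  then show ?case using chain_length.chain_step[of C p r "l + m" c t] by (simp add: add.assoc)
qed simp

lemma chain_single:
  "c \<in> geom_cells C \<Longrightarrow> q \<in> cell_points c \<Longrightarrow> r \<in> cell_points c \<Longrightarrow> chain_length C q r (segment_length q r)"
  using chain_length.chain_step[OF chain_length.chain_refl, of c C q r] by simp

lemma chain_sym: "chain_length C p q l \<Longrightarrow> chain_length C q p l"
proof (induction rule: chain_length.induct)
  case (chain_step q l c r)
  then show ?case
    using chain_trans[of q p l r "segment_length r q"] chain_single[of c r q]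
    by (simp add: segment_length_commute[of q r] add.commute)
qed (rule chain_refl)

lemma chain_vertices: "(x, y) \<in> (parcs C) ^^ n \<Longrightarrow> chain_length C (vertex_point x) (vertex_point y) (real n)"
proof (induction n arbitrary: y)
  case 0
  then show ?case using chain_refl[of C "vertex_point x"] by simp
next
  case (Suc n)
  then obtain z where z: "(x, z) \<in> (parcs C) ^^ n" "(z, y) \<in> parcs C" by auto
  then have "z \<noteq> y" "{z, y} \<in> geom_cells C" using no_loops by (force simp: geom_cells_def)+
  moreover from \<open>z \<noteq> y\<close> have "segment_length (vertex_point z) (vertex_point y) = 1"
    using segment_length_eq[of "{z,y}" "vertex_point z" "vertex_point y"]
    by (simp add: vertex_point_cell) (simp add: vertex_point_def)
  ultimately show ?case
    using chain_step[OF Suc.IH[OF z(1)], of "{z, y}" "vertex_point y"]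
    by (simp add: vertex_point_cell add.commute)
qed

lemma chain_exists:
  assumes "p \<in> realization C" "q \<in> realization C"
  shows "\<exists>l. chain_length C p q l"
proof -
  obtain c d where c: "c \<in> geom_cells C" "p \<in> cell_points c" and d: "d \<in> geom_cells C" "q \<in> cell_points d"
    using assms by (auto simp: realization_def)
  obtain x y where x: "x \<in> c" "x \<in> pverts C" and y: "y \<in> d" "y \<in> pverts C"
    using cell_facts[OF c(1)] cell_facts[OF d(1)] by blast
  obtain n where "(x, y) \<in> (parcs C) ^^ n" using connected[OF x(2) y(2)] rtrancl_power by blast
  note n = chain_vertices[OF this]
  have "chain_length C p (vertex_point x) (segment_length p (vertex_point x))"
       "chain_length C (vertex_point y) q (segment_length (vertex_point y) q)"
    using cell_facts[OF c(1)] cell_facts[OF d(1)] x y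
    by (blast intro: chain_single[OF c vertex_point_cell] chain_single[OF d(1) vertex_point_cell d(2)])+
  then show ?thesis using n chain_trans by blast
qed

lemma chain_nonneg: "chain_length C p q l \<Longrightarrow> 0 \<le> l"
  using chain_bound[of p q l undefined] by simp

lemma bdd_below_chain: "bdd_below {l. chain_length C p q l}"
  by (rule bdd_belowI[of _ 0]) (simp add: chain_nonneg)

lemma Metric_space_realization: "Metric_space (realization C) (path_dist C)"
proof
  fix x y show "0 \<le> path_dist C x y"
    using chain_exists[of x y] by (auto simp: path_dist_def intro!: cInf_greatest dest: chain_nonneg)
  have "{l. chain_length C x y l} = {l. chain_length C y x l}" using chain_sym by blast
  then show "path_dist C x y = path_dist C y x" by (simp add: path_dist_def)
next
  fix x y assume xy: "x \<in> realization C" "y \<in> realization C"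
  show "path_dist C x y = 0 \<longleftrightarrow> x = y"
  proof
    assume 0: "path_dist C x y = 0"
    have "\<bar>x z - y z\<bar> / 2 \<le> Inf {l. chain_length C x y l}" for z
      by (rule cInf_greatest) (use chain_exists[OF xy] chain_bound[of x y _ z] in force)+
    then have "\<bar>x z - y z\<bar> / 2 \<le> path_dist C x y" for z
      using xy by (simp add: path_dist_def)
    with 0 show "x = y" by (auto simp: fun_eq_iff)
  next
    assume "x = y"
    then have "path_dist C x y \<le> 0"
      using xy chain_refl[of C x] by (auto simp: path_dist_def intro!: cInf_lower bdd_below_chain)
    moreover have "0 \<le> path_dist C x y"
      using chain_exists[OF xy] xy by (auto simp: path_dist_def intro!: cInf_greatest dest: chain_nonneg)
    ultimately show "path_dist C x y = 0" by simp
  qed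
next
  fix x y z assume xyz: "x \<in> realization C" "y \<in> realization C" "z \<in> realization C"
  have "path_dist C x z - l \<le> path_dist C y z" if l: "chain_length C x y l" for l
  proof -
    have "path_dist C x z - l \<le> m" if "chain_length C y z m" for m
    proof -
      have "path_dist C x z \<le> l + m"
        using chain_trans[OF that l] xyz by (auto simp: path_dist_def intro!: cInf_lower bdd_below_chain)
      then show ?thesis by simp
    qed
    then show ?thesis
      using chain_exists[of y z] xyz unfolding path_dist_def[of C y z] by (auto intro!: cInf_greatest)
  qed
  then have "path_dist C x z - path_dist C y z \<le> l" if "chain_length C x y l" for l
    using that by (smt (verit))
  then have "path_dist C x z - path_dist C y z \<le> path_dist C x y"
    using chain_exists[of x y] xyz unfolding path_dist_def[of C x y] by (auto intro!: cInf_greatest)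
  then show "path_dist C x z \<le> path_dist C x y + path_dist C y z" by simp
qed

lemma vertex_point_realization: "x \<in> pverts C \<Longrightarrow> vertex_point x \<in> realization C"
  unfolding realization_def
  by (rule UN_I[of "{x}"]) (auto simp: geom_cells_def cell_points_single)

text \<open>On the vertices, the path metric is the combinatorial distance of the graph.\<close>

lemma path_dist_vertices:
  assumes xy: "x \<in> pverts C" "y \<in> pverts C"
  shows "path_dist C (vertex_point x) (vertex_point y) = real (LEAST n. (x, y) \<in> (parcs C) ^^ n)"
proof -
  define D where "D = (\<lambda>z. LEAST n. (x, z) \<in> (parcs C) ^^ n)"
  have D: "(x, z) \<in> (parcs C) ^^ D z" if "z \<in> pverts C" for z
    using connected[OF xy(1) that] unfolding D_def rtrancl_power by (auto intro: LeastI_ex)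
  have D_step: "D b \<le> Suc (D a)" if "(a, b) \<in> parcs C" for a b
    unfolding D_def[of] by (rule Least_le) (use D[of a] that in_arcsD1 in \<open>auto simp: D_def\<close>)
  have D_x: "D x = 0" unfolding D_def by (rule Least_eq_0) simp
  define f where "f = (\<lambda>p. \<Sum>z | p z \<noteq> (0::real). p z * real (D z))"
  have f_cell: "f p = (\<Sum>z\<in>c. p z * real (D z))" if "c \<in> geom_cells C" "p \<in> cell_points c" for p c
    unfolding f_def using that cell_facts
    by (intro sum.mono_neutral_left) (auto simp: cell_points_def)
  have f_step: "f r - f q \<le> segment_length q r"
    if c: "c \<in> geom_cells C" "q \<in> cell_points c" "r \<in> cell_points c" for c q r
  proof -
    consider a where "c = {a}" | a b where "c = {a, b}" "a \<noteq> b" "(a, b) \<in> parcs C"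
      using c(1) no_loops by (force simp: geom_cells_def)
    then show ?thesis
    proof cases
      case 1
      then show ?thesis using c segment_length_nonneg[of q r] by (simp add: cell_points_single)
    next
      case 2
      then have sums: "q b = 1 - q a" "r b = 1 - r a"
        using c(2,3) 2(1,2) by (simp_all add: cell_points_def eq_diff_eq add.commute)
      have "(b, a) \<in> parcs C" using 2(3) arcs_symmetric by blast
      then have "\<bar>real (D a) - real (D b)\<bar> \<le> 1" using D_step[of a b] D_step[of b a] 2(3) by simp
      then have "\<bar>r a - q a\<bar> * \<bar>real (D a) - real (D b)\<bar> \<le> \<bar>r a - q a\<bar> * 1"
        by (intro mult_left_mono) auto
      moreover have "f r - f q = (r a - q a) * (real (D a) - real (D b))"
        using 2(1,2) unfolding f_cell[OF c(1,2)] f_cell[OF c(1,3)] by (simp add: sums algebra_simps)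
      moreover have "segment_length q r = \<bar>r a - q a\<bar>"
        using segment_length_eq[of c q r] c(2,3) 2(1,2) by (simp add: sums)
      moreover have "(r a - q a) * (real (D a) - real (D b)) \<le> \<bar>r a - q a\<bar> * \<bar>real (D a) - real (D b)\<bar>"
        unfolding abs_mult[symmetric] by (rule abs_ge_self)
      ultimately show ?thesis by (metis (no_types) mult_1_right order_trans)
    qed
  qed
  have f_chain: "f q - f p \<le> l" if "chain_length C p q l" for p q l
    using that
  proof induction
    case (chain_step q l c r)
    then show ?case using f_step[of c q r] by simp
  qed simp
  have f_vertex: "f (vertex_point z) = real (D z)" for z
    by (simp add: f_def vertex_point_def)
  have chain_D: "chain_length C (vertex_point x) (vertex_point y) (real (D y))"
    by (rule chain_vertices) (rule D[OF xy(2)])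
  have "Inf {l. chain_length C (vertex_point x) (vertex_point y) l} = real (D y)"
    using chain_D f_chain[of "vertex_point x" "vertex_point y"]
    by (intro cInf_eq_minimum) (auto simp: f_vertex D_x)
  then show ?thesis using xy by (simp add: path_dist_def vertex_point_realization D_def)
qed

end


section \<open>The graph product acts on \<open>C_graph\<close> by isometries\<close>

context graph_product_setup begin

abbreviation "C \<equiv> C_graph \<Gamma> G S"

definition C_step :: "('v \<times> 'a) list set set \<Rightarrow> bool" where
  "C_step h \<longleftrightarrow> (\<exists>W. W \<noteq> {} \<and> W \<subset> pverts \<Gamma> \<and> h \<in> gp_subgroup \<Gamma> G W) \<or>
    h \<in> gp_generators \<Gamma> G S \<union> m_inv P ` gp_generators \<Gamma> G S"

lemma pverts_C: "pverts C = carrier P"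
  by (simp add: C_graph_def Let_def)

lemma parcs_C: "(x, y) \<in> parcs C \<longleftrightarrow>
    x \<in> carrier P \<and> y \<in> carrier P \<and> x \<noteq> y \<and> C_step (inv\<^bsub>P\<^esub> x \<otimes>\<^bsub>P\<^esub> y)"
  by (simp add: C_graph_def Let_def C_step_def)

lemma gp_subgroup_subgroup: "W \<subseteq> pverts \<Gamma> \<Longrightarrow> subgroup (gp_subgroup \<Gamma> G W) P"
  unfolding gp_subgroup_def
  by (rule group.generate_is_subgroup[OF group_graph_product]) (use gp_incl_hom in \<open>fastforce simp: hom_def\<close>)

lemma C_step_inv:
  assumes "C_step h" shows "C_step (inv\<^bsub>P\<^esub> h)"
proof -
  interpret P: group P by (rule group_graph_product)
  from assms consider W where "W \<noteq> {}" "W \<subset> pverts \<Gamma>" "h \<in> gp_subgroup \<Gamma> G W"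
    | "h \<in> gp_generators \<Gamma> G S" | t where "t \<in> gp_generators \<Gamma> G S" "h = inv\<^bsub>P\<^esub> t"
    unfolding C_step_def by blast
  then show ?thesis
  proof cases
    case (1 W)
    then have "inv\<^bsub>P\<^esub> h \<in> gp_subgroup \<Gamma> G W"
      using subgroup.m_inv_closed[OF gp_subgroup_subgroup[of W]] by blast
    with 1 show ?thesis unfolding C_step_def by blast
  next
    case 2
    then show ?thesis unfolding C_step_def by blast
  next
    case (3 t)
    then have "inv\<^bsub>P\<^esub> h \<in> gp_generators \<Gamma> G S" using gp_generators_subset by auto
    then show ?thesis unfolding C_step_def by (intro disjI2 UnI1)
  qed
qed

lemma C_bidirected: "pair_bidirected_digraph C"
proof -
  interpret P: group P by (rule group_graph_product)
  have "(y, x) \<in> parcs C" if "(x, y) \<in> parcs C" for x y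
  proof -
    have "inv\<^bsub>P\<^esub> y \<otimes>\<^bsub>P\<^esub> x = inv\<^bsub>P\<^esub> (inv\<^bsub>P\<^esub> x \<otimes>\<^bsub>P\<^esub> y)"
      using that by (simp add: parcs_C P.inv_mult_group)
    moreover have "x \<in> carrier P" "y \<in> carrier P" "y \<noteq> x" using that unfolding parcs_C by blast+
    ultimately show ?thesis
      using that C_step_inv[of "inv\<^bsub>P\<^esub> x \<otimes>\<^bsub>P\<^esub> y"] by (simp add: parcs_C)
  qed
  then have "sym (parcs C)" by (rule symI)
  moreover have "pair_loopfree_digraph C"
    by unfold_locales (auto simp: parcs_C pverts_C)
  ultimately show ?thesis
    by (simp add: pair_bidirected_digraph_def pair_sym_digraph_def pair_sym_digraph_axioms_def
        pair_loopfree_digraph_def symmetric_def)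
qed

lemma C_reach:
  "h \<in> generate P (gp_generators \<Gamma> G S) \<Longrightarrow> x \<in> carrier P \<Longrightarrow> (x, x \<otimes>\<^bsub>P\<^esub> h) \<in> (parcs C)\<^sup>*"
proof (induction arbitrary: x rule: generate.induct)
  interpret P: group P by (rule group_graph_product)
  have step: "(x, x \<otimes>\<^bsub>P\<^esub> h) \<in> (parcs C)\<^sup>*" if "C_step h" "h \<in> carrier P" "x \<in> carrier P" for h x
  proof (cases "x = x \<otimes>\<^bsub>P\<^esub> h")
    case False
    moreover have "inv\<^bsub>P\<^esub> x \<otimes>\<^bsub>P\<^esub> (x \<otimes>\<^bsub>P\<^esub> h) = h"
      using that by (simp add: P.inv_solve_left')
    ultimately show ?thesis using that by (intro r_into_rtrancl) (simp add: parcs_C)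
  qed simp
  {
    case one
    then show ?case by simp
  next
    case (incl h)
    then show ?case using gp_generators_subset by (intro step) (auto simp: C_step_def)
  next
    case (inv h)
    then show ?case using gp_generators_subset by (intro step) (auto simp: C_step_def)
  next
    case (eng h1 h2)
    then have "h1 \<in> carrier P" "h2 \<in> carrier P" by (simp_all add: gp_generated)
    then show ?case
      using eng.IH(1)[of x] eng.IH(2)[of "x \<otimes>\<^bsub>P\<^esub> h1"] eng.prems by (simp add: P.m_assoc)
  }
qed

sublocale C: connected_graph C
proof -
  interpret P: group P by (rule group_graph_product)
  interpret B: pair_bidirected_digraph C by (rule C_bidirected)
  show "connected_graph C"
  proof
    fix x y assume "x \<in> pverts C" "y \<in> pverts C"
    then have xy: "x \<in> carrier P" "y \<in> carrier P" by (simp_all add: pverts_C)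
    moreover have "x \<otimes>\<^bsub>P\<^esub> (inv\<^bsub>P\<^esub> x \<otimes>\<^bsub>P\<^esub> y) = y"
      using xy by (simp add: P.m_assoc[symmetric])
    ultimately show "(x, y) \<in> (parcs C)\<^sup>*"
      using C_reach[of "inv\<^bsub>P\<^esub> x \<otimes>\<^bsub>P\<^esub> y" x] by (simp add: gp_generated)
  qed
qed

definition push where
  "push g p = (\<lambda>x. if x \<in> carrier P then p (inv\<^bsub>P\<^esub> g \<otimes>\<^bsub>P\<^esub> x) else (0::real))"

lemma left_mult_action_eq: "left_mult_action P C g = restrict (push g) (realization C)"
  by (simp add: left_mult_action_def push_def[abs_def])

lemma push_cell:
  assumes g: "g \<in> carrier P" and c: "c \<in> geom_cells C"
  obtains d where "d \<in> geom_cells C" "\<And>p. p \<in> cell_points c \<Longrightarrow> push g p \<in> cell_points d"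
    "\<And>p q. p \<in> cell_points c \<Longrightarrow> q \<in> cell_points c \<Longrightarrow> segment_length (push g p) (push g q) = segment_length p q"
proof -
  interpret P: group P by (rule group_graph_product)
  let ?f = "\<lambda>x. g \<otimes>\<^bsub>P\<^esub> x"
  let ?d = "?f ` c"
  have cP: "c \<subseteq> carrier P" "finite c" using C.cell_facts[OF c] by (simp_all add: pverts_C)
  have inj: "inj_on ?f c" by (rule inj_onI) (use cP g P.Units_l_cancel[of g] P.Units_eq in blast)
  have arcs: "(?f x, ?f y) \<in> parcs C" if "(x, y) \<in> parcs C" for x y
  proof -
    have xy: "x \<in> carrier P" "y \<in> carrier P" using that by (auto simp: parcs_C)
    have "inv\<^bsub>P\<^esub> (?f x) \<otimes>\<^bsub>P\<^esub> ?f y = inv\<^bsub>P\<^esub> x \<otimes>\<^bsub>P\<^esub> (inv\<^bsub>P\<^esub> g \<otimes>\<^bsub>P\<^esub> (g \<otimes>\<^bsub>P\<^esub> y))"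
      using xy g by (simp add: P.inv_mult_group P.m_assoc)
    also have "\<dots> = inv\<^bsub>P\<^esub> x \<otimes>\<^bsub>P\<^esub> y"
      using xy g by (simp add: P.m_assoc[symmetric, of "inv\<^bsub>P\<^esub> g" g y])
    finally show ?thesis using that g by (simp add: parcs_C)
  qed
  have val: "push g p (?f x) = p x" if "x \<in> carrier P" for p x
    using that g by (simp add: push_def P.m_assoc[symmetric])
  have zero: "push g p z = 0" if "p \<in> cell_points c" "z \<notin> ?d" for p z
  proof (cases "z \<in> carrier P")
    case True
    then have "z = ?f (inv\<^bsub>P\<^esub> g \<otimes>\<^bsub>P\<^esub> z)" using g by (simp add: P.m_assoc[symmetric])
    then have "inv\<^bsub>P\<^esub> g \<otimes>\<^bsub>P\<^esub> z \<notin> c" using that(2) by blast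
    then show ?thesis using that(1) True by (simp add: push_def cell_points_def)
  qed (simp add: push_def)
  have pts: "push g p \<in> cell_points ?d" if p: "p \<in> cell_points c" for p
  proof -
    have "(\<Sum>z\<in>?d. push g p z) = (\<Sum>x\<in>c. push g p (?f x))"
      by (simp add: sum.reindex[OF inj])
    also have "\<dots> = (\<Sum>x\<in>c. p x)" using cP by (intro sum.cong) (auto simp: val)
    finally show ?thesis using p zero[OF p] by (auto simp: cell_points_def push_def)
  qed
  have len: "segment_length (push g p) (push g q) = segment_length p q"
    if "p \<in> cell_points c" "q \<in> cell_points c" for p q
  proof -
    have "(\<Sum>z\<in>?d. \<bar>push g p z - push g q z\<bar>) = (\<Sum>x\<in>c. \<bar>push g p (?f x) - push g q (?f x)\<bar>)"
      by (simp add: sum.reindex[OF inj])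
    also have "\<dots> = (\<Sum>x\<in>c. \<bar>p x - q x\<bar>)" using cP by (intro sum.cong) (auto simp: val)
    finally show ?thesis
      using that cP pts by (simp add: segment_length_eq[of c] segment_length_eq[of ?d])
  qed
  have "?d \<in> geom_cells C"
  proof -
    from c consider x where "c = {x}" "x \<in> pverts C" | x y where "c = {x, y}" "(x, y) \<in> parcs C"
      unfolding geom_cells_def by blast
    then show ?thesis
    proof cases
      case 1
      then have "?d = {?f x}" "?f x \<in> pverts C" using g by (simp_all add: pverts_C)
      then show ?thesis unfolding geom_cells_def by blast
    next
      case 2
      then have "?d = {?f x, ?f y}" "(?f x, ?f y) \<in> parcs C" using arcs by simp_all
      then show ?thesis unfolding geom_cells_def by blast
    qed
  qed
  with pts len that show thesis by blast
qed

lemma push_realization: "g \<in> carrier P \<Longrightarrow> p \<in> realization C \<Longrightarrow> push g p \<in> realization C"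
proof -
  assume g: "g \<in> carrier P" and "p \<in> realization C"
  then obtain c where c: "c \<in> geom_cells C" "p \<in> cell_points c" unfolding realization_def by blast
  obtain d where "d \<in> geom_cells C" "push g p \<in> cell_points d"
    by (rule push_cell[OF g c(1)]) (use c(2) in blast)
  then show ?thesis unfolding realization_def by blast
qed

lemma push_chain:
  assumes "g \<in> carrier P" shows "chain_length C p q l \<Longrightarrow> chain_length C (push g p) (push g q) l"
proof (induction rule: chain_length.induct)
  case (chain_step q l c r)
  obtain d where "d \<in> geom_cells C" "push g q \<in> cell_points d" "push g r \<in> cell_points d"
    "segment_length (push g q) (push g r) = segment_length q r"
    by (rule push_cell[OF assms chain_step.hyps(2)]) (use chain_step.hyps in blast)
  then show ?case using chain_length.chain_step[OF chain_step.IH, of d "push g r"] by simp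
qed (rule chain_refl)

lemma realization_zero: "p \<in> realization C \<Longrightarrow> x \<notin> carrier P \<Longrightarrow> p x = 0"
proof -
  assume "p \<in> realization C" and x: "x \<notin> carrier P"
  then obtain c where c: "c \<in> geom_cells C" "p \<in> cell_points c" unfolding realization_def by blast
  then have "x \<notin> c" using C.cell_facts[OF c(1)] x unfolding pverts_C by blast
  then show ?thesis using c(2) unfolding cell_points_def by blast
qed

lemma push_mult:
  assumes "g \<in> carrier P" "h \<in> carrier P"
  shows "push g (push h p) = push (g \<otimes>\<^bsub>P\<^esub> h) p"
proof -
  interpret P: group P by (rule group_graph_product)
  have eq: "inv\<^bsub>P\<^esub> h \<otimes>\<^bsub>P\<^esub> (inv\<^bsub>P\<^esub> g \<otimes>\<^bsub>P\<^esub> x) = inv\<^bsub>P\<^esub> (g \<otimes>\<^bsub>P\<^esub> h) \<otimes>\<^bsub>P\<^esub> x"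
    and closed: "inv\<^bsub>P\<^esub> g \<otimes>\<^bsub>P\<^esub> x \<in> carrier P" if "x \<in> carrier P" for x
    using assms that by (simp_all add: P.inv_mult_group P.m_assoc)
  show ?thesis unfolding push_def by (rule ext) (simp add: eq closed)
qed

lemma push_one: "p \<in> realization C \<Longrightarrow> push \<one>\<^bsub>P\<^esub> p = p"
proof -
  interpret P: group P by (rule group_graph_product)
  show "push \<one>\<^bsub>P\<^esub> p = p" if p: "p \<in> realization C"
    unfolding push_def by (rule ext) (use realization_zero[OF p] in simp)
qed

lemma push_vertex:
  assumes "g \<in> carrier P" "x \<in> carrier P"
  shows "push g (vertex_point x) = vertex_point (g \<otimes>\<^bsub>P\<^esub> x)"
proof -
  interpret P: group P by (rule group_graph_product)
  have "inv\<^bsub>P\<^esub> g \<otimes>\<^bsub>P\<^esub> z = x \<longleftrightarrow> z = g \<otimes>\<^bsub>P\<^esub> x" if z: "z \<in> carrier P" for z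
  proof
    show "inv\<^bsub>P\<^esub> g \<otimes>\<^bsub>P\<^esub> z = x" if "z = g \<otimes>\<^bsub>P\<^esub> x"
      using assms by (simp add: that P.m_assoc[symmetric])
    show "z = g \<otimes>\<^bsub>P\<^esub> x" if "inv\<^bsub>P\<^esub> g \<otimes>\<^bsub>P\<^esub> z = x"
      using assms z by (simp add: that[symmetric] P.m_assoc[symmetric])
  qed
  moreover have "g \<otimes>\<^bsub>P\<^esub> x \<in> carrier P" using assms by simp
  ultimately show ?thesis by (intro ext) (auto simp only: push_def vertex_point_def split: if_splits)
qed

text \<open>The presuppositions of acylindricity: \<open>C\<close> is a metric space, on which the graph product acts
  by isometries; on the vertices the action is left multiplication.\<close>

lemma Metric_space_C: "Metric_space (realization C) (path_dist C)"
  by (rule C.Metric_space_realization)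

lemma group_action_C: "group_action P (realization C) (left_mult_action P C)"
proof -
  interpret P: group P by (rule group_graph_product)
  have bij: "bij_betw (push g) (realization C) (realization C)" if g: "g \<in> carrier P" for g
    by (rule bij_betw_byWitness[where f' = "push (inv\<^bsub>P\<^esub> g)"])
      (use g in \<open>simp_all add: push_mult push_one push_realization image_subsetI\<close>)
  have mem: "left_mult_action P C g \<in> carrier (BijGroup (realization C))" if "g \<in> carrier P" for g
    using bij[OF that] by (simp add: BijGroup_def Bij_def left_mult_action_eq cong: bij_betw_cong)
  have "left_mult_action P C \<in> hom P (BijGroup (realization C))"
  proof (rule homI[OF mem])
    fix g h assume gh: "g \<in> carrier P" "h \<in> carrier P"
    have "left_mult_action P C (g \<otimes>\<^bsub>P\<^esub> h)
        = compose (realization C) (left_mult_action P C g) (left_mult_action P C h)"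
      by (rule ext) (use gh in \<open>simp add: left_mult_action_eq compose_def push_mult push_realization\<close>)
    then show "left_mult_action P C (g \<otimes>\<^bsub>P\<^esub> h)
        = left_mult_action P C g \<otimes>\<^bsub>BijGroup (realization C)\<^esub> left_mult_action P C h"
      using mem[OF gh(1)] mem[OF gh(2)] by (simp add: BijGroup_def)
  qed
  then show ?thesis
    by (simp add: group_action_def group_hom_def group_hom_axioms_def group_graph_product group_BijGroup)
qed

lemma left_mult_action_isometry:
  assumes "g \<in> carrier P" "p \<in> realization C" "q \<in> realization C"
  shows "path_dist C (left_mult_action P C g p) (left_mult_action P C g q) = path_dist C p q"
proof -
  interpret P: group P by (rule group_graph_product)
  have "chain_length C p q l" if "chain_length C (push g p) (push g q) l" for l
    using push_chain[of "inv\<^bsub>P\<^esub> g", OF _ that] assms by (simp add: push_mult push_one)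
  then have "{l. chain_length C (push g p) (push g q) l} = {l. chain_length C p q l}"
    using push_chain[OF assms(1)] by blast
  then show ?thesis
    using assms push_realization by (simp add: left_mult_action_eq path_dist_def)
qed

lemma left_mult_action_vertex:
  assumes "g \<in> carrier P" "x \<in> carrier P"
  shows "left_mult_action P C g (vertex_point x) = vertex_point (g \<otimes>\<^bsub>P\<^esub> x)"
  using assms C.vertex_point_realization by (simp add: left_mult_action_eq push_vertex pverts_C)

end

end

theory Submission
  imports Defs
begin

text \<open>
  Write a head map \<open>head v\<close> for the syllable of \<open>G v\<close> that can be shuffled to the front of an element. The
  hyperplane of label \<open>v\<close> at the coset \<open>x \<langle>star v\<rangle>\<close> separates \<open>r\<close> from \<open>r'\<close> if
  \<open>head v (x\<inverse> r) \<noteq> head v (x\<inverse> r')\<close>. An edge of \<open>C\<close> given by a proper subgraph without \<open>v\<close> crosses no hyperplane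
  of label \<open>v\<close>, and the hyperplanes of label \<open>v\<close> or \<open>w\<close> that separate \<open>1\<close> from \<open>y\<close> are linearly ordered unless
  \<open>v\<close> and \<open>w\<close> are adjacent.

  Suppose that the complement of \<open>\<Gamma>\<close> is connected and that \<open>g\<close> moves both \<open>1\<close> and the distant point \<open>y\<close> by at most
  \<open>e\<close>. Then \<open>g\<close> sends each hyperplane \<open>J\<close> crossing the middle of a geodesic word for \<open>y\<close> to a hyperplane that still
  separates \<open>1\<close> from \<open>y\<close>. If \<open>g J\<close> precedes \<open>g' J\<close> for one such \<open>J\<close>, then it does so for all of them, and between
  \<open>g J\<close> and \<open>g' J\<close> there is a hyperplane of each label not adjacent to that of \<open>J\<close>. Therefore a long chain
  \<open>g\<^sub>0 J, g\<^sub>1 J, \<dots>\<close> contains many segments in which all labels occur, and no edge of \<open>C\<close> passes such a segment. Since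
  \<open>g\<^sub>i J\<close> remains at the same distance from \<open>1\<close> up to \<open>2 e\<close>, such chains are bounded in length. Finally \<open>g J = g' J\<close>
  implies that \<open>g\<inverse> g'\<close> fixes all middle hyperplanes, so it is conjugate into \<open>\<Inter>v. \<langle>star v\<rangle>\<close>, which is trivial.
  If the complement of \<open>\<Gamma>\<close> is disconnected, \<open>C\<close> has diameter at most 2, and if \<open>\<Gamma>\<close> is a single vertex, balls are finite.
\<close>

section \<open>Hyperplanes\<close>

context group begin

lemma inv_mult_cancel [simp]: "x \<in> carrier G \<Longrightarrow> y \<in> carrier G \<Longrightarrow> inv x \<otimes> (x \<otimes> y) = y"
  by (simp add: m_assoc[symmetric])

lemma mult_inv_cancel [simp]: "x \<in> carrier G \<Longrightarrow> y \<in> carrier G \<Longrightarrow> x \<otimes> (inv x \<otimes> y) = y"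
  by (simp add: m_assoc[symmetric])

end

text \<open>Interface between normal forms and geometry: \<open>head v\<close> models the gate
  projection of the group onto the clique \<open>A v\<close>. The rules for left multiplication make
  it equivariant under \<open>A v\<close> and invariant under adjacent vertex groups. The last rule,
  on right multiplication, is what makes hyperplanes possible: an edge moves the projection only if
  it is parallel to \<open>A v\<close>, that is, labelled \<open>v\<close> and starting in the star
  subgroup.\<close>

locale head_system = group P for P (structure) +
  fixes V :: "'v set" and adj :: "'v \<Rightarrow> 'v \<Rightarrow> bool" and A :: "'v \<Rightarrow> 'a set"
    and head :: "'v \<Rightarrow> 'a \<Rightarrow> 'a"
  assumes finite_V: "finite V"
    and adj_V: "adj v w \<Longrightarrow> v \<in> V \<and> w \<in> V"
    and adj_sym: "adj v w \<Longrightarrow> adj w v"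
    and adj_irrefl: "\<not> adj v v"
    and A_subgroup: "v \<in> V \<Longrightarrow> subgroup (A v) P"
    and A_commute: "adj v w \<Longrightarrow> a \<in> A v \<Longrightarrow> b \<in> A w \<Longrightarrow> a \<otimes> b = b \<otimes> a"
    and A_generate: "generate P (\<Union>v\<in>V. A v) = carrier P"
    and head_in: "v \<in> V \<Longrightarrow> g \<in> carrier P \<Longrightarrow> head v g \<in> A v"
    and head_one: "v \<in> V \<Longrightarrow> head v \<one> = \<one>"
    and head_mult: "v \<in> V \<Longrightarrow> a \<in> A v \<Longrightarrow> g \<in> carrier P \<Longrightarrow> head v (a \<otimes> g) = a \<otimes> head v g"
    and head_adj: "adj v w \<Longrightarrow> b \<in> A w \<Longrightarrow> g \<in> carrier P \<Longrightarrow> head v (b \<otimes> g) = head v g"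
    and head_right: "v \<in> V \<Longrightarrow> w \<in> V \<Longrightarrow> b \<in> A w \<Longrightarrow> g \<in> carrier P \<Longrightarrow> head v (g \<otimes> b) \<noteq> head v g
      \<Longrightarrow> w = v \<and> g \<in> generate P (\<Union>u\<in>insert v {u. adj v u}. A u)"
begin

section \<open>Standard subgroups and the splitting of star subgroups\<close>

definition span :: "'v set \<Rightarrow> 'a set" where
  "span W = generate P (\<Union>v\<in>W. A v)"

definition link :: "'v \<Rightarrow> 'v set" where
  "link v = {w. adj v w}"

abbreviation star :: "'v \<Rightarrow> 'v set" where
  "star v \<equiv> insert v (link v)"

lemma link_V: "link v \<subseteq> V"
  using adj_V by (auto simp: link_def)

lemma star_V: "v \<in> V \<Longrightarrow> star v \<subseteq> V"
  using link_V by auto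

lemma A_carrier: "v \<in> V \<Longrightarrow> A v \<subseteq> carrier P"
  using A_subgroup subgroup.subset by blast

lemma A_closed: "v \<in> V \<Longrightarrow> a \<in> A v \<Longrightarrow> a \<in> carrier P"
  using A_carrier by blast

lemma A_one: "v \<in> V \<Longrightarrow> \<one> \<in> A v"
  by (rule subgroup.one_closed[OF A_subgroup])

lemma A_inv: "v \<in> V \<Longrightarrow> a \<in> A v \<Longrightarrow> inv a \<in> A v"
  by (rule subgroup.m_inv_closed[OF A_subgroup])

lemma A_mult: "v \<in> V \<Longrightarrow> a \<in> A v \<Longrightarrow> b \<in> A v \<Longrightarrow> a \<otimes> b \<in> A v"
  by (rule subgroup.m_closed[OF A_subgroup])

lemma head_closed: "v \<in> V \<Longrightarrow> g \<in> carrier P \<Longrightarrow> head v g \<in> carrier P"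
  using head_in A_closed by blast

lemma span_subgroup: "W \<subseteq> V \<Longrightarrow> subgroup (span W) P"
  unfolding span_def by (rule generate_is_subgroup) (use A_carrier in blast)

lemma span_closed: "W \<subseteq> V \<Longrightarrow> s \<in> span W \<Longrightarrow> s \<in> carrier P"
  using span_subgroup subgroup.subset by blast

lemma span_mult: "W \<subseteq> V \<Longrightarrow> s \<in> span W \<Longrightarrow> t \<in> span W \<Longrightarrow> s \<otimes> t \<in> span W"
  by (rule subgroup.m_closed[OF span_subgroup])

lemma span_inv: "W \<subseteq> V \<Longrightarrow> s \<in> span W \<Longrightarrow> inv s \<in> span W"
  by (rule subgroup.m_inv_closed[OF span_subgroup])

lemma span_one: "\<one> \<in> span W"
  unfolding span_def by (rule generate.one)

lemma span_mono: "W \<subseteq> W' \<Longrightarrow> span W \<subseteq> span W'"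
  unfolding span_def by (rule mono_generate) blast

lemma A_span: "v \<in> W \<Longrightarrow> A v \<subseteq> span W"
  unfolding span_def using generate.incl[of _ _ P] by blast

lemma span_V: "span V = carrier P"
  by (simp add: span_def A_generate)

definition words :: "'v set \<Rightarrow> ('v \<times> 'a) list set" where
  "words W = lists (SIGMA v:W. A v)"

primrec wprod :: "('v \<times> 'a) list \<Rightarrow> 'a" where
  "wprod [] = \<one>"
| "wprod (s # u) = snd s \<otimes> wprod u"

lemma words_simps [simp]:
  "[] \<in> words W"
  "s # u \<in> words W \<longleftrightarrow> fst s \<in> W \<and> snd s \<in> A (fst s) \<and> u \<in> words W"
  "u @ u' \<in> words W \<longleftrightarrow> u \<in> words W \<and> u' \<in> words W"
  by (cases s; auto simp: words_def)+

lemma words_mono: "W \<subseteq> W' \<Longrightarrow> words W \<subseteq> words W'"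
  unfolding words_def by (intro lists_mono) auto

lemma wprod_closed: "u \<in> words V \<Longrightarrow> wprod u \<in> carrier P"
  by (induction u) (auto intro: A_closed)

lemma wprod_append: "u \<in> words V \<Longrightarrow> u' \<in> words V \<Longrightarrow> wprod (u @ u') = wprod u \<otimes> wprod u'"
  by (induction u) (auto simp: wprod_closed m_assoc A_closed)

lemma wprod_span: "u \<in> words W \<Longrightarrow> W \<subseteq> V \<Longrightarrow> wprod u \<in> span W"
proof (induction u)
  case (Cons s u)
  then have "snd s \<in> span W" using A_span by force
  with Cons show ?case by (simp add: span_mult)
qed (simp add: span_one)

lemma span_word:
  assumes "g \<in> span W" "W \<subseteq> V" obtains u where "u \<in> words W" "wprod u = g"
proof -
  have "\<exists>u\<in>words W. wprod u = g"
    using assms(1) unfolding span_def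
  proof (induction rule: generate.induct)
    case one
    show ?case by (rule bexI[of _ "[]"]) auto
  next
    case (incl h)
    then obtain v where v: "v \<in> W" "h \<in> A v" by blast
    then have "h \<in> carrier P" using A_closed[of v h] assms by blast
    then show ?case using v by (intro bexI[of _ "[(v, h)]"]) simp_all
  next
    case (inv h)
    then obtain v where v: "v \<in> W" "h \<in> A v" by blast
    then have "inv h \<in> A v" using A_inv[of v h] assms by blast
    moreover have "h \<in> carrier P" using A_closed[of v h] v assms by blast
    ultimately show ?case using v by (intro bexI[of _ "[(v, inv h)]"]) simp_all
  next
    case (eng h1 h2)
    then obtain u1 u2 where "u1 \<in> words W" "wprod u1 = h1" "u2 \<in> words W" "wprod u2 = h2" by blast
    moreover from this have "u1 \<in> words V" "u2 \<in> words V" using words_mono[OF assms(2)] by blast+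
    ultimately show ?case by (intro bexI[of _ "u1 @ u2"]) (simp_all add: wprod_append)
  qed
  with that show ?thesis by blast
qed

lemma carrier_word: assumes "g \<in> carrier P" obtains u where "u \<in> words V" "wprod u = g"
  using span_word[of g V] assms by (auto simp: span_V)

definition winv :: "('v \<times> 'a) list \<Rightarrow> ('v \<times> 'a) list" where
  "winv u = rev (map (\<lambda>s. (fst s, inv (snd s))) u)"

lemma length_winv [simp]: "length (winv u) = length u"
  by (simp add: winv_def)

lemma winv_simps: "winv [] = []" "winv (s # u) = winv u @ [(fst s, inv (snd s))]"
  "winv (u @ u') = winv u' @ winv u"
  by (simp_all add: winv_def)

lemma winv_words: "u \<in> words W \<Longrightarrow> W \<subseteq> V \<Longrightarrow> winv u \<in> words W"
  by (induction u) (auto simp: winv_simps intro: A_inv)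

lemma wprod_winv: "u \<in> words V \<Longrightarrow> wprod (winv u) = inv (wprod u)"
proof (induction u)
  case (Cons s u)
  then have "(fst s, inv (snd s)) # [] \<in> words V" using A_inv[of "fst s" "snd s"] by auto
  moreover have "snd s \<in> carrier P" using Cons A_closed[of "fst s" "snd s"] by auto
  ultimately show ?case
    using Cons by (simp add: winv_simps wprod_append winv_words wprod_closed inv_mult_group)
qed (simp add: winv_simps)

lemma link_commute:
  assumes "v \<in> V" "l \<in> span (link v)" "a \<in> A v" shows "l \<otimes> a = a \<otimes> l"
proof -
  obtain u where u: "u \<in> words (link v)" "wprod u = l" using span_word assms(2) link_V by blast
  have "wprod u \<otimes> a = a \<otimes> wprod u" using u(1)
  proof (induction u)
    case Nil
    then show ?case using assms A_closed[of v a] by simp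
  next
    case (Cons s u)
    then have "fst s \<in> V" "u \<in> words V" using link_V[of v] words_mono[OF link_V] by auto
    then have c: "snd s \<in> carrier P" "wprod u \<in> carrier P" "a \<in> carrier P"
      using Cons wprod_closed[of u] assms A_closed[of "fst s" "snd s"] A_closed[of v a] by auto
    have "snd s \<otimes> a = a \<otimes> snd s" using Cons assms A_commute[of v "fst s" a "snd s"] by (simp add: link_def)
    then show ?case using Cons c by (simp add: m_assoc) (simp add: m_assoc[symmetric])
  qed
  with u show ?thesis by simp
qed

text \<open>Letters of label \<open>v\<close> can be collected on the left, because all other labels
  of the star commute with \<open>A v\<close>.\<close>

lemma span_star:
  assumes "v \<in> V" "s \<in> span W" "W \<subseteq> star v"
  obtains a l where "a \<in> A v" "l \<in> span (W - {v})" "s = a \<otimes> l" "v \<notin> W \<longrightarrow> a = \<one>"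
proof -
  have W: "W \<subseteq> V" using assms star_V by blast
  obtain u where u: "u \<in> words W" "wprod u = s" using span_word assms(2) W by blast
  have "\<exists>a l. a \<in> A v \<and> l \<in> span (W - {v}) \<and> wprod u = a \<otimes> l \<and> (v \<notin> W \<longrightarrow> a = \<one>)" using u(1)
  proof (induction u)
    case Nil
    show ?case
      using assms(1) A_one[of v] span_one[of "W - {v}"]
      by (intro exI[of _ "\<one>"]) simp
  next
    case (Cons s u)
    then obtain a l where al: "a \<in> A v" "l \<in> span (W - {v})" "wprod u = a \<otimes> l" "v \<notin> W \<longrightarrow> a = \<one>" by auto
    have lc: "l \<in> carrier P" using al W span_closed[of "W - {v}"] by blast
    have ac: "a \<in> carrier P" using al assms A_closed by blast
    have sc: "snd s \<in> carrier P" using Cons.prems W A_closed[of "fst s" "snd s"] by auto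
    show ?case
    proof (cases "fst s = v")
      case True
      then have "snd s \<otimes> a \<in> A v" using Cons al assms A_mult[of v] by simp
      moreover have "wprod (s # u) = snd s \<otimes> a \<otimes> l" using al ac lc sc by (simp add: m_assoc)
      ultimately show ?thesis using al True Cons.prems by auto
    next
      case False
      then have adj: "adj v (fst s)" using Cons.prems assms(3) by (auto simp: link_def)
      have "snd s \<in> span (W - {v})" using False Cons.prems A_span[of "fst s" "W - {v}"] by auto
      then have "snd s \<otimes> l \<in> span (W - {v})" using al W by (intro span_mult) auto
      moreover have "wprod (s # u) = a \<otimes> (snd s \<otimes> l)"
        using al ac lc sc A_commute[OF adj al(1), of "snd s"] Cons.prems
        by simp (simp add: m_assoc[symmetric])
      ultimately show ?thesis using al by blast
    qed
  qed
  with u that show ?thesis by blast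
qed

lemma head_link:
  assumes "v \<in> V" "l \<in> span (link v)" "g \<in> carrier P" shows "head v (l \<otimes> g) = head v g"
proof -
  obtain u where u: "u \<in> words (link v)" "wprod u = l" using span_word assms(2) link_V by blast
  have "head v (wprod u \<otimes> g) = head v g" using u(1)
  proof (induction u)
    case (Cons s u)
    then have "fst s \<in> V" "u \<in> words V" using link_V[of v] words_mono[OF link_V] by auto
    then have c: "snd s \<in> carrier P" "wprod u \<in> carrier P"
      using Cons wprod_closed[of u] A_closed[of "fst s" "snd s"] by auto
    then show ?case using Cons assms head_adj[of v "fst s" "snd s" "wprod u \<otimes> g"]
      by (simp add: m_assoc link_def)
  qed (use assms in simp)
  with u show ?thesis by simp
qed

text \<open>The link factor does not change heads, so an element of the star subgroup acts on them
  as left translation by its \<open>A v\<close> factor. Translations are injective, which makes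
  separation independent of the representative of the coset.\<close>

lemma head_star:
  assumes "v \<in> V" "s \<in> span (star v)"
  obtains a l where "a \<in> A v" "l \<in> span (link v)" "s = a \<otimes> l"
    "\<And>g. g \<in> carrier P \<Longrightarrow> head v (s \<otimes> g) = a \<otimes> head v g"
proof -
  obtain a l where al: "a \<in> A v" "l \<in> span (star v - {v})" "s = a \<otimes> l"
    using span_star[OF assms] by blast
  have "star v - {v} = link v" using adj_irrefl by (auto simp: link_def)
  with al have l: "l \<in> span (link v)" by simp
  have "head v (s \<otimes> g) = a \<otimes> head v g" if "g \<in> carrier P" for g
  proof -
    have "s \<otimes> g = a \<otimes> (l \<otimes> g)" using al assms A_closed[of v a] span_closed[OF link_V l] that by (simp add: m_assoc)
    then show ?thesis using al l assms that head_mult head_link span_closed[OF link_V l] by simp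
  qed
  with al l that show ?thesis by blast
qed

text \<open>Either \<open>b\<close> already lies in \<open>span W\<close>, or \<open>W\<close> is
  contained in the link and \<open>b\<close> commutes with \<open>s\<close>.\<close>

lemma span_conj:
  assumes "v \<in> V" "s \<in> span W" "W \<subseteq> star v" "b \<in> A v"
  shows "inv b \<otimes> s \<otimes> b \<in> span W"
proof (cases "v \<in> W")
  case True
  then have "b \<in> span W" using A_span assms(4) by blast
  moreover have "W \<subseteq> V" using assms star_V by blast
  ultimately show ?thesis using assms(2) by (simp add: span_mult span_inv)
next
  case False
  then have "s \<in> span (link v)" using assms span_mono[of W "link v"] by blast
  then have "s \<otimes> b = b \<otimes> s" "s \<in> carrier P" using link_commute[of v s b] assms span_closed[OF link_V, of s v] by blast+
  moreover have "b \<in> carrier P" using assms A_closed by blast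
  ultimately show ?thesis using assms(2) by (simp add: m_assoc)
qed

section \<open>Hyperplanes and their crossings with words\<close>

definition sep :: "'v \<Rightarrow> 'a \<Rightarrow> 'a \<Rightarrow> 'a \<Rightarrow> bool" where
  "sep v x r r' \<longleftrightarrow> head v (inv x \<otimes> r) \<noteq> head v (inv x \<otimes> r')"

lemma sep_refl [simp]: "\<not> sep v x r r" by (simp add: sep_def)

lemma sep_sym: "sep v x r r' \<Longrightarrow> sep v x r' r" by (simp add: sep_def)

lemma sep_left:
  assumes "g \<in> carrier P" "x \<in> carrier P" "r \<in> carrier P" "r' \<in> carrier P"
  shows "sep v (g \<otimes> x) (g \<otimes> r) (g \<otimes> r') \<longleftrightarrow> sep v x r r'"
  using assms by (simp add: sep_def inv_mult_group m_assoc)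

lemma sep_star:
  assumes "v \<in> V" "x \<in> carrier P" "x' \<in> carrier P" "r \<in> carrier P" "r' \<in> carrier P"
    and s: "inv x \<otimes> x' \<in> span (star v)"
  shows "sep v x' r r' \<longleftrightarrow> sep v x r r'"
proof -
  obtain a l where al: "a \<in> A v"
    and h: "\<And>g. g \<in> carrier P \<Longrightarrow> head v ((inv x \<otimes> x') \<otimes> g) = a \<otimes> head v g"
    using head_star[OF assms(1) s] by blast
  have e: "inv x \<otimes> g = (inv x \<otimes> x') \<otimes> (inv x' \<otimes> g)" if "g \<in> carrier P" for g
    using that assms by (simp add: m_assoc)
  have "head v (inv x \<otimes> g) = a \<otimes> head v (inv x' \<otimes> g)" if "g \<in> carrier P" for g
    using that assms by (subst e) (simp_all add: h)
  then show ?thesis using assms A_closed[OF assms(1) al] by (simp add: sep_def head_closed)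
qed

lemma sep_edge:
  assumes "v \<in> V" "w \<in> V" "b \<in> A w" "x \<in> carrier P" "r \<in> carrier P" "sep v x r (r \<otimes> b)"
  shows "w = v" "inv x \<otimes> r \<in> span (star v)"
proof -
  have "head v (inv x \<otimes> r \<otimes> b) \<noteq> head v (inv x \<otimes> r)"
    using assms A_closed[of w b] by (auto simp: sep_def m_assoc)
  then show "w = v" "inv x \<otimes> r \<in> span (star v)"
    using head_right[of v w b "inv x \<otimes> r"] assms unfolding span_def link_def by auto
qed

text \<open>Discrete intermediate value principle for the path spelled by \<open>u\<close> from
  \<open>r\<close>.\<close>

lemma cross_word:
  assumes "Q r" "\<not> Q (r \<otimes> wprod u)" "u \<in> words V" "r \<in> carrier P"
  obtains u1 v b u2 where "u = u1 @ (v, b) # u2" "Q (r \<otimes> wprod u1)" "\<not> Q (r \<otimes> wprod u1 \<otimes> b)"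
proof -
  have "\<exists>u1 v b u2. u = u1 @ (v, b) # u2 \<and> Q (r \<otimes> wprod u1) \<and> \<not> Q (r \<otimes> wprod u1 \<otimes> b)"
    using assms
  proof (induction u rule: rev_induct)
    case (snoc s u)
    show ?case
    proof (cases "Q (r \<otimes> wprod u)")
      case True
      moreover have "wprod (u @ [s]) = wprod u \<otimes> snd s"
        using snoc.prems A_closed[of "fst s" "snd s"] by (auto simp: wprod_append)
      moreover have "snd s \<in> carrier P" "wprod u \<in> carrier P" using snoc.prems A_closed[of "fst s" "snd s"] wprod_closed[of u] by auto
      ultimately show ?thesis using snoc.prems
        by (intro exI[of _ u] exI[of _ "fst s"] exI[of _ "snd s"] exI[of _ "[]"]) (simp add: m_assoc)
    next
      case False
      with snoc obtain u1 v b u2 where "u = u1 @ (v, b) # u2" "Q (r \<otimes> wprod u1)" "\<not> Q (r \<otimes> wprod u1 \<otimes> b)"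
        by auto
      then show ?thesis by (intro exI[of _ u1] exI[of _ v] exI[of _ b] exI[of _ "u2 @ [s]"]) simp
    qed
  qed simp
  with that show ?thesis by blast
qed

lemma sep_word:
  assumes "sep v x r (r \<otimes> wprod u)" "u \<in> words V" "v \<in> V" "r \<in> carrier P" "x \<in> carrier P"
  obtains u1 b u2 where "u = u1 @ (v, b) # u2" "\<not> sep v x r (r \<otimes> wprod u1)" "sep v x r (r \<otimes> wprod u1 \<otimes> b)"
    "inv x \<otimes> (r \<otimes> wprod u1) \<in> span (star v)"
proof -
  obtain u1 w b u2 where u: "u = u1 @ (w, b) # u2" "\<not> sep v x r (r \<otimes> wprod u1)" "sep v x r (r \<otimes> wprod u1 \<otimes> b)"
    by (rule cross_word[of "\<lambda>g. \<not> sep v x r g" r u]) (use assms in auto)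
  then have "sep v x (r \<otimes> wprod u1) (r \<otimes> wprod u1 \<otimes> b)" unfolding sep_def by simp
  with u assms sep_edge[of v w b x "r \<otimes> wprod u1"] have "w = v" "inv x \<otimes> (r \<otimes> wprod u1) \<in> span (star v)"
    by (simp_all add: wprod_closed)
  with u that show ?thesis by blast
qed

lemma not_sep_span:
  assumes "g \<in> span W" "W \<subseteq> V" "v \<in> V" "v \<notin> W" "r \<in> carrier P" "x \<in> carrier P"
  shows "\<not> sep v x r (r \<otimes> g)"
proof
  assume s: "sep v x r (r \<otimes> g)"
  obtain u where u: "u \<in> words W" "wprod u = g" using span_word assms by blast
  then have "u \<in> words V" using words_mono assms by blast
  with s u assms obtain u1 b u2 where "u = u1 @ (v, b) # u2"
    using sep_word[of v x r u] by metis
  with u assms show False by auto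
qed

text \<open>The crossing edge of a word with labels in \<open>W\<close> starts both in the coset of
  \<open>span W\<close> at \<open>r\<close> and on the carrier of the hyperplane. This turns
  crossing into closeness once such cosets are coned off.\<close>

lemma sep_carrier_diam:
  assumes "sep v x r (r \<otimes> g)" "g \<in> span W" "W \<subseteq> V" "v \<in> V" "r \<in> carrier P" "x \<in> carrier P"
  obtains t where "t \<in> span W" "inv x \<otimes> (r \<otimes> t) \<in> span (star v)"
proof -
  obtain u where u: "u \<in> words W" "wprod u = g" using span_word assms by blast
  then have "u \<in> words V" using words_mono assms by blast
  with assms u obtain u1 b u2 where "u = u1 @ (v, b) # u2" "inv x \<otimes> (r \<otimes> wprod u1) \<in> span (star v)"
    using sep_word[of v x r u] by metis
  with u assms that[of "wprod u1"] show thesis by (auto intro: wprod_span)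
qed

text \<open>The head is stripped off letter by letter. A letter that leaves the head of the prefix
  unchanged is kept. A letter that changes it has label \<open>v\<close> and follows a prefix
  \<open>a \<otimes> l\<close> with \<open>l\<close> in the link subgroup; it commutes past
  \<open>l\<close>, merges into the head and is dropped. So the new path stays in the fibre of
  trivial head, and a nontrivial final head costs at least one letter.\<close>

lemma project_word:
  assumes "u \<in> words V" "v \<in> V"
  shows "\<exists>u'\<in>words V. wprod u' = inv (head v (wprod u)) \<otimes> wprod u \<and> length u' \<le> length u \<and>
    (head v (wprod u) \<noteq> \<one> \<longrightarrow> length u' < length u) \<and>
    (\<forall>u1 u2. u' = u1 @ u2 \<longrightarrow> head v (wprod u1) = \<one>)"
  using assms(1)
proof (induction u rule: rev_induct)
  case Nil
  then show ?case using assms by (intro bexI[of _ "[]"]) (auto simp: head_one)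
next
  case (snoc s u)
  then obtain u' where u': "u' \<in> words V" "wprod u' = inv (head v (wprod u)) \<otimes> wprod u" "length u' \<le> length u"
    "head v (wprod u) \<noteq> \<one> \<longrightarrow> length u' < length u" "\<forall>u1 u2. u' = u1 @ u2 \<longrightarrow> head v (wprod u1) = \<one>"
    by auto
  obtain w b where s: "s = (w, b)" "w \<in> V" "b \<in> A w" using snoc.prems by (cases s) auto
  have c: "b \<in> carrier P" "wprod u \<in> carrier P" "wprod u' \<in> carrier P"
    using s snoc.prems u' A_closed[of w b] wprod_closed[of u] wprod_closed[of u'] by auto
  have hc: "head v (wprod u) \<in> carrier P" "head v (wprod u) \<in> A v" using assms c by (auto simp: head_closed head_in)
  have e: "wprod (u @ [s]) = wprod u \<otimes> b" using s c snoc.prems by (simp add: wprod_append)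
  show ?case
  proof (cases "head v (wprod u \<otimes> b) = head v (wprod u)")
    case True
    have p: "head v (wprod u' \<otimes> b) = \<one>"
    proof -
      have "inv (head v (wprod u)) \<in> A v" using hc assms A_inv by blast
      then have "head v (inv (head v (wprod u)) \<otimes> (wprod u \<otimes> b)) = inv (head v (wprod u)) \<otimes> head v (wprod u)"
        using True assms c by (simp add: head_mult)
      then show ?thesis using c hc u' by (simp add: m_assoc)
    qed
    have "head v (wprod u1) = \<one>" if "u' @ [s] = u1 @ u2" for u1 u2
    proof (cases u2 rule: rev_cases)
      case Nil
      then show ?thesis using that p s u' c by (auto simp: wprod_append)
    next
      case (snoc)
      then show ?thesis using that u'(5) by auto
    qed
    moreover have "wprod (u' @ [s]) = inv (head v (wprod u)) \<otimes> (wprod u \<otimes> b)"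
      using u' s c hc by (simp add: wprod_append m_assoc)
    ultimately show ?thesis
      unfolding e True using u' s by (intro bexI[of _ "u' @ [s]"]) simp_all
  next
    case False
    then have w: "w = v" "wprod u \<in> span (star v)"
      using head_right[of v w b "wprod u"] assms s c unfolding span_def link_def by auto
    obtain a l where al: "a \<in> A v" "l \<in> span (link v)" "wprod u = a \<otimes> l"
      and h: "\<And>g. g \<in> carrier P \<Longrightarrow> head v (wprod u \<otimes> g) = a \<otimes> head v g"
        using head_star[OF assms(2) w(2)] by blast
    have cc: "a \<in> carrier P" "l \<in> carrier P" using al assms A_closed[of v a] span_closed[OF link_V] by blast+
    have 1: "head v (wprod u) = a" using h[of "\<one>"] c cc assms by (simp add: head_one)
    have "head v b = b" using head_mult[of v b "\<one>"] s w c assms by (simp add: head_one)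
    then have 2: "head v (wprod u \<otimes> b) = a \<otimes> b" using h c by simp
    have "l \<otimes> b = b \<otimes> l" using link_commute al s w by simp
    then have "inv (a \<otimes> b) \<otimes> (wprod u \<otimes> b) = wprod u'"
      using 1 al u' c cc by (simp add: inv_mult_group m_assoc)
    then show ?thesis using u' 2 e by (intro bexI[of _ u']) auto
  qed
qed

section \<open>Geodesic words and the hyperplanes they cross\<close>

definition minimal :: "('v \<times> 'a) list \<Rightarrow> bool" where
  "minimal u \<longleftrightarrow> u \<in> words V \<and> (\<forall>u'\<in>words V. wprod u' = wprod u \<longrightarrow> length u \<le> length u')"

lemma minimal_words: "minimal u \<Longrightarrow> u \<in> words V" by (simp add: minimal_def)

lemma minimal_exists: assumes "g \<in> carrier P" obtains u where "minimal u" "wprod u = g"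
proof -
  obtain u0 where "u0 \<in> words V" "wprod u0 = g" using carrier_word[OF assms] .
  then have "\<exists>u. u \<in> words V \<and> wprod u = g" by blast
  from ex_has_least_nat[OF this[THEN exE], of _ length] obtain u where
    "u \<in> words V" "wprod u = g" "\<forall>u'. u' \<in> words V \<and> wprod u' = g \<longrightarrow> length u \<le> length u'"
    using ex_has_least_nat[of "\<lambda>u. u \<in> words V \<and> wprod u = g" u0 length] \<open>u0 \<in> words V\<close> \<open>wprod u0 = g\<close> by blast
  with that show ?thesis unfolding minimal_def by blast
qed

lemma minimal_append: assumes "minimal (u1 @ u2)" shows "minimal u1" "minimal u2"
proof -
  have w: "u1 \<in> words V" "u2 \<in> words V" using assms by (auto simp: minimal_def)
  have "length u1 \<le> length u'" if "u' \<in> words V" "wprod u' = wprod u1" for u'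
    using assms[unfolded minimal_def, THEN conjunct2, rule_format, of "u' @ u2"] that w by (simp add: wprod_append)
  with w show "minimal u1" by (simp add: minimal_def)
  have "length u2 \<le> length u'" if "u' \<in> words V" "wprod u' = wprod u2" for u'
    using assms[unfolded minimal_def, THEN conjunct2, rule_format, of "u1 @ u'"] that w by (simp add: wprod_append)
  with w show "minimal u2" by (simp add: minimal_def)
qed

lemma minimal_winv: assumes "minimal u" shows "minimal (winv u)"
proof -
  have w: "u \<in> words V" using assms by (simp add: minimal_def)
  have "length u \<le> length u'" if "u' \<in> words V" "wprod u' = wprod (winv u)" for u'
    using assms[unfolded minimal_def, THEN conjunct2, rule_format, of "winv u'"] that w
    by (simp add: wprod_winv winv_words wprod_closed)
  with w show ?thesis by (simp add: minimal_def winv_words)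
qed

text \<open>A trivial first letter could be deleted. A nontrivial head of the rest could be merged
  into the first letter, and \<open>project_word\<close> would spell what remains with fewer
  letters.\<close>

lemma minimal_Cons: assumes "minimal ((v, a) # u)" shows "a \<noteq> \<one>" "head v (wprod u) = \<one>"
proof -
  have w: "v \<in> V" "a \<in> A v" "u \<in> words V" using minimal_words[OF assms] by auto
  then have c: "a \<in> carrier P" "wprod u \<in> carrier P" by (auto intro: A_closed wprod_closed)
  have m: "Suc (length u) \<le> length u'" if "u' \<in> words V" "wprod u' = a \<otimes> wprod u" for u'
    using assms that by (simp add: minimal_def)
  show "a \<noteq> \<one>" using m[of u] w c by auto
  obtain u' where u': "u' \<in> words V" "wprod u' = inv (head v (wprod u)) \<otimes> wprod u"
    "head v (wprod u) \<noteq> \<one> \<longrightarrow> length u' < length u"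
    using project_word[OF w(3,1)] by blast
  show "head v (wprod u) = \<one>"
  proof (rule ccontr)
    assume "head v (wprod u) \<noteq> \<one>"
    moreover have "a \<otimes> head v (wprod u) \<in> A v" using w c by (intro A_mult head_in)
    ultimately show False
      using m[of "(v, a \<otimes> head v (wprod u)) # u'"] u' w c head_closed[of v "wprod u"] by (simp add: m_assoc)
  qed
qed

text \<open>Apply \<open>minimal_Cons\<close> to the tail that starts with the letter and, through
  \<open>winv\<close>, to the initial part that ends with it. Both ends of the geodesic thus lie on
  the sides of the corresponding ends of that letter.\<close>

lemma minimal_sep:
  assumes "minimal (u1 @ (v, a) # u2)"
  shows "\<not> sep v (wprod u1) \<one> (wprod u1)" "\<not> sep v (wprod u1) (wprod u1 \<otimes> a) (wprod (u1 @ (v, a) # u2))"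
    "sep v (wprod u1) (wprod u1) (wprod u1 \<otimes> a)"
proof -
  have w: "v \<in> V" "a \<in> A v" "u1 \<in> words V" "u2 \<in> words V" using minimal_words[OF assms] by auto
  then have c: "a \<in> carrier P" "wprod u1 \<in> carrier P" "wprod u2 \<in> carrier P" by (auto intro: A_closed wprod_closed)
  have "minimal ((v, a) # u2)" using minimal_append[OF assms] by simp
  note 1 = minimal_Cons[OF this]
  have "minimal (winv (u1 @ [(v, a)]))" by (rule minimal_winv) (use minimal_append(1)[of "u1 @ [(v,a)]" u2] assms in simp)
  then have "minimal ((v, inv a) # winv u1)" by (simp add: winv_simps)
  from minimal_Cons(2)[OF this] have 2: "head v (inv (wprod u1)) = \<one>" using w by (simp add: wprod_winv)
  have e: "wprod (u1 @ (v, a) # u2) = wprod u1 \<otimes> (a \<otimes> wprod u2)" using w by (simp add: wprod_append)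
  have ha: "head v a = a" using head_mult[of v a "\<one>"] w c by (simp add: head_one)
  show "\<not> sep v (wprod u1) \<one> (wprod u1)" using 2 c w by (simp add: sep_def head_one)
  show "\<not> sep v (wprod u1) (wprod u1 \<otimes> a) (wprod (u1 @ (v, a) # u2))"
    using 1 c w ha by (simp add: sep_def e head_mult)
  show "sep v (wprod u1) (wprod u1) (wprod u1 \<otimes> a)"
    using 1 c w ha by (simp add: sep_def head_one)
qed

text \<open>Every letter of a geodesic word for \<open>g\<close> yields a hyperplane of its label
  that separates \<open>\<one>\<close> from \<open>g\<close>, so the word uses labels of
  \<open>U\<close> only.\<close>

lemma span_labels:
  assumes "g \<in> carrier P" "U \<subseteq> V" "\<And>v x. v \<in> V - U \<Longrightarrow> x \<in> carrier P \<Longrightarrow> \<not> sep v x \<one> g"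
  shows "g \<in> span U"
proof -
  obtain u where u: "minimal u" "wprod u = g" using minimal_exists[OF assms(1)] .
  have "s \<in> (SIGMA v:U. A v)" if "s \<in> set u" for s
  proof -
    obtain v a where s: "s = (v, a)" by force
    obtain u1 u2 where e: "u = u1 @ (v, a) # u2" using \<open>s \<in> set u\<close> s split_list by metis
    then have w: "v \<in> V" "a \<in> A v" "u1 \<in> words V" using minimal_words[OF u(1)] by auto
    have "sep v (wprod u1) \<one> g"
      using minimal_sep[OF u(1)[unfolded e]] u(2) unfolding e sep_def by simp
    then have "v \<in> U" using assms(3)[of v "wprod u1"] w wprod_closed by blast
    then show ?thesis using s w by simp
  qed
  then have "u \<in> words U" unfolding words_def by blast
  then show ?thesis using wprod_span u assms by blast
qed

text \<open>A word without a label crosses no hyperplane of that label, so the labels separating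
  \<open>\<one>\<close> from \<open>g\<close> belong to both sets and \<open>span_labels\<close>
  applies.\<close>

lemma span_Int: assumes "g \<in> span U" "g \<in> span W" "U \<subseteq> V" "W \<subseteq> V" shows "g \<in> span (U \<inter> W)"
proof (rule span_labels)
  show g: "g \<in> carrier P" using assms span_closed by blast
  fix v x assume v: "v \<in> V - U \<inter> W" and x: "x \<in> carrier P"
  have "\<not> sep v x \<one> (\<one> \<otimes> g)" if "g \<in> span Y" "v \<notin> Y" "Y \<subseteq> V" for Y
    using not_sep_span[of g Y v "\<one>" x] that v x by simp
  then show "\<not> sep v x \<one> g" using v assms g by auto
qed (use assms in blast)

end

section \<open>Half-spaces and their translates\<close>

context head_system begin

text \<open>A hyperplane of label \<open>v\<close> has one side for each value of the head; this set
  unites all sides that do not contain \<open>\<one>\<close>. The base point \<open>\<one>\<close>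
  is built in, which is why left translates need care.\<close>

definition halfspace :: "'v \<Rightarrow> 'a \<Rightarrow> 'a set" where
  "halfspace v x = {r \<in> carrier P. sep v x \<one> r}"

lemma halfspace_carrier: "halfspace v x \<subseteq> carrier P"
  by (auto simp: halfspace_def)

lemma one_notin_halfspace: "\<one> \<notin> halfspace v x"
  by (simp add: halfspace_def)

lemma halfspace_star:
  assumes "v \<in> V" "x \<in> carrier P" "x' \<in> carrier P" "inv x \<otimes> x' \<in> span (star v)"
  shows "halfspace v x' = halfspace v x"
  using sep_star[of v x x' \<one>] assms by (auto simp: halfspace_def)

lemma halfspace_edge:
  assumes "r \<notin> halfspace v x" "r \<otimes> b \<in> halfspace v x" "b \<in> A w" "v \<in> V" "w \<in> V" "x \<in> carrier P" "r \<in> carrier P"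
  shows "w = v" "inv x \<otimes> r \<in> span (star v)"
proof -
  have "sep v x r (r \<otimes> b)" using assms by (auto simp: halfspace_def sep_def)
  then show "w = v" "inv x \<otimes> r \<in> span (star v)" using sep_edge assms by blast+
qed

lemma halfspace_boundary:
  assumes "v \<in> V" "x \<in> carrier P" "y \<in> halfspace v x"
  obtains r b where "r \<in> carrier P" "b \<in> A v" "r \<notin> halfspace v x" "r \<otimes> b \<in> halfspace v x"
    "inv x \<otimes> r \<in> span (star v)"
proof -
  have y: "y \<in> carrier P" using assms halfspace_carrier by blast
  then obtain u where u: "u \<in> words V" "wprod u = y" using carrier_word by blast
  then obtain u1 w b u2 where s: "u = u1 @ (w, b) # u2" "\<one> \<otimes> wprod u1 \<notin> halfspace v x"
    "\<not> \<one> \<otimes> wprod u1 \<otimes> b \<notin> halfspace v x"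
    by (rule_tac cross_word[of "\<lambda>g. g \<notin> halfspace v x" \<one> u]) (use y assms one_notin_halfspace in auto)
  then have c: "wprod u1 \<in> carrier P" "w \<in> V" "b \<in> A w" using u wprod_closed by auto
  then show thesis using that[of "wprod u1" b] s assms halfspace_edge[of "wprod u1" v x b w] by auto
qed

text \<open>A nonempty half-space has a boundary edge, and this edge determines both the label and
  the carrier coset.\<close>

lemma halfspace_inj:
  assumes "halfspace v x = halfspace w z" "y \<in> halfspace v x" "v \<in> V" "w \<in> V" "x \<in> carrier P" "z \<in> carrier P"
  shows "v = w" "inv z \<otimes> x \<in> span (star v)"
proof -
  obtain r b where r: "r \<in> carrier P" "b \<in> A v" "r \<notin> halfspace v x" "r \<otimes> b \<in> halfspace v x"
    "inv x \<otimes> r \<in> span (star v)"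
    using halfspace_boundary assms by blast
  then have *: "v = w" "inv z \<otimes> r \<in> span (star v)" using halfspace_edge[of r w z b v] assms by auto
  have "inv z \<otimes> x = (inv z \<otimes> r) \<otimes> inv (inv x \<otimes> r)"
    using r assms by (simp add: inv_mult_group m_assoc)
  moreover have "\<dots> \<in> span (star v)"
    using span_mult[OF star_V[OF assms(3)] *(2) span_inv[OF star_V[OF assms(3)] r(5)]] .
  ultimately show "v = w" "inv z \<otimes> x \<in> span (star v)" using * by auto
qed

text \<open>A word in the star of \<open>v\<close> crosses a hyperplane of label \<open>w\<close>
  only at a letter \<open>w\<close>. Since \<open>w\<close> is not adjacent to \<open>v\<close>,
  this forces \<open>w = v\<close>; then the carriers meet and the hyperplanes coincide.\<close>

lemma carrier_side:
  assumes "v \<in> V" "w \<in> V" "\<not> adj v w" "x \<in> carrier P" "z \<in> carrier P" "s \<in> span (star v)"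
    and ne: "\<not> (v = w \<and> inv z \<otimes> x \<in> span (star v))"
  shows "\<not> sep w z x (x \<otimes> s)"
proof
  assume sep: "sep w z x (x \<otimes> s)"
  obtain u where u: "u \<in> words (star v)" "wprod u = s" using span_word assms star_V by blast
  then have uV: "u \<in> words V" using words_mono star_V assms by blast
  obtain u1 b u2 where s: "u = u1 @ (w, b) # u2" "inv z \<otimes> (x \<otimes> wprod u1) \<in> span (star w)"
    by (rule sep_word[of w z x u]) (use sep u uV assms in auto)
  then have "w \<in> star v" using u by auto
  then have "w = v" using assms by (simp add: link_def)
  have u1: "wprod u1 \<in> span (star v)" "wprod u1 \<in> carrier P"
    using s u uV wprod_span[of u1 "star v"] star_V assms wprod_closed[of u1] by auto
  have "inv z \<otimes> x = (inv z \<otimes> (x \<otimes> wprod u1)) \<otimes> inv (wprod u1)" using u1 assms by (simp add: m_assoc)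
  moreover have "\<dots> \<in> span (star v)"
    using span_mult[OF star_V[OF assms(1)] _ span_inv[OF star_V[OF assms(1)] u1(1)]] s(2) \<open>w = v\<close> by blast
  ultimately show False using ne \<open>w = v\<close> by simp
qed

text \<open>Walk from \<open>z\<close> to \<open>r\<close> by first moving along \<open>c\<close> to
  the side of \<open>r\<close> at the hyperplane of \<open>z\<close>, and then staying on that side.
  If the hyperplane of \<open>x\<close> separates \<open>r\<close> from \<open>z\<close>, the second
  stretch crosses it, so its carrier has a point on the side of \<open>r\<close>. By
  \<open>carrier_side\<close> the whole carrier, including \<open>x\<close>, is on that
  side.\<close>

lemma nested:
  assumes "v \<in> V" "w \<in> V" "\<not> adj v w" "x \<in> carrier P" "z \<in> carrier P" "r \<in> carrier P"
    and ne: "\<not> (v = w \<and> inv z \<otimes> x \<in> span (star v))"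
  shows "\<not> sep w z r x \<or> \<not> sep v x r z"
proof (rule ccontr)
  assume "\<not> ?thesis"
  then have 1: "sep w z r x" and 2: "sep v x r z" by auto
  define c where "c = head w (inv z \<otimes> r)"
  have c: "c \<in> A w" "c \<in> carrier P" using assms head_in A_closed unfolding c_def by auto
  have "inv z \<otimes> r \<in> carrier P" using assms by simp
  then obtain u where u: "u \<in> words V" "wprod u = inv z \<otimes> r" by (rule carrier_word)
  obtain u' where u': "u' \<in> words V" "wprod u' = inv c \<otimes> (inv z \<otimes> r)"
    "\<forall>u1 u2. u' = u1 @ u2 \<longrightarrow> head w (wprod u1) = \<one>"
    using project_word[OF u(1) assms(2)] unfolding u c_def by blast
  \<comment> \<open>An edge of the clique at \<open>z\<close> that crosses the hyperplane of
    \<open>x\<close> would make the two hyperplanes equal.\<close>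
  have "\<not> sep v x z (z \<otimes> c)"
  proof
    assume "sep v x z (z \<otimes> c)"
    from sep_edge[OF assms(1,2) c(1) assms(4,5) this] have *: "w = v" "inv x \<otimes> z \<in> span (star v)" by auto
    have "inv z \<otimes> x = inv (inv x \<otimes> z)" using assms by (simp add: inv_mult_group)
    then have "inv z \<otimes> x \<in> span (star v)" using * span_inv[OF star_V] assms by simp
    with ne * show False by simp
  qed
  moreover have "r = z \<otimes> c \<otimes> wprod u'" using u' c assms by (simp add: m_assoc)
  ultimately have "sep v x (z \<otimes> c) (z \<otimes> c \<otimes> wprod u')" using 2 unfolding sep_def by simp
  then obtain u1 b u2 where s: "u' = u1 @ (v, b) # u2" "inv x \<otimes> (z \<otimes> c \<otimes> wprod u1) \<in> span (star v)"
    by (rule sep_word) (use u' c assms in auto)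
  have u1: "wprod u1 \<in> carrier P" using u' s wprod_closed by auto
  have "\<not> sep w z x (x \<otimes> (inv x \<otimes> (z \<otimes> c \<otimes> wprod u1)))" using carrier_side assms s by blast
  then have "\<not> sep w z x (z \<otimes> c \<otimes> wprod u1)" using u1 c assms by simp
  moreover have "head w (inv z \<otimes> (z \<otimes> c \<otimes> wprod u1)) = c"
    using head_mult[OF assms(2) c(1) u1] u'(3) s(1) c u1 assms by (simp add: m_assoc)
  ultimately show False using 1 unfolding sep_def c_def by simp
qed

text \<open>By \<open>nested\<close> at \<open>\<one>\<close>, one of the carriers is on the side of
  \<open>\<one>\<close> of the other hyperplane. If this is \<open>x\<close>, every point of
  \<open>halfspace w z\<close> is on the side of \<open>z\<close> at the hyperplane of
  \<open>x\<close>; so is the common point \<open>y\<close>, which shows that this side is not that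
  of \<open>\<one>\<close>. The other case is symmetric.\<close>

lemma halfspace_comparable:
  assumes "v \<in> V" "w \<in> V" "\<not> adj v w" "x \<in> carrier P" "z \<in> carrier P" "y \<in> halfspace v x" "y \<in> halfspace w z"
  shows "halfspace v x \<subseteq> halfspace w z \<or> halfspace w z \<subseteq> halfspace v x"
proof (cases "v = w \<and> inv z \<otimes> x \<in> span (star v)")
  case True
  then show ?thesis using halfspace_star[of v z x] assms by auto
next
  case False
  note n = nested[OF assms(1-5) _ False]
  have y: "y \<in> carrier P" "sep v x \<one> y" "sep w z \<one> y" using assms by (auto simp: halfspace_def)
  consider "\<not> sep w z \<one> x" | "\<not> sep v x \<one> z" using n[of \<one>] by auto
  then show ?thesis
  proof cases
    case 1
    have "r \<in> halfspace v x" if "r \<in> halfspace w z" for r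
      using n[of r] n[of y] 1 y that unfolding halfspace_def sep_def by auto
    then show ?thesis by blast
  next
    case 2
    have "r \<in> halfspace w z" if "r \<in> halfspace v x" for r
      using n[of r] n[of y] 2 y that unfolding halfspace_def sep_def by auto
    then show ?thesis by blast
  qed
qed

section \<open>Half-spaces between \<open>\<one>\<close> and a point, and their left
  translates\<close>

definition halfspaces :: "'a \<Rightarrow> 'v \<Rightarrow> 'a set set" where
  "halfspaces y v = {S. \<exists>x\<in>carrier P. S = halfspace v x \<and> y \<in> S}"

lemma halfspaces_comparable:
  assumes "S \<in> halfspaces y v" "T \<in> halfspaces y w" "v \<in> V" "w \<in> V" "\<not> adj v w"
  shows "S \<subseteq> T \<or> T \<subseteq> S"
  using assms halfspace_comparable unfolding halfspaces_def by blast

lemma halfspaces_label: "S \<in> halfspaces y v \<Longrightarrow> S \<in> halfspaces y' w \<Longrightarrow> v \<in> V \<Longrightarrow> w \<in> V \<Longrightarrow> v = w"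
  unfolding halfspaces_def using halfspace_inj(1) by blast

lemma halfspaces_carrier: "S \<in> halfspaces y v \<Longrightarrow> S \<subseteq> carrier P"
  unfolding halfspaces_def using halfspace_carrier by blast

text \<open>The obstruction used for counting: an edge of the coned-off graph omits some label, and
  half-spaces of that label stop it.\<close>

lemma halfspaces_span:
  assumes "S \<in> halfspaces y v" "v \<in> V" "r \<in> carrier P" "r' \<in> carrier P" "inv r \<otimes> r' \<in> span (V - {v})"
  shows "r \<in> S \<longleftrightarrow> r' \<in> S"
proof -
  obtain x where x: "x \<in> carrier P" "S = halfspace v x" using assms unfolding halfspaces_def by blast
  have "\<not> sep v x r (r \<otimes> (inv r \<otimes> r'))" by (rule not_sep_span) (use assms x in auto)
  then show ?thesis using assms x by (simp add: halfspace_def sep_def)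
qed

text \<open>A fixed word for \<open>y\<close> crosses each of these half-spaces at one of its
  finitely many prefixes.\<close>

lemma finite_halfspaces: assumes "y \<in> carrier P" "v \<in> V" shows "finite (halfspaces y v)"
proof -
  obtain u where u: "u \<in> words V" "wprod u = y" using carrier_word assms by blast
  have "S \<in> (\<lambda>i. halfspace v (wprod (take i u))) ` {..length u}" if S: "S \<in> halfspaces y v" for S
  proof -
    obtain x where x: "x \<in> carrier P" "S = halfspace v x" "y \<in> S" using S unfolding halfspaces_def by blast
    obtain u1 w b u2 where s: "u = u1 @ (w, b) # u2" "\<one> \<otimes> wprod u1 \<notin> S" "\<not> \<one> \<otimes> wprod u1 \<otimes> b \<notin> S"
      by (rule cross_word[of "\<lambda>g. g \<notin> S" \<one> u]) (use x u assms one_notin_halfspace in auto)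
    then have c: "wprod u1 \<in> carrier P" "w \<in> V" "b \<in> A w" using u wprod_closed by auto
    then have "inv x \<otimes> wprod u1 \<in> span (star v)"
      using halfspace_edge[of "wprod u1" v x b w] s x assms by auto
    then have "S = halfspace v (wprod (take (length u1) u))"
      using halfspace_star[of v x "wprod u1"] s x c assms by simp
    then show ?thesis using s by (intro image_eqI[of _ _ "length u1"]) auto
  qed
  then have "halfspaces y v \<subseteq> (\<lambda>i. halfspace v (wprod (take i u))) ` {..length u}" by blast
  then show ?thesis by (rule finite_subset) simp
qed

definition lmul :: "'a \<Rightarrow> 'a set \<Rightarrow> 'a set" where
  "lmul g S = (\<lambda>r. g \<otimes> r) ` S"

lemma lmul_mem: "g \<in> carrier P \<Longrightarrow> r \<in> carrier P \<Longrightarrow> S \<subseteq> carrier P \<Longrightarrow> g \<otimes> r \<in> lmul g S \<longleftrightarrow> r \<in> S"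
  using Units_l_cancel[of g] unfolding lmul_def by (auto simp: subset_iff Units_eq)

lemma lmul_subset: "g \<in> carrier P \<Longrightarrow> S \<subseteq> carrier P \<Longrightarrow> T \<subseteq> carrier P \<Longrightarrow> lmul g S \<subseteq> lmul g T \<longleftrightarrow> S \<subseteq> T"
  using lmul_mem[of g _ T] unfolding lmul_def by (auto simp: subset_iff)

lemma lmul_psubset: "g \<in> carrier P \<Longrightarrow> S \<subseteq> carrier P \<Longrightarrow> T \<subseteq> carrier P \<Longrightarrow> lmul g S \<subset> lmul g T \<longleftrightarrow> S \<subset> T"
  unfolding psubset_eq set_eq_subset using lmul_subset[of g S T] lmul_subset[of g T S] by blast

text \<open>Translation moves the base point from \<open>\<one>\<close> to \<open>g\<close>. The
  translate is again a \<open>halfspace\<close> as soon as the translated hyperplane does not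
  separate \<open>\<one>\<close> from \<open>g\<close>.\<close>

lemma lmul_halfspace:
  assumes "g \<in> carrier P" "x \<in> carrier P"
  shows "lmul g (halfspace v x) = {r \<in> carrier P. sep v (g \<otimes> x) g r}"
proof -
  have "r \<in> lmul g (halfspace v x) \<longleftrightarrow> sep v (g \<otimes> x) g r" if r: "r \<in> carrier P" for r
  proof -
    have "r \<in> lmul g (halfspace v x) \<longleftrightarrow> sep v x \<one> (inv g \<otimes> r)"
      using lmul_mem[of g "inv g \<otimes> r" "halfspace v x"] halfspace_carrier assms r by (simp add: halfspace_def)
    also have "\<dots> \<longleftrightarrow> sep v (g \<otimes> x) (g \<otimes> \<one>) (g \<otimes> (inv g \<otimes> r))" using assms r by (subst sep_left) auto
    finally show ?thesis using assms r by simp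
  qed
  moreover have "lmul g (halfspace v x) \<subseteq> carrier P"
    using halfspace_carrier assms unfolding lmul_def by (auto simp: subset_iff)
  ultimately show ?thesis by blast
qed

end

text \<open>
  The word \<open>u\<close> is the part of a minimal word of \<open>y\<close> far from both ends. By \<open>E_start\<close> and \<open>E_end\<close> the translates by
  \<open>E\<close> of the hyperplanes crossed by \<open>u\<close> do not leave the corridor between \<open>1\<close> and \<open>y\<close>.
\<close>

locale axis = head_system +
  fixes u0 u u3 :: "('c \<times> 'a) list" and y p q :: 'a and E :: "'a set"
  assumes minimal_axis: "minimal (u0 @ u @ u3)"
    and y_def: "y = wprod (u0 @ u @ u3)" and p_def: "p = wprod u0" and q_def: "q = wprod (u0 @ u)"
    and labels: "v \<in> V \<Longrightarrow> \<exists>u1 b u2. u = u1 @ (v, b) # u2"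
    and connected: "v \<in> V \<Longrightarrow> w \<in> V \<Longrightarrow> (v, w) \<in> {(a, b). a \<in> V \<and> b \<in> V \<and> a \<noteq> b \<and> \<not> adj a b}\<^sup>*"
    and two_vertices: "V \<noteq> {a}"
    and E_carrier: "E \<subseteq> carrier P"
    and E_start: "g \<in> E \<Longrightarrow> u = u1 @ (v, b) # u2 \<Longrightarrow> \<not> sep v (g \<otimes> wprod (u0 @ u1)) \<one> g"
    and E_end: "g \<in> E \<Longrightarrow> u = u1 @ (v, b) # u2 \<Longrightarrow> \<not> sep v (g \<otimes> wprod (u0 @ u1)) y (g \<otimes> y)"
begin

lemma axis_words: "u0 \<in> words V" "u \<in> words V" "u3 \<in> words V"
  using minimal_words[OF minimal_axis] by auto

lemma axis_closed: "p \<in> carrier P" "q \<in> carrier P" "y \<in> carrier P"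
  using axis_words wprod_closed by (auto simp: p_def q_def y_def)

lemma q_eq: "q = p \<otimes> wprod u"
  using axis_words by (simp add: q_def p_def wprod_append)

section \<open>Half-spaces crossed by the middle word\<close>

definition mid :: "'c \<Rightarrow> 'a set set" where
  "mid v = {S \<in> halfspaces y v. p \<notin> S \<and> q \<in> S}"

lemma mid_halfspaces: "S \<in> mid v \<Longrightarrow> S \<in> halfspaces y v"
  by (simp add: mid_def)

lemma mid_carrier: "S \<in> mid v \<Longrightarrow> S \<subseteq> carrier P"
  using mid_halfspaces halfspaces_carrier by blast

lemma finite_mid: "v \<in> V \<Longrightarrow> finite (mid v)"
  using finite_halfspaces[OF axis_closed(3)] unfolding mid_def by simp

text \<open>Subwords of a geodesic are geodesic, so \<open>minimal_sep\<close> applies with three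
  pairs of ends: \<open>\<one>\<close> and \<open>y\<close>, \<open>\<one>\<close> and
  \<open>q\<close>, \<open>p\<close> and \<open>y\<close>.\<close>

lemma split_mid:
  assumes u: "u = u1 @ (v, b) # u2"
  shows "halfspace v (wprod (u0 @ u1)) \<in> mid v" "wprod (u0 @ u1) \<notin> halfspace v (wprod (u0 @ u1))"
    "wprod (u0 @ u1) \<otimes> b \<in> halfspace v (wprod (u0 @ u1))"
proof -
  let ?x = "wprod (u0 @ u1)"
  have w: "u1 \<in> words V" "v \<in> V" "b \<in> A v" "u2 \<in> words V" using u axis_words by auto
  have c: "?x \<in> carrier P" "wprod u1 \<in> carrier P" "b \<in> carrier P" "?x \<otimes> b \<in> carrier P"
    using w axis_words wprod_closed A_closed[of v b] by auto
  have "minimal ((u0 @ u1) @ (v, b) # (u2 @ u3))" using minimal_axis u by simp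
  note 1 = minimal_sep[OF this]
  have "minimal ((u0 @ u1) @ (v, b) # u2)"
    using minimal_append(1)[of "(u0 @ u1) @ (v, b) # u2" u3] minimal_axis u by simp
  note 2 = minimal_sep[OF this]
  have "minimal (u1 @ (v, b) # (u2 @ u3))"
    using minimal_append(2)[of u0 "u1 @ (v, b) # (u2 @ u3)"] minimal_axis u by simp
  then have "\<not> sep v (wprod u1) \<one> (wprod u1)" by (rule minimal_sep)
  then have "\<not> sep v (p \<otimes> wprod u1) (p \<otimes> \<one>) (p \<otimes> wprod u1)"
    using sep_left[of p "wprod u1" \<one> "wprod u1" v] axis_closed c by simp
  then have 3: "\<not> sep v ?x p ?x" using axis_words w axis_closed by (simp add: p_def wprod_append)
  have y: "y = wprod ((u0 @ u1) @ (v, b) # (u2 @ u3))" "q = wprod ((u0 @ u1) @ (v, b) # u2)"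
    by (simp_all add: y_def q_def u)
  show "?x \<notin> halfspace v ?x" "?x \<otimes> b \<in> halfspace v ?x"
    using 1 c unfolding halfspace_def sep_def by auto
  have "y \<in> halfspace v ?x" using 1 axis_closed unfolding y[symmetric] halfspace_def sep_def by auto
  moreover have "q \<in> halfspace v ?x" using 2 axis_closed unfolding y[symmetric] halfspace_def sep_def by auto
  moreover have "p \<notin> halfspace v ?x" using 1 3 unfolding halfspace_def sep_def by auto
  ultimately show "halfspace v ?x \<in> mid v" using c unfolding mid_def halfspaces_def by blast
qed

lemma mid_split:
  assumes "S \<in> mid v" "v \<in> V"
  obtains u1 b u2 where "u = u1 @ (v, b) # u2" "S = halfspace v (wprod (u0 @ u1))"
proof -
  obtain x where x: "x \<in> carrier P" "S = halfspace v x" "p \<notin> S" "q \<in> S"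
    using assms unfolding mid_def halfspaces_def by blast
  obtain u1 w b u2 where s: "u = u1 @ (w, b) # u2" "p \<otimes> wprod u1 \<notin> S" "\<not> p \<otimes> wprod u1 \<otimes> b \<notin> S"
    by (rule cross_word[of "\<lambda>g. g \<notin> S" p u]) (use x axis_words axis_closed q_eq in auto)
  then have c: "wprod u1 \<in> carrier P" "w \<in> V" "b \<in> A w" "u1 \<in> words V" using axis_words wprod_closed by auto
  then have *: "w = v" "inv x \<otimes> (p \<otimes> wprod u1) \<in> span (star v)"
    using halfspace_edge[of "p \<otimes> wprod u1" v x b w] s x assms axis_closed by auto
  then have "S = halfspace v (p \<otimes> wprod u1)"
    using halfspace_star[of v x "p \<otimes> wprod u1"] x c assms axis_closed by simp
  then show thesis using that s * c axis_words by (simp add: wprod_append p_def)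
qed

lemma mid_nonempty: "v \<in> V \<Longrightarrow> mid v \<noteq> {}"
  using labels split_mid(1) by blast

text \<open>\<open>E_start\<close> moves the base point back from \<open>g\<close> to
  \<open>\<one>\<close>, and \<open>E_end\<close> carries membership from
  \<open>g \<otimes> y\<close> over to \<open>y\<close>.\<close>

lemma lmul_mid:
  assumes "g \<in> E" "v \<in> V" "S \<in> mid v" shows "lmul g S \<in> halfspaces y v"
proof -
  obtain u1 b u2 where s: "u = u1 @ (v, b) # u2" "S = halfspace v (wprod (u0 @ u1))" using mid_split assms by blast
  let ?x = "wprod (u0 @ u1)"
  have g: "g \<in> carrier P" using assms E_carrier by blast
  have x: "?x \<in> carrier P" using s axis_words wprod_closed by auto
  have e: "lmul g S = {r \<in> carrier P. sep v (g \<otimes> ?x) g r}" using s x g by (simp add: lmul_halfspace)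
  have st: "\<not> sep v (g \<otimes> ?x) \<one> g" using E_start assms s by blast
  then have "lmul g S = halfspace v (g \<otimes> ?x)" unfolding e halfspace_def sep_def by auto
  moreover have "y \<in> S" using assms(3) by (auto simp: mid_def halfspaces_def)
  then have "g \<otimes> y \<in> lmul g S" unfolding lmul_def by blast
  then have "y \<in> lmul g S" using E_end[OF assms(1) s(1)] axis_closed unfolding e sep_def by auto
  ultimately show ?thesis using g x unfolding halfspaces_def by blast
qed

text \<open>The candidate is the translate of \<open>T\<close> by \<open>inv g\<close>. As
  \<open>g\<close> is outside \<open>lmul g S\<close>, it is outside \<open>T\<close>, so the base
  point may be moved and the candidate is a genuine half-space. It lies between \<open>S'\<close>
  and \<open>S\<close>, hence contains \<open>q\<close> and \<open>y\<close> but not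
  \<open>p\<close>.\<close>

lemma sandwich:
  assumes g: "g \<in> E" and S: "S \<in> mid v" and S': "S' \<in> mid w" and T: "T \<in> halfspaces y a"
    and "T \<subseteq> lmul g S" "lmul g S' \<subseteq> T" and a: "a \<in> V"
  obtains T' where "T' \<in> mid a" "T = lmul g T'"
proof -
  have gc: "g \<in> carrier P" using assms E_carrier by blast
  obtain t where t: "t \<in> carrier P" "T = halfspace a t" using T unfolding halfspaces_def by blast
  have sub: "S \<subseteq> carrier P" "S' \<subseteq> carrier P" using S S' mid_carrier by auto
  define T' where "T' = halfspace a (inv g \<otimes> t)"
  have "\<one> \<notin> S" using S one_notin_halfspace by (auto simp: mid_def halfspaces_def)
  then have "g \<otimes> \<one> \<notin> lmul g S" using lmul_mem[of g \<one> S] gc sub by simp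
  then have "g \<notin> T" using assms(5) gc by auto
  then have "\<not> sep a t \<one> g" using t gc by (simp add: halfspace_def)
  then have T': "T = lmul g T'"
    using lmul_halfspace[of g "inv g \<otimes> t" a] gc t unfolding T'_def t(2)
    by (auto simp: halfspace_def sep_def)
  have T'c: "T' \<subseteq> carrier P" unfolding T'_def by (rule halfspace_carrier)
  have "S' \<subseteq> T'" "T' \<subseteq> S" using assms(5,6) lmul_subset gc sub T'c unfolding T' by blast+
  then have "y \<in> T'" "p \<notin> T'" "q \<in> T'" using S S' by (auto simp: mid_def halfspaces_def)
  then have "T' \<in> mid a" unfolding mid_def halfspaces_def T'_def using gc t by blast
  with T' that show thesis by blast
qed

text \<open>Half-spaces contain \<open>y\<close>, hence the smaller one is the farther one from \<open>1\<close>.\<close>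

definition prec :: "'a \<Rightarrow> 'a \<Rightarrow> 'a set \<Rightarrow> bool" where
  "prec g g' S \<longleftrightarrow> lmul g' S \<subset> lmul g S"

text \<open>If the orders at \<open>S\<close> and \<open>T\<close> differed, a translate of one of
  them would fall strictly between the translates of \<open>T\<close> and \<open>S\<close> by the
  same element. By \<open>sandwich\<close> it would come from a member of \<open>mid v\<close> or
  \<open>mid w\<close> strictly between \<open>T\<close> and \<open>S\<close>, which is
  excluded.\<close>

lemma prec_adjacent:
  assumes E: "g \<in> E" "g' \<in> E" and V: "v \<in> V" "w \<in> V" "\<not> adj v w"
    and S: "S \<in> mid v" and T: "T \<in> mid w" "T \<subset> S"
    and none: "\<And>U. U \<in> mid v \<union> mid w \<Longrightarrow> T \<subset> U \<Longrightarrow> U \<subset> S \<Longrightarrow> False"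
  shows "prec g g' S \<longleftrightarrow> prec g g' T"
proof -
  have c: "g \<in> carrier P" "g' \<in> carrier P" "S \<subseteq> carrier P" "T \<subseteq> carrier P"
    using E E_carrier S T mid_carrier by auto
  have gT: "lmul g T \<subset> lmul g S" "lmul g' T \<subset> lmul g' S" using lmul_psubset c T by auto
  have cS: "lmul g S \<subseteq> lmul g' S \<or> lmul g' S \<subseteq> lmul g S"
    using halfspaces_comparable[OF lmul_mid[OF E(1) V(1) S] lmul_mid[OF E(2) V(1) S] V(1,1) adj_irrefl] .
  have cT: "lmul g T \<subseteq> lmul g' T \<or> lmul g' T \<subseteq> lmul g T"
    using halfspaces_comparable[OF lmul_mid[OF E(1) V(2) T(1)] lmul_mid[OF E(2) V(2) T(1)] V(2,2) adj_irrefl] .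
  show ?thesis
  proof
    assume p: "prec g g' S"
    show "prec g g' T"
    proof (rule ccontr)
      assume "\<not> prec g g' T"
      then have "lmul g T \<subseteq> lmul g' T" using cT unfolding prec_def by blast
      then have btw: "lmul g T \<subset> lmul g' S" "lmul g' S \<subset> lmul g S" using p gT unfolding prec_def by blast+
      obtain U where U: "U \<in> mid v" "lmul g' S = lmul g U"
        by (rule sandwich[OF E(1) S T(1) lmul_mid[OF E(2) V(1) S]]) (use btw V in auto)
      then show False using none[of U] btw lmul_psubset c mid_carrier by auto
    qed
  next
    assume p: "prec g g' T"
    show "prec g g' S"
    proof (rule ccontr)
      assume "\<not> prec g g' S"
      then have "lmul g S \<subseteq> lmul g' S" using cS unfolding prec_def by blast
      then have btw: "lmul g' T \<subset> lmul g T" "lmul g T \<subset> lmul g' S" using p gT unfolding prec_def by blast+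
      obtain U where U: "U \<in> mid w" "lmul g T = lmul g' U"
        by (rule sandwich[OF E(2) S T(1) lmul_mid[OF E(1) V(2) T(1)]]) (use btw V in auto)
      then show False using none[of U] btw lmul_psubset c mid_carrier by auto
    qed
  qed
qed

text \<open>Half-spaces of two non-adjacent labels form a finite chain, along which
  \<open>prec_adjacent\<close> propagates. The induction is on the number of members strictly
  between.\<close>

lemma prec_chain:
  assumes E: "g \<in> E" "g' \<in> E" and V: "v \<in> V" "w \<in> V" "\<not> adj v w"
    and "S \<in> mid v \<union> mid w" "T \<in> mid v \<union> mid w" "T \<subset> S"
  shows "prec g g' S \<longleftrightarrow> prec g g' T"
  using assms(6-8)
proof (induction "card {U \<in> mid v \<union> mid w. T \<subset> U \<and> U \<subset> S}" arbitrary: S T rule: less_induct)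
  case less
  let ?X = "mid v \<union> mid w"
  have fin: "finite ?X" using finite_mid V by simp
  show ?case
  proof (cases "\<exists>U\<in>?X. T \<subset> U \<and> U \<subset> S")
    case True
    then obtain U where U: "U \<in> ?X" "T \<subset> U" "U \<subset> S" by blast
    have "card {U' \<in> ?X. T \<subset> U' \<and> U' \<subset> U} < card {U \<in> ?X. T \<subset> U \<and> U \<subset> S}"
      by (rule psubset_card_mono) (use fin U in auto)
    moreover have "card {U' \<in> ?X. U \<subset> U' \<and> U' \<subset> S} < card {U \<in> ?X. T \<subset> U \<and> U \<subset> S}"
      by (rule psubset_card_mono) (use fin U in auto)
    ultimately show ?thesis using less.hyps[of T U] less.hyps[of U S] less.prems U by simp
  next
    case False
    obtain a b where ab: "a \<in> {v, w}" "b \<in> {v, w}" "S \<in> mid a" "T \<in> mid b" using less.prems by blast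
    then have "\<not> adj a b" "a \<in> V" "b \<in> V" using V adj_sym adj_irrefl by auto
    then show ?thesis by (rule_tac prec_adjacent[OF E, of a b S T]) (use ab less.prems False in auto)
  qed
qed

text \<open>The comparison passes between non-adjacent labels by \<open>prec_chain\<close>, and it
  spreads to all labels because the complement of the graph is connected and every label occurs in
  \<open>u\<close>.\<close>

lemma prec_all:
  assumes E: "g \<in> E" "g' \<in> E" and S: "S \<in> mid v" "v \<in> V" and T: "T \<in> mid w" "w \<in> V"
  shows "prec g g' S \<longleftrightarrow> prec g g' T"
proof -
  have pair: "prec g g' S \<longleftrightarrow> prec g g' T" if "S \<in> mid a" "T \<in> mid b" "a \<in> V" "b \<in> V" "\<not> adj a b" for S T a b
  proof -
    have "S \<subseteq> T \<or> T \<subseteq> S" using halfspaces_comparable mid_halfspaces that by blast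
    then show ?thesis using prec_chain[OF E that(3-5), of S T] prec_chain[OF E that(3-5), of T S] that by blast
  qed
  have "\<forall>T\<in>mid w. prec g g' S \<longleftrightarrow> prec g g' T" using connected[OF S(2) T(2)]
  proof (induction rule: rtrancl_induct)
    case base
    then show ?case using pair[OF S(1) _ S(2) S(2)] adj_irrefl by blast
  next
    case (step a b)
    then have ab: "a \<in> V" "b \<in> V" "\<not> adj a b" by auto
    obtain U where "U \<in> mid a" using mid_nonempty ab by blast
    then show ?case using step.IH pair[OF _ _ ab] by blast
  qed
  then show ?thesis using T by blast
qed

text \<open>Translates of one half-space are comparable, so equality means that neither element
  precedes the other, and \<open>prec_all\<close> transports this.\<close>

lemma lmul_eq_all:
  assumes E: "g \<in> E" "g' \<in> E" and S: "S \<in> mid v" "v \<in> V" "lmul g S = lmul g' S" and T: "T \<in> mid w" "w \<in> V"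
  shows "lmul g T = lmul g' T"
proof -
  have "\<not> prec g g' T" "\<not> prec g' g T"
    using prec_all[OF E S(1,2) T] prec_all[OF E(2,1) S(1,2) T] S(3) by (auto simp: prec_def)
  moreover have "lmul g T \<subseteq> lmul g' T \<or> lmul g' T \<subseteq> lmul g T"
    using halfspaces_comparable[OF lmul_mid[OF E(1) T(2,1)] lmul_mid[OF E(2) T(2,1)] T(2,2) adj_irrefl] .
  ultimately show ?thesis unfolding prec_def by blast
qed

text \<open>Take \<open>L\<close> next to \<open>S\<close> among the half-spaces of label
  \<open>w\<close>: the largest one inside \<open>S\<close> or the smallest one containing
  \<open>S\<close>. If the claimed inclusion failed, \<open>sandwich\<close> and
  \<open>prec_all\<close> would produce a member of \<open>mid w\<close> still closer to
  \<open>S\<close>. Neither \<open>L\<close> nor the alternative depends on \<open>g\<close> and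
  \<open>g'\<close>, so both serve for all pairs at once.\<close>

lemma between:
  assumes S: "S \<in> mid v" "v \<in> V" and w: "w \<in> V" "w \<noteq> v" "\<not> adj v w"
  obtains L where "L \<in> mid w"
    "(\<forall>g\<in>E. \<forall>g'\<in>E. prec g g' S \<longrightarrow> lmul g L \<subseteq> lmul g S \<and> lmul g' S \<subseteq> lmul g L) \<or>
     (\<forall>g\<in>E. \<forall>g'\<in>E. prec g g' S \<longrightarrow> lmul g' L \<subseteq> lmul g S \<and> lmul g' S \<subseteq> lmul g' L)"
proof -
  obtain T0 where T0: "T0 \<in> mid w" using mid_nonempty w by blast
  have fin: "finite (mid w)" using finite_mid w by blast
  have ne: "U \<noteq> S" if "U \<in> mid w" for U
    using that S w mid_halfspaces halfspaces_label[of S y v y w] by blast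
  have cmp: "X \<subseteq> Y \<or> Y \<subseteq> X" if "X \<in> halfspaces y v" "Y \<in> halfspaces y w" for X Y
    using halfspaces_comparable[of X y v Y w] that S w by blast
  have sc: "S \<subseteq> carrier P" using S mid_carrier by blast
  have "T0 \<subseteq> S \<or> S \<subseteq> T0" using cmp T0 S mid_halfspaces by blast
  then show thesis
  proof
    assume "T0 \<subseteq> S"
    then have "finite {L \<in> mid w. L \<subseteq> S}" "{L \<in> mid w. L \<subseteq> S} \<noteq> {}" using T0 fin by auto
    from finite_has_maximal[OF this] obtain L where
      "L \<in> {L \<in> mid w. L \<subseteq> S}" "\<forall>U\<in>{L \<in> mid w. L \<subseteq> S}. L \<subseteq> U \<longrightarrow> L = U" by (rule bexE)
    then have L: "L \<in> mid w" "L \<subseteq> S" and max: "\<And>U. U \<in> mid w \<Longrightarrow> U \<subseteq> S \<Longrightarrow> L \<subseteq> U \<Longrightarrow> L = U"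
      by simp_all
    have Lc: "L \<subseteq> carrier P" using L mid_carrier by blast
    have "lmul g L \<subseteq> lmul g S \<and> lmul g' S \<subseteq> lmul g L" if g: "g \<in> E" "g' \<in> E" "prec g g' S" for g g'
    proof -
      have gc: "g \<in> carrier P" "g' \<in> carrier P" using g E_carrier by auto
      have 1: "lmul g L \<subseteq> lmul g S" using lmul_subset gc L sc Lc by blast
      have p: "lmul g' L \<subset> lmul g L" using prec_all[OF g(1,2) S L(1) w(1)] g(3) unfolding prec_def by blast
      \<comment> \<open>Otherwise \<open>lmul g L\<close> lies between \<open>lmul g' L\<close> and
        \<open>lmul g' S\<close>, so it is the \<open>g'\<close>-translate of some \<open>U\<close>
        with \<open>L \<subset> U \<subseteq> S\<close>.\<close>
      have "lmul g' S \<subseteq> lmul g L"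
      proof (rule ccontr)
        assume "\<not> ?thesis"
        then have i: "lmul g L \<subseteq> lmul g' S"
          using cmp[OF lmul_mid[OF g(2) S(2,1)] lmul_mid[OF g(1) w(1) L(1)]] by blast
        obtain U where U: "U \<in> mid w" "lmul g L = lmul g' U"
          by (rule sandwich[OF g(2) S(1) L(1) lmul_mid[OF g(1) w(1) L(1)] i]) (use p w in auto)
        have "U \<subseteq> S" "L \<subset> U" using U i p lmul_subset lmul_psubset gc sc Lc mid_carrier[OF U(1)] by auto
        then show False using max U by blast
      qed
      with 1 show ?thesis by blast
    qed
    then show thesis using that[OF L(1)] by blast
  next
    assume "S \<subseteq> T0"
    then have "finite {L \<in> mid w. S \<subseteq> L}" "{L \<in> mid w. S \<subseteq> L} \<noteq> {}" using T0 fin by auto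
    from finite_has_minimal[OF this] obtain L where
      "L \<in> {L \<in> mid w. S \<subseteq> L}" "\<forall>U\<in>{L \<in> mid w. S \<subseteq> L}. U \<subseteq> L \<longrightarrow> L = U" by (rule bexE)
    then have L: "L \<in> mid w" "S \<subseteq> L" and min: "\<And>U. U \<in> mid w \<Longrightarrow> S \<subseteq> U \<Longrightarrow> U \<subseteq> L \<Longrightarrow> L = U"
      by simp_all
    have Lc: "L \<subseteq> carrier P" using L mid_carrier by blast
    have "lmul g' L \<subseteq> lmul g S \<and> lmul g' S \<subseteq> lmul g' L" if g: "g \<in> E" "g' \<in> E" "prec g g' S" for g g'
    proof -
      have gc: "g \<in> carrier P" "g' \<in> carrier P" using g E_carrier by auto
      have 1: "lmul g' S \<subseteq> lmul g' L" using lmul_subset gc L sc Lc by blast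
      have p: "lmul g' L \<subset> lmul g L" using prec_all[OF g(1,2) S L(1) w(1)] g(3) unfolding prec_def by blast
      have "lmul g' L \<subseteq> lmul g S"
      proof (rule ccontr)
        assume "\<not> ?thesis"
        then have i: "lmul g S \<subseteq> lmul g' L"
          using cmp[OF lmul_mid[OF g(1) S(2,1)] lmul_mid[OF g(2) w(1) L(1)]] by blast
        obtain U where U: "U \<in> mid w" "lmul g' L = lmul g U"
          by (rule sandwich[OF g(1) L(1) S(1) lmul_mid[OF g(2) w(1) L(1)] _ i]) (use p w in auto)
        have "S \<subseteq> U" "U \<subset> L" using U i p lmul_subset lmul_psubset gc sc Lc mid_carrier[OF U(1)] by auto
        then show False using min U by blast
      qed
      with 1 show ?thesis by blast
    qed
    then show thesis using that[OF L(1)] by blast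
  qed
qed

text \<open>Induction along the path in the complement. Each edge trades \<open>S\<close> for a
  half-space \<open>L\<close> of the next label and uses up one index at either end of the interval,
  hence the factor 2.\<close>

lemma between_all:
  assumes "(v, w) \<in> {(a, b). a \<in> V \<and> b \<in> V \<and> a \<noteq> b \<and> \<not> adj a b} ^^ k"
    and "S \<in> mid v" "v \<in> V" "\<And>i. i \<le> M \<Longrightarrow> e i \<in> E" "\<And>i. i < M \<Longrightarrow> prec (e i) (e (Suc i)) S"
    and "i + 2 * k \<le> M"
  obtains T j where "T \<in> mid w" "j \<le> M" "lmul (e j) T \<subseteq> lmul (e i) S" "lmul (e (i + 2 * k)) S \<subseteq> lmul (e j) T"
proof -
  have "\<exists>T j. T \<in> mid w \<and> j \<le> M \<and> lmul (e j) T \<subseteq> lmul (e i) S \<and> lmul (e (i + 2 * k)) S \<subseteq> lmul (e j) T"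
    using assms
  proof (induction k arbitrary: v S i)
    case 0
    then show ?case by (intro exI[of _ S] exI[of _ i]) auto
  next
    case (Suc k)
    let ?N = "{(a, b). a \<in> V \<and> b \<in> V \<and> a \<noteq> b \<and> \<not> adj a b}"
    obtain c where c: "(v, c) \<in> ?N" "(c, w) \<in> ?N ^^ k" by (rule relpow_Suc_E2[OF Suc.prems(1)])
    then have cV: "c \<in> V" "c \<noteq> v" "\<not> adj v c" by auto
    obtain L where L: "L \<in> mid c"
      "(\<forall>g\<in>E. \<forall>g'\<in>E. prec g g' S \<longrightarrow> lmul g L \<subseteq> lmul g S \<and> lmul g' S \<subseteq> lmul g L) \<or>
       (\<forall>g\<in>E. \<forall>g'\<in>E. prec g g' S \<longrightarrow> lmul g' L \<subseteq> lmul g S \<and> lmul g' S \<subseteq> lmul g' L)"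
      by (rule between[OF Suc.prems(2,3) cV])
    have pL: "prec (e i) (e (Suc i)) L" if "i < M" for i
      using prec_all[OF Suc.prems(4)[of i] Suc.prems(4)[of "Suc i"] Suc.prems(2,3) L(1) cV(1)] Suc.prems(5) that by auto
    obtain T j where T: "T \<in> mid w" "j \<le> M" "lmul (e j) T \<subseteq> lmul (e (Suc i)) L"
      "lmul (e (Suc i + 2 * k)) L \<subseteq> lmul (e j) T"
      using Suc.IH[of c L "Suc i"] c(2) L(1) cV(1) pL Suc.prems(4,6) by auto
    have iM: "i < M" "Suc i + 2 * k < M" using Suc.prems(6) by auto
    let ?i = "Suc i + 2 * k"
    have p1: "e i \<in> E" "e (Suc i) \<in> E" "prec (e i) (e (Suc i)) S" "e ?i \<in> E" "e (Suc ?i) \<in> E" "prec (e ?i) (e (Suc ?i)) S"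
      using Suc.prems(4,5) iM by auto
    have "lmul (e (Suc i)) L \<subseteq> lmul (e i) L" using pL[OF iM(1)] by (auto simp: prec_def)
    moreover have "lmul (e (Suc ?i)) L \<subseteq> lmul (e ?i) L" using pL[OF iM(2)] by (auto simp: prec_def)
    ultimately have 1: "lmul (e (Suc i)) L \<subseteq> lmul (e i) S" and 2: "lmul (e (Suc ?i)) S \<subseteq> lmul (e ?i) L"
      using L(2) p1 by (blast, blast)
    have "i + 2 * Suc k = Suc ?i" by simp
    then show ?case using T(1,2) subset_trans[OF T(3) 1] subset_trans[OF 2 T(4)]
      by (intro exI[of _ T] exI[of _ j]) simp
  qed
  with that show thesis by blast
qed

text \<open>By \<open>lmul_eq_all\<close>, the element \<open>h\<close> fixes every half-space
  crossed by \<open>u\<close>; conjugated to the start of a letter, it therefore lies in the star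
  subgroup of that letter. Moving along \<open>u\<close> intersects all these stars, and they have
  no common vertex.\<close>

lemma E_inj:
  assumes E: "g \<in> E" "g' \<in> E" and S: "S \<in> mid v" "v \<in> V" "lmul g S = lmul g' S"
  shows "g = g'"
proof -
  define h where "h = inv g \<otimes> g'"
  have gc: "g \<in> carrier P" "g' \<in> carrier P" using E E_carrier by auto
  then have h: "h \<in> carrier P" "g' = g \<otimes> h" by (simp_all add: h_def)
  \<comment> \<open>Conjugating by a letter of \<open>u\<close> does not enlarge the support, and every label occurs in \<open>u\<close>.\<close>
  define X where "X = (\<lambda>t. inv (wprod (u0 @ t)) \<otimes> h \<otimes> wprod (u0 @ t))"
  have conj: "X u1 \<in> span (star w)" if s: "u = u1 @ (w, b) # u2" for u1 w b u2
  proof -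
    let ?r = "wprod (u0 @ u1)"
    let ?T = "halfspace w ?r"
    have w: "w \<in> V" "b \<in> A w" "b \<in> carrier P" "?r \<in> carrier P"
      using s axis_words wprod_closed A_closed[of w b] by auto
    note T = split_mid[OF s]
    have eq: "lmul g ?T = lmul g' ?T" by (rule lmul_eq_all[OF E S T(1) w(1)])
    have mem: "h \<otimes> r \<in> ?T \<longleftrightarrow> r \<in> ?T" if "r \<in> carrier P" for r
    proof -
      have "h \<otimes> r \<in> ?T \<longleftrightarrow> g \<otimes> (h \<otimes> r) \<in> lmul g ?T"
        using lmul_mem[of g "h \<otimes> r" ?T] halfspace_carrier gc h that by simp
      also have "g \<otimes> (h \<otimes> r) = g' \<otimes> r" using gc h that by (simp add: m_assoc)
      also have "g' \<otimes> r \<in> lmul g ?T \<longleftrightarrow> r \<in> ?T"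
        unfolding eq using lmul_mem[of g' r ?T] halfspace_carrier gc that by simp
      finally show ?thesis .
    qed
    \<comment> \<open>Thus \<open>h\<close> sends the boundary edge of \<open>?T\<close> at
      \<open>?r\<close> again to a boundary edge of \<open>?T\<close>, so both start on the same
      carrier.\<close>
    have "h \<otimes> ?r \<notin> ?T" using mem T w by blast
    moreover have "h \<otimes> ?r \<otimes> b \<in> ?T" using mem[of "?r \<otimes> b"] T w h by (simp add: m_assoc)
    ultimately have "inv ?r \<otimes> (h \<otimes> ?r) \<in> span (star w)" using halfspace_edge(2) w h by blast
    then show ?thesis using w h by (simp add: X_def m_assoc)
  qed
  have "X u1 \<in> span {a \<in> V. \<forall>w\<in>fst ` set u1. a \<in> star w}" if "u = u1 @ u2" for u1 u2
    using that
  proof (induction u1 arbitrary: u2 rule: rev_induct)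
    case Nil
    have "X [] \<in> carrier P" using axis_words wprod_closed h by (auto simp: X_def)
    then show ?case by (simp add: span_V)
  next
    case (snoc s u1)
    obtain w b where sw: "s = (w, b)" by force
    let ?W = "{a \<in> V. \<forall>w\<in>fst ` set u1. a \<in> star w}"
    have u: "u = u1 @ (w, b) # u2" using snoc.prems sw by simp
    then have w: "w \<in> V" "b \<in> A w" "b \<in> carrier P" "wprod (u0 @ u1) \<in> carrier P" "u1 \<in> words V"
      using axis_words wprod_closed A_closed[of w b] by auto
    have "X u1 \<in> span (?W \<inter> star w)"
      using span_Int[of "X u1" ?W "star w"] snoc.IH[of "(w, b) # u2"] conj[OF u] u star_V[OF w(1)] by auto
    then have "inv b \<otimes> X u1 \<otimes> b \<in> span (?W \<inter> star w)" using w by (intro span_conj[of w]) auto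
    moreover have "wprod (u0 @ u1 @ [s]) = wprod (u0 @ u1) \<otimes> b"
      using axis_words w wprod_append[of "u0 @ u1" "[s]"] sw by simp
    then have "X (u1 @ [s]) = inv b \<otimes> X u1 \<otimes> b"
      using w h by (simp add: X_def inv_mult_group m_assoc)
    moreover have "{a \<in> V. \<forall>w\<in>fst ` set (u1 @ [s]). a \<in> star w} = ?W \<inter> star w" using sw by auto
    ultimately show ?case by simp
  qed
  from this[of u "[]"] have "X u \<in> span {a \<in> V. \<forall>w\<in>fst ` set u. a \<in> star w}" by simp
  \<comment> \<open>A vertex in all stars is isolated in the complement of the graph, so by
    connectedness it would be the only vertex.\<close>
  moreover have "{a \<in> V. \<forall>w\<in>fst ` set u. a \<in> star w} = {}"
  proof (rule ccontr)
    assume "\<not> ?thesis"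
    then obtain a where a: "a \<in> V" "\<forall>w\<in>fst ` set u. a \<in> star w" by blast
    have st: "a = w \<or> adj a w" if w: "w \<in> V" for w
    proof -
      obtain u1 b u2 where "u = u1 @ (w, b) # u2" using labels w by blast
      then have "w \<in> fst ` set u" by force
      then show ?thesis using a adj_sym by (auto simp: link_def)
    qed
    have "w = a" if "w \<in> V" for w using connected[OF a(1) that]
      by (induction rule: rtrancl_induct) (use st in auto)
    then have "V = {a}" using a by blast
    then show False using two_vertices by blast
  qed
  ultimately have "X u \<in> span {}" by (simp only:)
  then have X: "X u = \<one>" by (simp add: span_def generate_empty)
  have c: "wprod (u0 @ u) \<in> carrier P" using axis_words wprod_closed[of "u0 @ u"] by simp
  then have "h = wprod (u0 @ u) \<otimes> X u \<otimes> inv (wprod (u0 @ u))"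
    using h by (simp add: X_def m_assoc)
  then have "h = \<one>" using c unfolding X by simp
  then show ?thesis using h gc by simp
qed

end

section \<open>Counting by distances\<close>

lemma chain_enumeration:
  assumes "finite F" "\<And>X Y. X \<in> F \<Longrightarrow> Y \<in> F \<Longrightarrow> X \<subseteq> Y \<or> Y \<subseteq> X" "M < card F"
  obtains f :: "nat \<Rightarrow> 'x set" where "\<And>i. i \<le> M \<Longrightarrow> f i \<in> F" "\<And>i. i < M \<Longrightarrow> f (Suc i) \<subset> f i"
proof -
  have "\<exists>f :: nat \<Rightarrow> 'x set. (\<forall>i\<le>M. f i \<in> F) \<and> (\<forall>i<M. f (Suc i) \<subset> f i)"
    using assms
  proof (induction M arbitrary: F)
    case 0
    then obtain X where "X \<in> F" by fastforce
    then show ?case by (intro exI[of _ "\<lambda>_. X"]) simp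
  next
    case (Suc M)
    have "F \<noteq> {}" using Suc.prems(3) by auto
    from finite_has_maximal[OF Suc.prems(1) this] obtain X where X: "X \<in> F" "\<forall>Y\<in>F. X \<subseteq> Y \<longrightarrow> X = Y" by (rule bexE)
    have "finite (F - {X})" "M < card (F - {X})" using Suc.prems(1,3) X(1) by simp_all
    moreover have "Y \<subseteq> Z \<or> Z \<subseteq> Y" if "Y \<in> F - {X}" "Z \<in> F - {X}" for Y Z using that Suc.prems(2) by blast
    ultimately have "\<exists>f :: nat \<Rightarrow> 'x set. (\<forall>i\<le>M. f i \<in> F - {X}) \<and> (\<forall>i<M. f (Suc i) \<subset> f i)"
      by (intro Suc.IH)
    then obtain f :: "nat \<Rightarrow> 'x set" where f: "\<forall>i\<le>M. f i \<in> F - {X}" "\<forall>i<M. f (Suc i) \<subset> f i"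
      by (elim exE conjE)
    have "f 0 \<in> F" "f 0 \<noteq> X" using f(1) by auto
    then have "f 0 \<subset> X" using X Suc.prems(2)[of X "f 0"] by blast
    then show ?case using f X
      by (intro exI[of _ "\<lambda>i. case i of 0 \<Rightarrow> X | Suc i \<Rightarrow> f i"]) (auto split: nat.split)
  qed
  with that show thesis by blast
qed

text \<open>Discrete intermediate value principle for paths. The remaining path starts at
  \<open>z\<close>, before the crossing step, hence its length \<open>n - i\<close>.\<close>

lemma relpow_cross:
  assumes "(r, r') \<in> R ^^ n" "Q r" "\<not> Q r'"
  obtains i z z' where "i < n" "(r, z) \<in> R ^^ i" "(z, z') \<in> R" "(z, r') \<in> R ^^ (n - i)" "Q z" "\<not> Q z'"
proof -
  have "\<exists>i z z'. i < n \<and> (r, z) \<in> R ^^ i \<and> (z, z') \<in> R \<and> (z, r') \<in> R ^^ (n - i) \<and> Q z \<and> \<not> Q z'"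
    using assms
  proof (induction n arbitrary: r')
    case (Suc n)
    then obtain t where t: "(r, t) \<in> R ^^ n" "(t, r') \<in> R" by auto
    show ?case
    proof (cases "Q t")
      case True
      then show ?thesis using t Suc.prems by (intro exI[of _ n] exI[of _ t] exI[of _ r']) auto
    next
      case False
      then obtain i z z' where i: "i < n" "(r, z) \<in> R ^^ i" "(z, z') \<in> R" "(z, t) \<in> R ^^ (n - i)" "Q z" "\<not> Q z'"
        using Suc.IH t Suc.prems by blast
      have "(z, r') \<in> R ^^ Suc (n - i)" using i(4) t(2) by (rule relpow_Suc_I)
      then show ?thesis using i by (intro exI[of _ i] exI[of _ z] exI[of _ z']) (simp add: Suc_diff_le)
    qed
  qed simp
  with that show thesis by blast
qed

section \<open>The coned-off graph and its distance to hyperplanes\<close>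

locale connected_head_system = head_system +
  assumes other_vertex: "\<exists>w\<in>V. w \<noteq> v"
    and connected: "v \<in> V \<Longrightarrow> w \<in> V \<Longrightarrow> (v, w) \<in> {(a, b). a \<in> V \<and> b \<in> V \<and> a \<noteq> b \<and> \<not> adj a b}\<^sup>*"
begin

text \<open>The edges of \<open>C\<close> together with all loops, which do not affect least path
  lengths. Maximal proper subgraphs suffice because \<open>span\<close> is monotone, and generators
  are covered because with two vertices every letter lies in such a subgroup.\<close>

definition cstep :: "'a rel" where
  "cstep = {(r, r'). r \<in> carrier P \<and> r' \<in> carrier P \<and> (\<exists>v\<in>V. inv r \<otimes> r' \<in> span (V - {v}))}"

definition cdist :: "'a \<Rightarrow> 'a \<Rightarrow> nat" where
  "cdist r r' = (LEAST n. (r, r') \<in> cstep ^^ n)"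

lemma cstep_closed: "(r, r') \<in> cstep \<Longrightarrow> r \<in> carrier P \<and> r' \<in> carrier P"
  by (simp add: cstep_def)

lemma cstep_letter: "r \<in> carrier P \<Longrightarrow> v \<in> V \<Longrightarrow> b \<in> A v \<Longrightarrow> (r, r \<otimes> b) \<in> cstep"
proof -
  assume r: "r \<in> carrier P" and v: "v \<in> V" "b \<in> A v"
  obtain w where "w \<in> V" "w \<noteq> v" using other_vertex by blast
  moreover have "b \<in> span (V - {w})" if "w \<noteq> v" for w using A_span[of v "V - {w}"] v that by blast
  ultimately show "(r, r \<otimes> b) \<in> cstep" using r v A_closed unfolding cstep_def by auto
qed

lemma cstep_sym: "(r, r') \<in> cstep \<Longrightarrow> (r', r) \<in> cstep"
proof -
  assume "(r, r') \<in> cstep"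
  then obtain v where v: "r \<in> carrier P" "r' \<in> carrier P" "v \<in> V" "inv r \<otimes> r' \<in> span (V - {v})"
    by (auto simp: cstep_def)
  moreover have "inv r' \<otimes> r = inv (inv r \<otimes> r')" using v by (simp add: inv_mult_group)
  ultimately show "(r', r) \<in> cstep" using span_inv[of "V - {v}"] unfolding cstep_def by auto
qed

lemma cstep_left: "g \<in> carrier P \<Longrightarrow> (r, r') \<in> cstep \<Longrightarrow> (g \<otimes> r, g \<otimes> r') \<in> cstep"
  unfolding cstep_def by (auto simp: inv_mult_group m_assoc)

lemma cpath_sym: "(r, r') \<in> cstep ^^ n \<Longrightarrow> (r', r) \<in> cstep ^^ n"
proof (induction n arbitrary: r')
  case (Suc n)
  then obtain t where "(r, t) \<in> cstep ^^ n" "(t, r') \<in> cstep" by auto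
  then show ?case using Suc.IH cstep_sym by (blast intro: relpow_Suc_I2)
qed simp

lemma cpath_left: "g \<in> carrier P \<Longrightarrow> (r, r') \<in> cstep ^^ n \<Longrightarrow> (g \<otimes> r, g \<otimes> r') \<in> cstep ^^ n"
  by (induction n arbitrary: r') (auto intro: cstep_left relpow_Suc_I)

lemma cpath_exists: assumes "r \<in> carrier P" "r' \<in> carrier P" shows "\<exists>n. (r, r') \<in> cstep ^^ n"
proof -
  obtain u where u: "u \<in> words V" "wprod u = inv r \<otimes> r'" using carrier_word[of "inv r \<otimes> r'"] assms by auto
  have "(r, r \<otimes> wprod u) \<in> cstep ^^ length u" if "u \<in> words V" for u using that
  proof (induction u rule: rev_induct)
    case Nil
    then show ?case using assms by simp
  next
    case (snoc s u)
    then have c: "wprod u \<in> carrier P" "fst s \<in> V" "snd s \<in> A (fst s)" using wprod_closed by auto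
    then have "(r \<otimes> wprod u, r \<otimes> wprod u \<otimes> snd s) \<in> cstep" using assms by (intro cstep_letter) auto
    moreover have "wprod (u @ [s]) = wprod u \<otimes> snd s" "snd s \<in> carrier P"
      using snoc.prems c A_closed by (auto simp: wprod_append)
    ultimately show ?case using snoc c assms by (auto simp: m_assoc)
  qed
  from this[OF u(1)] show ?thesis using u assms by auto
qed

lemma cdist_path: "r \<in> carrier P \<Longrightarrow> r' \<in> carrier P \<Longrightarrow> (r, r') \<in> cstep ^^ cdist r r'"
  unfolding cdist_def by (rule LeastI_ex) (rule cpath_exists)

lemma cdist_le: "(r, r') \<in> cstep ^^ n \<Longrightarrow> cdist r r' \<le> n"
  unfolding cdist_def by (rule Least_le)

lemma cdist_refl [simp]: "cdist r r = 0"
  using cdist_le[of r r 0] by simp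

lemma cdist_step: "(r, r') \<in> cstep \<Longrightarrow> cdist r r' \<le> 1"
  by (rule cdist_le) simp

lemma cdist_triangle:
  assumes "r \<in> carrier P" "r' \<in> carrier P" "r'' \<in> carrier P"
  shows "cdist r r'' \<le> cdist r r' + cdist r' r''"
  by (rule cdist_le) (use cdist_path assms in \<open>auto simp: relpow_add\<close>)

lemma cdist_sym: "r \<in> carrier P \<Longrightarrow> r' \<in> carrier P \<Longrightarrow> cdist r r' = cdist r' r"
  using cdist_le[OF cpath_sym[OF cdist_path[of r r']]] cdist_le[OF cpath_sym[OF cdist_path[of r' r]]] by simp

lemma cdist_left:
  assumes "g \<in> carrier P" "r \<in> carrier P" "r' \<in> carrier P"
  shows "cdist (g \<otimes> r) (g \<otimes> r') = cdist r r'"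
proof (rule antisym)
  show "cdist (g \<otimes> r) (g \<otimes> r') \<le> cdist r r'" using assms by (intro cdist_le cpath_left[OF _ cdist_path])
  have "(inv g \<otimes> (g \<otimes> r), inv g \<otimes> (g \<otimes> r')) \<in> cstep ^^ cdist (g \<otimes> r) (g \<otimes> r')"
    using assms by (intro cpath_left[OF _ cdist_path]) auto
  then show "cdist r r' \<le> cdist (g \<otimes> r) (g \<otimes> r')" using assms by (intro cdist_le) simp
qed

text \<open>In a connected complement with at least two vertices, \<open>v\<close> has a
  non-neighbour \<open>w\<close>, so the star of \<open>v\<close> misses \<open>w\<close>. Carriers
  thus have diameter at most 1.\<close>

lemma cstep_star:
  assumes "v \<in> V" "x \<in> carrier P" "x' \<in> carrier P" "inv x \<otimes> x' \<in> span (star v)" shows "(x, x') \<in> cstep"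
proof -
  obtain w0 where w0: "w0 \<in> V" "w0 \<noteq> v" using other_vertex by blast
  then obtain w where "(v, w) \<in> {(a, b). a \<in> V \<and> b \<in> V \<and> a \<noteq> b \<and> \<not> adj a b}"
    by (rule_tac converse_rtranclE[OF connected[OF assms(1) w0(1)]]) blast+
  then have "w \<in> V" "star v \<subseteq> V - {w}" using star_V[OF assms(1)] by (auto simp: link_def)
  then show ?thesis using assms span_mono[of "star v" "V - {w}"] unfolding cstep_def by blast
qed

text \<open>One step inside the coset of the edge reaches the carrier, by
  \<open>sep_carrier_diam\<close>; a second step inside the carrier reaches
  \<open>x\<close>.\<close>

lemma cdist_sep:
  assumes "(r, r') \<in> cstep" "sep v x r r'" "v \<in> V" "x \<in> carrier P"
  shows "cdist r x \<le> 2"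
proof -
  obtain w where w: "r \<in> carrier P" "r' \<in> carrier P" "w \<in> V" "inv r \<otimes> r' \<in> span (V - {w})"
    using assms(1) by (auto simp: cstep_def)
  have "sep v x r (r \<otimes> (inv r \<otimes> r'))" using assms w by simp
  then obtain t where t: "t \<in> span (V - {w})" "inv x \<otimes> (r \<otimes> t) \<in> span (star v)"
    by (rule sep_carrier_diam) (use w assms in auto)
  have tc: "t \<in> carrier P" using t span_closed[of "V - {w}"] by blast
  have "(r, r \<otimes> t) \<in> cstep" using w t tc unfolding cstep_def by auto
  moreover have "(r \<otimes> t, x) \<in> cstep" using cstep_star[of v x "r \<otimes> t"] t tc w assms cstep_sym by simp
  ultimately show ?thesis
    using cdist_triangle[of r "r \<otimes> t" x] cdist_step[of r "r \<otimes> t"] cdist_step[of "r \<otimes> t" x] w tc assms by simp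
qed

text \<open>A shortest path crosses the hyperplane in a step that starts at some
  \<open>i < cdist r r'\<close>, and \<open>cdist_sep\<close> adds 2.\<close>

lemma cdist_sep_path:
  assumes "sep v x r r'" "v \<in> V" "x \<in> carrier P" "r \<in> carrier P" "r' \<in> carrier P"
  shows "cdist r x \<le> cdist r r' + 1"
proof -
  obtain i z z' where i: "i < cdist r r'" "(r, z) \<in> cstep ^^ i" "(z, z') \<in> cstep" "\<not> sep v x r z" "\<not> \<not> sep v x r z'"
    by (rule relpow_cross[OF cdist_path[OF assms(4,5)], of "\<lambda>g. \<not> sep v x r g"]) (use assms in auto)
  then have "sep v x z z'" by (simp add: sep_def)
  then have "cdist z x \<le> 2" using cdist_sep i assms by blast
  moreover have "cdist r z \<le> i" using i cdist_le by blast
  moreover have "z \<in> carrier P" using i cstep_closed by blast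
  ultimately show ?thesis using cdist_triangle[of r z x] assms i by simp
qed

section \<open>Elements that move both ends by a bounded amount\<close>

definition coarse_stabilizer :: "nat \<Rightarrow> 'a \<Rightarrow> 'a set" where
  "coarse_stabilizer e y = {g \<in> carrier P. cdist \<one> g \<le> e \<and> cdist y (g \<otimes> y) \<le> e}"

text \<open>The middle word consists of consecutive letters of a geodesic that start further than
  \<open>e + 2\<close> from both \<open>\<one>\<close> and \<open>y\<close>. The translate by
  \<open>g\<close> of a hyperplane at such a point is too far from \<open>g\<close> and
  \<open>g \<otimes> y\<close> to separate them from \<open>\<one>\<close> and \<open>y\<close>, by
  \<open>cdist_sep_path\<close>. If \<open>u\<close> missed a label, its ends would be at distance
  at most 1 and \<open>y\<close> at distance at most \<open>2 * (e + 2) + 2\<close>, contrary to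
  \<open>far\<close>.\<close>

lemma axis_exists:
  assumes y: "y \<in> carrier P" and far: "2 * e + 7 \<le> cdist \<one> y"
  obtains u0 u u3 where
    "axis P V adj A head u0 u u3 y (wprod u0) (wprod (u0 @ u)) (coarse_stabilizer e y)"
proof -
  obtain uu where uu: "minimal uu" "wprod uu = y" using minimal_exists y by blast
  define r where "r = (\<lambda>i. wprod (take i uu))"
  define n where "n = length uu"
  have uuV: "uu \<in> words V" using uu minimal_words by blast
  have takeV: "take i uu \<in> words V" "drop i uu \<in> words V" for i
    using uuV words_simps(3)[of "take i uu" "drop i uu" V] by simp_all
  have rc: "r i \<in> carrier P" for i unfolding r_def using takeV wprod_closed by blast
  have r0: "r 0 = \<one>" "r n = y" by (simp_all add: r_def n_def uu)
  have rstep: "cdist (r i) (r (Suc i)) \<le> 1" if "i < n" for i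
  proof -
    have t: "take (Suc i) uu = take i uu @ [uu ! i]" using that by (simp add: n_def take_Suc_conv_app_nth)
    then have l: "fst (uu ! i) \<in> V" "snd (uu ! i) \<in> A (fst (uu ! i))" using takeV(1)[of "Suc i"] by auto
    then have "r (Suc i) = r i \<otimes> snd (uu ! i)"
      unfolding r_def t using takeV[of i] A_closed[OF l] by (simp add: wprod_append)
    then show ?thesis using cstep_letter[OF rc l] cdist_step by simp
  qed
  define m where "m = e + 2"
  \<comment> \<open>\<open>a\<close> is the last index near \<open>\<one>\<close>, and
    \<open>b\<close> below is the first later index near \<open>y\<close>. The middle word starts at
    \<open>Suc a\<close>, so that the starting points of all its letters are strictly in
    between.\<close>
  define a where "a = Max {i. i \<le> n \<and> cdist \<one> (r i) \<le> m}"
  have a_in: "a \<in> {i. i \<le> n \<and> cdist \<one> (r i) \<le> m}"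
    unfolding a_def by (rule Max_in) (auto simp: r0 intro: exI[of _ 0])
  have a_max: "m < cdist \<one> (r i)" if "a < i" "i \<le> n" for i
    using Max_ge[of "{i. i \<le> n \<and> cdist \<one> (r i) \<le> m}" i] that unfolding a_def[symmetric] by fastforce
  have an: "a < n" using a_in far r0 unfolding m_def by (cases "a = n") auto
  define b where "b = (LEAST j. a < j \<and> j \<le> n \<and> cdist (r j) y \<le> m)"
  have b_in: "a < b \<and> b \<le> n \<and> cdist (r b) y \<le> m"
    unfolding b_def by (rule LeastI[of _ n]) (simp add: an r0)
  have b_min: "m < cdist (r i) y" if "a < i" "i < b" for i
    using not_less_Least[of i "\<lambda>j. a < j \<and> j \<le> n \<and> cdist (r j) y \<le> m"] that b_in unfolding b_def[symmetric] by auto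
  define u0 where "u0 = take (Suc a) uu"
  define u where "u = drop (Suc a) (take b uu)"
  define u3 where "u3 = drop b uu"
  have u0u: "u0 @ u = take b uu"
  proof -
    have "u0 = take (Suc a) (take b uu)" using b_in by (simp add: u0_def min_def)
    then show ?thesis unfolding u_def by (simp only: append_take_drop_id)
  qed
  have split: "u0 @ u @ u3 = uu" using u0u by (simp add: u3_def flip: append_assoc)
  have V: "u0 \<in> words V" "u \<in> words V" "u3 \<in> words V" using uuV unfolding split[symmetric] by auto
  have len: "length u0 = Suc a" using an by (simp add: u0_def n_def)
  have p: "wprod u0 = r (Suc a)" "wprod (u0 @ u) = r b" unfolding u0u by (simp_all add: u0_def r_def)
  have pos: "m < cdist \<one> (wprod (u0 @ u1)) \<and> m < cdist y (wprod (u0 @ u1)) \<and> wprod (u0 @ u1) \<in> carrier P"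
    if "u = u1 @ s # u2" for u1 s u2
  proof -
    have "length (u0 @ u) = b" unfolding u0u using b_in by (simp add: n_def)
    then have lt: "Suc a + length u1 < b" using that len by simp
    have "u0 @ u1 = take (Suc a + length u1) (u0 @ u)" using that len by simp
    also have "\<dots> = take (Suc a + length u1) uu" unfolding u0u using lt by (simp add: min_def)
    finally have "wprod (u0 @ u1) = r (Suc a + length u1)" by (simp add: r_def)
    then show ?thesis
      using a_max[of "Suc a + length u1"] b_min[of "Suc a + length u1"] lt b_in rc cdist_sym[OF y rc] by auto
  qed
  have "axis P V adj A head u0 u u3 y (wprod u0) (wprod (u0 @ u)) (coarse_stabilizer e y)"
  proof (unfold_locales)
    show "minimal (u0 @ u @ u3)" "y = wprod (u0 @ u @ u3)" using uu split by simp_all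
    show "coarse_stabilizer e y \<subseteq> carrier P" by (auto simp: coarse_stabilizer_def)
    show "V \<noteq> {v}" for v using other_vertex by blast
    show "\<exists>u1 b u2. u = u1 @ (v, b) # u2" if v: "v \<in> V" for v
    proof (rule ccontr)
      assume none: "\<not> ?thesis"
      have "s \<in> (SIGMA w:V - {v}. A w)" if s: "s \<in> set u" for s
      proof -
        obtain u1 u2 where e: "u = u1 @ s # u2" using s split_list by metis
        then have "fst s \<noteq> v" using none by (metis prod.collapse)
        moreover have "fst s \<in> V" "snd s \<in> A (fst s)" using V(2) e by auto
        ultimately show ?thesis by (cases s) auto
      qed
      then have "u \<in> words (V - {v})" unfolding words_def by blast
      then have "wprod u \<in> span (V - {v})" by (rule wprod_span) blast
      moreover have "r b = r (Suc a) \<otimes> wprod u" using V by (simp add: wprod_append flip: p)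
      ultimately have "(r (Suc a), r b) \<in> cstep"
        using v rc[of b] rc[of "Suc a"] wprod_closed[OF V(2)] unfolding cstep_def by auto
      then have "cdist (r (Suc a)) (r b) \<le> 1" by (rule cdist_step)
      moreover have "cdist (r a) (r (Suc a)) \<le> 1" using rstep an by blast
      ultimately have "cdist \<one> y \<le> m + 1 + 1 + m"
        using cdist_triangle[of \<one> "r a" y] cdist_triangle[of "r a" "r (Suc a)" y]
          cdist_triangle[of "r (Suc a)" "r b" y] a_in b_in rc y by auto
      then show False using far by (simp add: m_def)
    qed
    fix g u1 v b u2 assume g: "g \<in> coarse_stabilizer e y" and e: "u = u1 @ (v, b) # u2"
    let ?x = "wprod (u0 @ u1)"
    have v: "v \<in> V" using V e by auto
    have gc: "g \<in> carrier P" "cdist \<one> g \<le> e" "cdist y (g \<otimes> y) \<le> e"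
      using g by (auto simp: coarse_stabilizer_def)
    note x = pos[OF e]
    show "\<not> sep v (g \<otimes> ?x) \<one> g"
    proof
      assume "sep v (g \<otimes> ?x) \<one> g"
      then have "cdist g (g \<otimes> ?x) \<le> cdist g \<one> + 1" using cdist_sep_path[of v "g \<otimes> ?x" g \<one>] sep_sym v x gc by simp
      then have "cdist \<one> ?x \<le> e + 1" using cdist_left[of g \<one> ?x] cdist_sym[of g \<one>] gc x by simp
      then show False using x by (simp add: m_def)
    qed
    show "\<not> sep v (g \<otimes> ?x) y (g \<otimes> y)"
    proof
      assume "sep v (g \<otimes> ?x) y (g \<otimes> y)"
      then have "cdist (g \<otimes> y) (g \<otimes> ?x) \<le> cdist (g \<otimes> y) y + 1"
        using cdist_sep_path[of v "g \<otimes> ?x" "g \<otimes> y" y] sep_sym v x gc y by simp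
      then have "cdist y ?x \<le> e + 1" using cdist_left[of g y ?x] cdist_sym[of "g \<otimes> y" y] gc x y by simp
      then show False using x by (simp add: m_def)
    qed
  qed (use connected in auto)
  with that show thesis by blast
qed

lemma diameter_bound:
  obtains K where "\<And>v w. v \<in> V \<Longrightarrow> w \<in> V \<Longrightarrow>
    \<exists>k\<le>K. (v, w) \<in> {(a, b). a \<in> V \<and> b \<in> V \<and> a \<noteq> b \<and> \<not> adj a b} ^^ k"
proof -
  let ?N = "{(a, b). a \<in> V \<and> b \<in> V \<and> a \<noteq> b \<and> \<not> adj a b}"
  define l where "l = (\<lambda>(v, w). LEAST k. (v, w) \<in> ?N ^^ k)"
  have fin: "finite (l ` (V \<times> V))" using finite_V by simp
  have "\<exists>k\<le>Max (l ` (V \<times> V)). (v, w) \<in> ?N ^^ k" if "v \<in> V" "w \<in> V" for v w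
  proof -
    have "(v, w) \<in> ?N ^^ l (v, w)"
      using connected[OF that] unfolding l_def rtrancl_power by (auto intro: LeastI_ex)
    moreover have "l (v, w) \<le> Max (l ` (V \<times> V))" using that fin by (intro Max_ge) auto
    ultimately show ?thesis by blast
  qed
  with that show thesis by blast
qed

text \<open>The translates of one half-space \<open>S\<close> are distinct by \<open>E_inj\<close>
  and form a chain. If there were more than \<open>M\<close>, take every \<open>2 * K\<close>-th one
  as \<open>Z 0, ..., Z m\<close>. An edge gets past at most one of these, since a half-space of the
  label it omits lies between any two neighbours. On the other hand, the translates of
  \<open>x\<close> stay at nearly constant distance from \<open>\<one>\<close>, which leaves a
  shortest path at most \<open>m\<close> steps to get from outside \<open>Z 0\<close> into
  \<open>Z m\<close>.\<close>

theorem acylindrical_cdist: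
  "\<exists>N. \<forall>y\<in>carrier P. 2 * e + 7 \<le> cdist \<one> y \<longrightarrow>
    finite (coarse_stabilizer e y) \<and> card (coarse_stabilizer e y) \<le> N"
proof -
  obtain K where K: "\<And>v w. v \<in> V \<Longrightarrow> w \<in> V \<Longrightarrow>
    \<exists>k\<le>K. (v, w) \<in> {(a, b). a \<in> V \<and> b \<in> V \<and> a \<noteq> b \<and> \<not> adj a b} ^^ k"
    using diameter_bound by blast
  \<comment> \<open>\<open>m\<close> is the sum of the errors \<open>e + 2\<close> in
    \<open>lower\<close> and \<open>e + 1\<close> in \<open>upper\<close>; in \<open>M\<close>, each
    of the \<open>m\<close> gaps is given \<open>2 * K\<close> members of the chain, as
    \<open>between_all\<close> requires.\<close>
  define m where "m = 2 * e + 3"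
  define M where "M = 2 * K * m"
  have "finite (coarse_stabilizer e y) \<and> card (coarse_stabilizer e y) \<le> M"
    if y: "y \<in> carrier P" "2 * e + 7 \<le> cdist \<one> y" for y
  proof -
    obtain u0 u u3 where "axis P V adj A head u0 u u3 y (wprod u0) (wprod (u0 @ u)) (coarse_stabilizer e y)"
      by (rule axis_exists[OF y])
    then interpret axis P V adj A head u0 u u3 y "wprod u0" "wprod (u0 @ u)" "coarse_stabilizer e y" .
    let ?E = "coarse_stabilizer e y"
    obtain v where v: "v \<in> V" using other_vertex by blast
    obtain u1 b u2 where ub: "u = u1 @ (v, b) # u2" using labels v by blast
    define x where "x = wprod (u0 @ u1)"
    define S where "S = halfspace v x"
    have S: "S \<in> mid v" "x \<otimes> b \<in> S" using split_mid[OF ub] by (auto simp: S_def x_def)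
    have b: "b \<in> A v" "b \<in> carrier P" and x: "x \<in> carrier P"
      using ub axis_words wprod_closed A_closed[of v b] by (auto simp: x_def)
    have inj: "inj_on (\<lambda>g. lmul g S) ?E" by (rule inj_onI) (rule E_inj[OF _ _ S(1) v])
    have sub: "(\<lambda>g. lmul g S) ` ?E \<subseteq> halfspaces y v" using lmul_mid v S by blast
    have fin: "finite ((\<lambda>g. lmul g S) ` ?E)" using sub finite_halfspaces[OF y(1) v] by (rule finite_subset)
    have cmp: "X \<subseteq> Y \<or> Y \<subseteq> X" if "X \<in> (\<lambda>g. lmul g S) ` ?E" "Y \<in> (\<lambda>g. lmul g S) ` ?E" for X Y
      using halfspaces_comparable[OF _ _ v v adj_irrefl] sub that by blast
    have "card ?E \<le> M"
    proof (rule ccontr)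
      assume "\<not> ?thesis"
      then have "M < card ((\<lambda>g. lmul g S) ` ?E)" using card_image[OF inj] by simp
      then obtain f where f: "\<And>i. i \<le> M \<Longrightarrow> f i \<in> (\<lambda>g. lmul g S) ` ?E" "\<And>i. i < M \<Longrightarrow> f (Suc i) \<subset> f i"
        using chain_enumeration[OF fin cmp] by metis
      then have "\<forall>i. \<exists>g. i \<le> M \<longrightarrow> g \<in> ?E \<and> f i = lmul g S" by blast
      then obtain h where h: "\<And>i. i \<le> M \<Longrightarrow> h i \<in> ?E" "\<And>i. i \<le> M \<Longrightarrow> f i = lmul (h i) S" by metis
      have prec: "prec (h i) (h (Suc i)) S" if "i < M" for i
        using f(2)[OF that] h(2)[of i] h(2)[of "Suc i"] that by (simp add: prec_def)
      have dec: "lmul (h j) S \<subseteq> lmul (h i) S" if "i \<le> j" "j \<le> M" for i j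
        using that
      proof (induction rule: dec_induct)
        case (step n)
        then show ?case using prec[of n] by (auto simp: prec_def)
      qed simp
      define Z where "Z = (\<lambda>j. lmul (h (2 * K * j)) S)"
      have idx: "2 * K * i \<le> 2 * K * j" "2 * K * j \<le> M" if "i \<le> j" "j \<le> m" for i j
        using that by (simp_all add: M_def)
      have Zstep: "r' \<notin> Z (Suc j)" if j: "j < m" and r: "(r, r') \<in> cstep" "r \<notin> Z j" for j r r'
      proof -
        obtain w where w: "r \<in> carrier P" "r' \<in> carrier P" "w \<in> V" "inv r \<otimes> r' \<in> span (V - {w})"
          using r(1) by (auto simp: cstep_def)
        obtain k where k: "k \<le> K" "(v, w) \<in> {(a, b). a \<in> V \<and> b \<in> V \<and> a \<noteq> b \<and> \<not> adj a b} ^^ k"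
          using K v w by blast
        have le: "2 * K * j + 2 * k \<le> 2 * K * Suc j" "2 * K * Suc j \<le> M" using k j idx[of "Suc j" "Suc j"] by auto
        obtain T l where T: "T \<in> mid w" "l \<le> M" "lmul (h l) T \<subseteq> lmul (h (2 * K * j)) S"
          "lmul (h (2 * K * j + 2 * k)) S \<subseteq> lmul (h l) T"
          by (rule between_all[OF k(2) S(1) v, of M h "2 * K * j"]) (use h prec le in auto)
        have "r \<notin> lmul (h l) T" using r T unfolding Z_def by blast
        then have "r' \<notin> lmul (h l) T"
          using halfspaces_span[OF lmul_mid[OF h(1)[OF T(2)] w(3) T(1)] w(3,1,2,4)] by blast
        moreover have "Z (Suc j) \<subseteq> lmul (h l) T" using T(4) dec[OF le] unfolding Z_def by blast
        ultimately show ?thesis by blast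
      qed
      have Zpath: "r' \<notin> Z j" if "(r, r') \<in> cstep ^^ j" "r \<notin> Z 0" "j \<le> m" for r r' j
        using that
      proof (induction j arbitrary: r')
        case (Suc j)
        then obtain t where t: "(r, t) \<in> cstep ^^ j" "(t, r') \<in> cstep" by auto
        then have "t \<notin> Z j" using Suc by simp
        then show ?case using Zstep[of j t r'] t Suc.prems by simp
      qed simp
      have Zdec: "Z j \<subseteq> Z i" if "i \<le> j" "j \<le> m" for i j
        unfolding Z_def using dec idx that by blast
      define g0 where "g0 = h 0"
      define g1 where "g1 = h (2 * K * m)"
      have "g0 \<in> ?E" "g1 \<in> ?E" using h(1) by (simp_all add: g0_def g1_def M_def)
      then have g: "g0 \<in> carrier P" "g1 \<in> carrier P" "cdist \<one> g0 \<le> e" "cdist \<one> g1 \<le> e"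
        by (auto simp: coarse_stabilizer_def)
      \<comment> \<open>The target is the far end of a translated boundary edge: it lies in the last
        half-space and within distance 1 of \<open>g1 \<otimes> x\<close>.\<close>
      let ?t = "g1 \<otimes> (x \<otimes> b)"
      have t: "?t \<in> carrier P" using g x b by simp
      have tZ: "?t \<in> Z m" using S(2) unfolding Z_def g1_def[symmetric] lmul_def by blast
      have Z0: "Z 0 = {r \<in> carrier P. sep v (g0 \<otimes> x) g0 r}"
        using lmul_halfspace[OF g(1) x] by (simp add: Z_def g0_def S_def)
      have "Z 0 \<in> halfspaces y v" using lmul_mid[OF \<open>g0 \<in> ?E\<close> v S(1)] by (simp add: Z_def g0_def)
      then have one: "\<one> \<notin> Z 0" using one_notin_halfspace by (auto simp: halfspaces_def)
      have tZ0: "?t \<in> Z 0" using tZ Zdec[of 0 m] by blast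
      obtain i z z' where i: "i < cdist \<one> ?t" "(\<one>, z) \<in> cstep ^^ i" "(z, z') \<in> cstep"
        "(z, ?t) \<in> cstep ^^ (cdist \<one> ?t - i)" "z \<notin> Z 0" "\<not> z' \<notin> Z 0"
        by (rule relpow_cross[OF cdist_path[OF one_closed t], of "\<lambda>g. g \<notin> Z 0"]) (use one tZ0 in auto)
      have zc: "z \<in> carrier P" "z' \<in> carrier P" using i(3) cstep_closed by auto
      have "sep v (g0 \<otimes> x) z z'" using i(5,6) zc unfolding Z0 sep_def by auto
      then have "cdist z (g0 \<otimes> x) \<le> 2" using cdist_sep i(3) v g x by blast
      moreover have "cdist \<one> z \<le> i" using i(2) by (rule cdist_le)
      moreover have "cdist \<one> x = cdist g0 (g0 \<otimes> x)" using cdist_left[of g0 \<one> x] g x by simp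
      ultimately have lower: "cdist \<one> x \<le> e + i + 2"
        using cdist_triangle[of g0 \<one> "g0 \<otimes> x"] cdist_triangle[of \<one> z "g0 \<otimes> x"] cdist_sym[of g0 \<one>] g x zc by simp
      have "cdist g1 (g1 \<otimes> x) = cdist \<one> x" using cdist_left[of g1 \<one> x] g x by simp
      moreover have "cdist (g1 \<otimes> x) ?t \<le> 1"
        using cdist_step[OF cstep_letter[of "g1 \<otimes> x" v b]] g x b v by (simp add: m_assoc)
      ultimately have upper: "cdist \<one> ?t \<le> e + cdist \<one> x + 1"
        using cdist_triangle[of \<one> g1 ?t] cdist_triangle[of g1 "g1 \<otimes> x" ?t] g x b by simp
      \<comment> \<open>At \<open>z\<close> the path is still outside \<open>Z 0\<close>, while
        \<open>?t\<close> lies in \<open>Z m\<close>; each remaining step gains at most one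
        index.\<close>
      have "m < cdist \<one> ?t - i"
      proof (rule ccontr)
        assume "\<not> ?thesis"
        then have "?t \<notin> Z (cdist \<one> ?t - i)" "Z m \<subseteq> Z (cdist \<one> ?t - i)" using Zpath[OF i(4,5)] Zdec by simp_all
        then show False using tZ by blast
      qed
      then show False using lower upper by (simp add: m_def)
    qed
    then show ?thesis using finite_imageD[OF fin inj] by blast
  qed
  then show ?thesis by blast
qed

end

section \<open>Normal forms in graph products\<close>

context graph_product_setup begin

lemma arc_sym: "(v, w) \<in> parcs \<Gamma> \<Longrightarrow> (w, v) \<in> parcs \<Gamma>"
proof -
  interpret \<Gamma>: pair_graph \<Gamma> by (rule graph_Gamma)
  show "(v, w) \<in> parcs \<Gamma> \<Longrightarrow> (w, v) \<in> parcs \<Gamma>" by (rule \<Gamma>.arcs_symmetric)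
qed

lemma arc_irrefl: "(v, v) \<notin> parcs \<Gamma>"
proof -
  interpret \<Gamma>: pair_graph \<Gamma> by (rule graph_Gamma)
  show ?thesis by (auto dest: \<Gamma>.no_loops)
qed

lemma arc_pverts: "(v, w) \<in> parcs \<Gamma> \<Longrightarrow> v \<in> pverts \<Gamma> \<and> w \<in> pverts \<Gamma>"
proof -
  interpret \<Gamma>: pair_graph \<Gamma> by (rule graph_Gamma)
  show "(v, w) \<in> parcs \<Gamma> \<Longrightarrow> v \<in> pverts \<Gamma> \<and> w \<in> pverts \<Gamma>"
    by (auto dest: \<Gamma>.in_arcsD1 \<Gamma>.in_arcsD2)
qed

text \<open>The search finds a letter of label \<open>v\<close> preceded only by letters of
  neighbours of \<open>v\<close>, which can therefore be shuffled to the front. Any other letter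
  blocks it and gives the identity.\<close>

primrec syllable :: "'v \<Rightarrow> ('v \<times> 'a) list \<Rightarrow> 'a" where
  "syllable v [] = \<one>\<^bsub>G v\<^esub>"
| "syllable v (s # u) =
    (if fst s = v then snd s else if (v, fst s) \<in> parcs \<Gamma> then syllable v u else \<one>\<^bsub>G v\<^esub>)"

primrec remainder :: "'v \<Rightarrow> ('v \<times> 'a) list \<Rightarrow> ('v \<times> 'a) list" where
  "remainder v [] = []"
| "remainder v (s # u) =
    (if fst s = v then u else if (v, fst s) \<in> parcs \<Gamma> then s # remainder v u else s # u)"

text \<open>A later letter that could be shuffled next to \<open>s\<close> and merged with it would
  show up as a nontrivial syllable, as all letters of the tail are nontrivial.\<close>

primrec reduced :: "('v \<times> 'a) list \<Rightarrow> bool" where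
  "reduced [] \<longleftrightarrow> True"
| "reduced (s # u) \<longleftrightarrow> fst s \<in> pverts \<Gamma> \<and> snd s \<in> carrier (G (fst s)) \<and> snd s \<noteq> \<one>\<^bsub>G (fst s)\<^esub> \<and>
    syllable (fst s) u = \<one>\<^bsub>G (fst s)\<^esub> \<and> reduced u"

inductive shuffle :: "('v \<times> 'a) list \<Rightarrow> ('v \<times> 'a) list \<Rightarrow> bool" where
  shuffle_refl: "shuffle u u"
| shuffle_trans: "shuffle u u' \<Longrightarrow> shuffle u' u'' \<Longrightarrow> shuffle u u''"
| shuffle_Cons: "shuffle u u' \<Longrightarrow> shuffle (s # u) (s # u')"
| shuffle_swap: "(fst s, fst t) \<in> parcs \<Gamma> \<Longrightarrow> shuffle (s # t # u) (t # s # u)"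

lemma shuffle_sym: "shuffle u u' \<Longrightarrow> shuffle u' u"
proof (induction rule: shuffle.induct)
  case (shuffle_trans u u' u'')
  then show ?case by (blast intro: shuffle.shuffle_trans)
next
  case (shuffle_swap s t u)
  then show ?case by (intro shuffle.shuffle_swap[OF arc_sym])
qed (auto intro: shuffle_refl shuffle_Cons)

lemma syllable_shuffle: "shuffle u u' \<Longrightarrow> syllable v u = syllable v u'"
proof (induction rule: shuffle.induct)
  case (shuffle_swap s t u)
  then show ?case using arc_sym[of "fst s" "fst t"] arc_irrefl[of "fst s"] by auto
qed auto

lemma remainder_shuffle: "shuffle u u' \<Longrightarrow> shuffle (remainder v u) (remainder v u')"
proof (induction rule: shuffle.induct)
  case (shuffle_trans u u' u'')
  then show ?case by (blast intro: shuffle.shuffle_trans)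
next
  case (shuffle_swap s t u)
  then show ?case
    using arc_sym[of "fst s" "fst t"] arc_irrefl[of "fst s"]
    by (auto intro: shuffle_refl shuffle.shuffle_swap)
qed (auto intro: shuffle_refl shuffle_Cons)

lemma reduced_words: "reduced u \<Longrightarrow> u \<in> fp_words (pverts \<Gamma>) G"
  by (induction u) (auto simp: fp_words_def)

lemma one_closed_G: "v \<in> pverts \<Gamma> \<Longrightarrow> \<one>\<^bsub>G v\<^esub> \<in> carrier (G v)"
  by (intro monoid.one_closed group.is_monoid groups)

lemma syllable_closed: "u \<in> fp_words (pverts \<Gamma>) G \<Longrightarrow> v \<in> pverts \<Gamma> \<Longrightarrow> syllable v u \<in> carrier (G v)"
  by (induction u) (auto simp: fp_words_def one_closed_G)

lemma remainder_words: "u \<in> fp_words (pverts \<Gamma>) G \<Longrightarrow> remainder v u \<in> fp_words (pverts \<Gamma>) G"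
  by (induction u) (auto simp: fp_words_def)

lemma syllable_remainder_adj: "(w, v) \<in> parcs \<Gamma> \<Longrightarrow> syllable w (remainder v u) = syllable w u"
  using arc_irrefl by (induction u) auto

lemma remainder_reduced: "reduced u \<Longrightarrow> reduced (remainder v u)"
  by (induction u) (auto simp: syllable_remainder_adj[OF arc_sym])

lemma syllable_remainder: "reduced u \<Longrightarrow> syllable v (remainder v u) = \<one>\<^bsub>G v\<^esub>"
  by (induction u) auto

text \<open>Letters of a reduced word are never the identity, so a trivial syllable means that no
  letter of label \<open>v\<close> can reach the front.\<close>

lemma remainder_trivial: "reduced u \<Longrightarrow> syllable v u = \<one>\<^bsub>G v\<^esub> \<Longrightarrow> remainder v u = u"
  by (induction u) (auto split: if_splits)

lemma shuffle_front: "syllable v u \<noteq> \<one>\<^bsub>G v\<^esub> \<Longrightarrow> shuffle ((v, syllable v u) # remainder v u) u"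
proof (induction u)
  case (Cons s u)
  show ?case
  proof (cases "fst s = v")
    case True
    then show ?thesis by (cases s) (auto intro: shuffle_refl)
  next
    case False
    then have adj: "(v, fst s) \<in> parcs \<Gamma>" and n: "syllable v u \<noteq> \<one>\<^bsub>G v\<^esub>" using Cons.prems by (auto split: if_splits)
    have "shuffle ((v, syllable v u) # s # remainder v u) (s # (v, syllable v u) # remainder v u)"
      using adj by (intro shuffle_swap) simp
    moreover have "shuffle (s # (v, syllable v u) # remainder v u) (s # u)"
      using Cons.IH n by (intro shuffle_Cons) simp
    ultimately have "shuffle ((v, syllable v u) # s # remainder v u) (s # u)" by (rule shuffle_trans)
    then show ?thesis using False adj by simp
  qed
qed simp

lemma remainder_commute: "(v, w) \<in> parcs \<Gamma> \<Longrightarrow> remainder v (remainder w u) = remainder w (remainder v u)"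
proof -
  assume "(v, w) \<in> parcs \<Gamma>"
  moreover from this have "(w, v) \<in> parcs \<Gamma>" "v \<noteq> w" using arc_sym[of v w] arc_irrefl[of v] by auto
  ultimately show "remainder v (remainder w u) = remainder w (remainder v u)" by (induction u) auto
qed

text \<open>Left multiplication on reduced words. As in van der Waerden's argument for free
  products, these maps form an action, here only up to \<open>shuffle\<close>, from which uniqueness
  of normal forms follows.\<close>

definition prepend :: "'v \<Rightarrow> 'a \<Rightarrow> ('v \<times> 'a) list \<Rightarrow> ('v \<times> 'a) list" where
  "prepend v a u = (let c = a \<otimes>\<^bsub>G v\<^esub> syllable v u in
    if c = \<one>\<^bsub>G v\<^esub> then remainder v u else (v, c) # remainder v u)"

lemma prepend_reduced:
  assumes "reduced u" "v \<in> pverts \<Gamma>" "a \<in> carrier (G v)"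
  shows "reduced (prepend v a u)"
proof -
  interpret Gv: group "G v" by (rule groups) (rule assms)
  show ?thesis
    using assms(2,3) syllable_closed[OF reduced_words[OF assms(1)] assms(2)]
      remainder_reduced[OF assms(1), of v] syllable_remainder[OF assms(1), of v]
    by (simp add: prepend_def Let_def)
qed

lemma syllable_prepend: "reduced u \<Longrightarrow> syllable v (prepend v a u) = a \<otimes>\<^bsub>G v\<^esub> syllable v u"
  by (simp add: prepend_def Let_def syllable_remainder)

lemma remainder_prepend: "reduced u \<Longrightarrow> remainder v (prepend v a u) = remainder v u"
  using remainder_trivial[of "remainder v u" v] remainder_reduced[of u v] syllable_remainder[of u v]
  by (simp add: prepend_def Let_def)

lemma prepend_prepend:
  assumes "reduced u" "v \<in> pverts \<Gamma>" "a \<in> carrier (G v)" "b \<in> carrier (G v)"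
  shows "prepend v a (prepend v b u) = prepend v (a \<otimes>\<^bsub>G v\<^esub> b) u"
proof -
  interpret Gv: group "G v" by (rule groups) (rule assms)
  have "a \<otimes>\<^bsub>G v\<^esub> (b \<otimes>\<^bsub>G v\<^esub> syllable v u) = a \<otimes>\<^bsub>G v\<^esub> b \<otimes>\<^bsub>G v\<^esub> syllable v u"
    using assms syllable_closed[OF reduced_words[OF assms(1)] assms(2)] by (simp add: Gv.m_assoc)
  then show ?thesis
    using syllable_prepend[OF assms(1), of v b] remainder_prepend[OF assms(1), of v b]
    by (simp add: prepend_def[of v a "prepend v b u"] prepend_def[of v "a \<otimes>\<^bsub>G v\<^esub> b" u] Let_def)
qed

lemma prepend_one:
  assumes "reduced u" "v \<in> pverts \<Gamma>" shows "shuffle (prepend v \<one>\<^bsub>G v\<^esub> u) u"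
proof -
  interpret Gv: group "G v" by (rule groups) (rule assms)
  show ?thesis
    using assms syllable_closed[OF reduced_words[OF assms(1)] assms(2)] shuffle_front[of v u] remainder_trivial[of u v]
    by (auto simp: prepend_def Let_def shuffle_refl)
qed

lemma prepend_shuffle: "shuffle u u' \<Longrightarrow> shuffle (prepend v a u) (prepend v a u')"
  using syllable_shuffle[of u u' v] remainder_shuffle[of u u' v] by (auto simp: prepend_def Let_def intro: shuffle_Cons)

lemma syllable_prepend_adj: "(v, w) \<in> parcs \<Gamma> \<Longrightarrow> syllable v (prepend w b u) = syllable v u"
  using arc_irrefl by (auto simp: prepend_def Let_def syllable_remainder_adj)

text \<open>Adjacent labels do not influence each other's syllables, and the two removals commute;
  only the order of the two new front letters can differ.\<close>

lemma prepend_commute: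
  assumes "(v, w) \<in> parcs \<Gamma>"
  shows "shuffle (prepend v a (prepend w b u)) (prepend w b (prepend v a u))"
proof -
  have n: "v \<noteq> w" "(w, v) \<in> parcs \<Gamma>" using assms arc_sym[of v w] arc_irrefl[of v] by auto
  then have r: "remainder v (prepend w b u) = (if b \<otimes>\<^bsub>G w\<^esub> syllable w u = \<one>\<^bsub>G w\<^esub> then remainder v (remainder w u)
      else (w, b \<otimes>\<^bsub>G w\<^esub> syllable w u) # remainder v (remainder w u))"
    "remainder w (prepend v a u) = (if a \<otimes>\<^bsub>G v\<^esub> syllable v u = \<one>\<^bsub>G v\<^esub> then remainder v (remainder w u)
      else (v, a \<otimes>\<^bsub>G v\<^esub> syllable v u) # remainder v (remainder w u))"
    using assms remainder_commute[OF assms] by (auto simp: prepend_def Let_def)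
  have "prepend v a (prepend w b u) = (if a \<otimes>\<^bsub>G v\<^esub> syllable v u = \<one>\<^bsub>G v\<^esub> then remainder v (prepend w b u)
      else (v, a \<otimes>\<^bsub>G v\<^esub> syllable v u) # remainder v (prepend w b u))"
    using syllable_prepend_adj[OF assms] by (simp add: prepend_def[of v a "prepend w b u"] Let_def)
  moreover have "prepend w b (prepend v a u) = (if b \<otimes>\<^bsub>G w\<^esub> syllable w u = \<one>\<^bsub>G w\<^esub> then remainder w (prepend v a u)
      else (w, b \<otimes>\<^bsub>G w\<^esub> syllable w u) # remainder w (prepend v a u))"
    using syllable_prepend_adj[OF n(2)] by (simp add: prepend_def[of w b "prepend v a u"] Let_def)
  ultimately show ?thesis using assms by (auto simp: r intro: shuffle_refl shuffle_swap)
qed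

section \<open>The action of the free product on reduced words\<close>

definition act :: "('v \<times> 'a) list \<Rightarrow> ('v \<times> 'a) list \<Rightarrow> ('v \<times> 'a) list" where
  "act w u = foldr (\<lambda>s. prepend (fst s) (snd s)) w u"

lemma act_simps: "act [] u = u" "act (s # w) u = prepend (fst s) (snd s) (act w u)" "act (w @ w') u = act w (act w' u)"
  by (simp_all add: act_def)

lemma act_reduced: "w \<in> fp_words (pverts \<Gamma>) G \<Longrightarrow> reduced u \<Longrightarrow> reduced (act w u)"
  by (induction w) (auto simp: act_simps fp_words_def intro: prepend_reduced)

lemma act_shuffle: "shuffle u u' \<Longrightarrow> shuffle (act w u) (act w u')"
  by (induction w) (auto simp: act_simps intro: prepend_shuffle)

lemma act_of_reduced: "reduced u \<Longrightarrow> act u [] = u"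
proof (induction u)
  case (Cons s u)
  then interpret Gv: group "G (fst s)" by (intro groups) simp
  show ?case using Cons remainder_trivial[of u "fst s"] by (simp add: act_simps prepend_def)
qed (simp add: act_simps)

lemma act_step: "(w, w') \<in> fp_step (pverts \<Gamma>) G \<Longrightarrow> reduced u \<Longrightarrow> shuffle (act w u) (act w' u)"
proof (induction rule: fp_step.induct)
  case (fp_one a b v)
  then show ?case by (simp add: act_simps act_shuffle prepend_one act_reduced)
next
  case (fp_mult a b v g h)
  then show ?case by (simp add: act_simps prepend_prepend act_reduced shuffle_refl)
qed

lemma act_cls:
  assumes "cls w = cls w'" "w \<in> fp_words (pverts \<Gamma>) G" "w' \<in> fp_words (pverts \<Gamma>) G" "reduced u"
  shows "shuffle (act w u) (act w' u)"
proof -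
  have "(w, w') \<in> fp_rel (pverts \<Gamma>) G"
    using assms eq_equiv_class_iff[OF equiv_rel] by blast
  then have "(w, w') \<in> (fp_step (pverts \<Gamma>) G \<union> (fp_step (pverts \<Gamma>) G)\<inverse>)\<^sup>*" by (simp add: fp_rel_def)
  then show ?thesis
  proof induction
    case (step a b)
    then have "shuffle (act a u) (act b u)" using act_step[OF _ assms(4)] shuffle_sym by blast
    with step.IH show ?case by (rule shuffle_trans)
  qed (rule shuffle_refl)
qed

text \<open>Membership of a class asks for one representative that acts trivially up to
  \<open>shuffle\<close>; by \<open>act_cls\<close> all representatives then do.\<close>

definition act_kernel :: "('v \<times> 'a) list set set" where
  "act_kernel = {cls w | w. w \<in> fp_words (pverts \<Gamma>) G \<and> (\<forall>u. reduced u \<longrightarrow> shuffle (act w u) u)}"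

lemma act_kernel_cls:
  assumes "cls w \<in> act_kernel" "w \<in> fp_words (pverts \<Gamma>) G" "reduced u"
  shows "shuffle (act w u) u"
proof -
  obtain w' where "cls w = cls w'" "w' \<in> fp_words (pverts \<Gamma>) G" "shuffle (act w' u) u"
    using assms unfolding act_kernel_def by blast
  then show ?thesis using act_cls assms shuffle_trans by blast
qed

lemma act_kernelI:
  "w \<in> fp_words (pverts \<Gamma>) G \<Longrightarrow> (\<And>u. reduced u \<Longrightarrow> shuffle (act w u) u) \<Longrightarrow> cls w \<in> act_kernel"
  unfolding act_kernel_def by blast

lemma act_kernel_normal: "act_kernel \<lhd> F"
proof -
  interpret F: group F by (rule group_free_product)
  \<comment> \<open>The word \<open>w'\<close> need not be the formal inverse of \<open>w\<close>;
    what counts is that \<open>w @ w'\<close> acts like the empty word up to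
    \<open>shuffle\<close>.\<close>
  have inv: "\<exists>w'\<in>fp_words (pverts \<Gamma>) G. inv\<^bsub>F\<^esub> (cls w) = cls w' \<and>
      (\<forall>u. reduced u \<longrightarrow> shuffle (act w (act w' u)) u)" if w: "w \<in> fp_words (pverts \<Gamma>) G" for w
  proof -
    have c: "cls w \<in> carrier F" using w carrier_cls by blast
    obtain w' where w': "w' \<in> fp_words (pverts \<Gamma>) G" "inv\<^bsub>F\<^esub> (cls w) = cls w'"
      using F.inv_closed[OF c] carrier_cls by blast
    have "cls (w @ w') = cls []" using F.r_inv[OF c] w w' by (simp add: mult_cls one_cls)
    then have "shuffle (act w (act w' u)) u" if "reduced u" for u
      using act_cls[of "w @ w'" "[]" u] that w w' by (simp add: words_simps act_simps)
    with w' show ?thesis by blast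
  qed
  show ?thesis
  proof (rule F.normal_invI)
    show "subgroup act_kernel F"
    proof (rule F.subgroupI)
      show "act_kernel \<subseteq> carrier F" unfolding act_kernel_def using carrier_cls by blast
      show "act_kernel \<noteq> {}" using act_kernelI[of "[]"] words_Nil shuffle_refl by (auto simp: act_simps)
    next
      fix X assume "X \<in> act_kernel"
      then obtain w where w: "w \<in> fp_words (pverts \<Gamma>) G" "X = cls w" unfolding act_kernel_def by blast
      obtain w' where w': "w' \<in> fp_words (pverts \<Gamma>) G" "inv\<^bsub>F\<^esub> X = cls w'"
        "\<And>u. reduced u \<Longrightarrow> shuffle (act w (act w' u)) u" using inv[OF w(1)] w(2) by blast
      have "shuffle (act w' u) u" if "reduced u" for u
        using act_kernel_cls[of w "act w' u"] \<open>X \<in> act_kernel\<close> w w' that act_reduced shuffle_trans shuffle_sym by blast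
      then show "inv\<^bsub>F\<^esub> X \<in> act_kernel" using w' act_kernelI by simp
    next
      fix X Y assume XY: "X \<in> act_kernel" "Y \<in> act_kernel"
      then obtain w w' where w: "w \<in> fp_words (pverts \<Gamma>) G" "X = cls w" "w' \<in> fp_words (pverts \<Gamma>) G" "Y = cls w'"
        unfolding act_kernel_def by blast
      have "shuffle (act (w @ w') u) u" if "reduced u" for u
      proof -
        have "shuffle (act w (act w' u)) (act w' u)" "shuffle (act w' u) u"
          using act_kernel_cls XY w that act_reduced by simp_all
        then show ?thesis unfolding act_simps by (rule shuffle_trans)
      qed
      then show "X \<otimes>\<^bsub>F\<^esub> Y \<in> act_kernel" using w act_kernelI by (simp add: mult_cls words_simps)
    qed
  next
    fix X Y assume X: "X \<in> carrier F" and Y: "Y \<in> act_kernel"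
    obtain a where a: "a \<in> fp_words (pverts \<Gamma>) G" "X = cls a" using X carrier_cls by blast
    obtain w where w: "w \<in> fp_words (pverts \<Gamma>) G" "Y = cls w" using Y unfolding act_kernel_def by blast
    obtain a' where a': "a' \<in> fp_words (pverts \<Gamma>) G" "inv\<^bsub>F\<^esub> X = cls a'"
      "\<And>u. reduced u \<Longrightarrow> shuffle (act a (act a' u)) u" using inv[OF a(1)] a(2) by blast
    have "shuffle (act (a @ w @ a') u) u" if "reduced u" for u
    proof -
      have "shuffle (act w (act a' u)) (act a' u)" using act_kernel_cls Y w a' that act_reduced by simp
      then have "shuffle (act a (act w (act a' u))) (act a (act a' u))" by (rule act_shuffle)
      then show ?thesis using a'(3)[OF that] unfolding act_simps by (rule shuffle_trans)
    qed
    then show "X \<otimes>\<^bsub>F\<^esub> Y \<otimes>\<^bsub>F\<^esub> inv\<^bsub>F\<^esub> X \<in> act_kernel"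
      using a a' w act_kernelI[of "a @ w @ a'"] by (simp add: mult_cls words_simps)
  qed
qed

text \<open>By minimality of the normal closure it suffices to treat the commutators, which act
  trivially because \<open>prepend\<close> maps of adjacent labels commute up to
  \<open>shuffle\<close>.\<close>

lemma gp_kernel_act_kernel: "gp_kernel \<Gamma> G \<subseteq> act_kernel"
  unfolding gp_kernel_def normal_closure_def
proof (rule hull_minimal)
  interpret F: group F by (rule group_free_product)
  show "act_kernel \<lhd> F" by (rule act_kernel_normal)
  show "gp_relators \<Gamma> G \<subseteq> act_kernel"
  proof
    fix X assume "X \<in> gp_relators \<Gamma> G"
    then obtain v g w h where vw: "(v, w) \<in> parcs \<Gamma>" "g \<in> carrier (G v)" "h \<in> carrier (G w)"
      and X: "X = commutator F (fp_incl (pverts \<Gamma>) G v g) (fp_incl (pverts \<Gamma>) G w h)"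
      unfolding gp_relators_def by blast
    have V: "v \<in> pverts \<Gamma>" "w \<in> pverts \<Gamma>" using arc_pverts vw by auto
    interpret Gv: group "G v" by (rule groups) (rule V)
    interpret Gw: group "G w" by (rule groups) (rule V)
    interpret iv: group_hom "G v" F "fp_incl (pverts \<Gamma>) G v" by unfold_locales (rule fp_incl_hom[OF V(1)])
    interpret iw: group_hom "G w" F "fp_incl (pverts \<Gamma>) G w" by unfold_locales (rule fp_incl_hom[OF V(2)])
    let ?g = "inv\<^bsub>G v\<^esub> g" and ?h = "inv\<^bsub>G w\<^esub> h"
    have "X = cls [(v, g), (w, h), (v, ?g), (w, ?h)]"
      unfolding X commutator_def iv.hom_inv[OF vw(2), symmetric] iw.hom_inv[OF vw(3), symmetric]
      using vw V by (simp add: fp_incl_def mult_cls words_simps)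
    moreover have "cls [(v, g), (w, h), (v, ?g), (w, ?h)] \<in> act_kernel"
    proof (rule act_kernelI)
      show "[(v, g), (w, h), (v, ?g), (w, ?h)] \<in> fp_words (pverts \<Gamma>) G" using vw V by (simp add: words_simps)
      fix u assume u: "reduced u"
      let ?u = "prepend w ?h u"
      have r: "reduced ?u" "reduced (prepend w h ?u)" using u V vw prepend_reduced by simp_all
      have "shuffle (prepend w h (prepend v ?g ?u)) (prepend v ?g (prepend w h ?u))"
        by (rule prepend_commute[OF arc_sym[OF vw(1)]])
      then have "shuffle (prepend v g (prepend w h (prepend v ?g ?u))) (prepend v g (prepend v ?g (prepend w h ?u)))"
        by (rule prepend_shuffle)
      moreover have "prepend v g (prepend v ?g (prepend w h ?u)) = prepend v \<one>\<^bsub>G v\<^esub> (prepend w h ?u)"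
        using prepend_prepend[OF r(2) V(1)] vw by simp
      moreover have "shuffle (prepend v \<one>\<^bsub>G v\<^esub> (prepend w h ?u)) (prepend w h ?u)" using prepend_one r V by blast
      moreover have "prepend w h ?u = prepend w \<one>\<^bsub>G w\<^esub> u" using prepend_prepend[OF u V(2)] vw by simp
      moreover have "shuffle (prepend w \<one>\<^bsub>G w\<^esub> u) u" using prepend_one u V by blast
      ultimately have "shuffle (prepend v g (prepend w h (prepend v ?g ?u))) u" using shuffle_trans by metis
      then show "shuffle (act [(v, g), (w, h), (v, ?g), (w, ?h)] u) u" by (simp add: act_simps)
    qed
    ultimately show "X \<in> act_kernel" by simp
  qed
qed

section \<open>Evaluation in the graph product and the head map\<close>

primrec ev :: "('v \<times> 'a) list \<Rightarrow> ('v \<times> 'a) list set set" where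
  "ev [] = \<one>\<^bsub>P\<^esub>"
| "ev (s # u) = gp_incl \<Gamma> G (fst s) (snd s) \<otimes>\<^bsub>P\<^esub> ev u"

lemma gp_incl_closed: "v \<in> pverts \<Gamma> \<Longrightarrow> a \<in> carrier (G v) \<Longrightarrow> gp_incl \<Gamma> G v a \<in> carrier P"
  using gp_incl_hom by (auto simp: hom_def)

lemma ev_closed: "u \<in> fp_words (pverts \<Gamma>) G \<Longrightarrow> ev u \<in> carrier P"
proof -
  interpret P: group P by (rule group_graph_product)
  show "u \<in> fp_words (pverts \<Gamma>) G \<Longrightarrow> ev u \<in> carrier P"
    by (induction u) (auto simp: fp_words_def gp_incl_closed)
qed

lemma ev_append:
  "u \<in> fp_words (pverts \<Gamma>) G \<Longrightarrow> u' \<in> fp_words (pverts \<Gamma>) G \<Longrightarrow> ev (u @ u') = ev u \<otimes>\<^bsub>P\<^esub> ev u'"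
proof -
  interpret P: group P by (rule group_graph_product)
  show "u \<in> fp_words (pverts \<Gamma>) G \<Longrightarrow> u' \<in> fp_words (pverts \<Gamma>) G \<Longrightarrow> ev (u @ u') = ev u \<otimes>\<^bsub>P\<^esub> ev u'"
  proof (induction u)
    case (Cons s u)
    then have "fst s \<in> pverts \<Gamma>" "snd s \<in> carrier (G (fst s))" "u \<in> fp_words (pverts \<Gamma>) G" by (auto simp: fp_words_def)
    then show ?case using Cons by (simp add: P.m_assoc gp_incl_closed ev_closed)
  qed (simp add: ev_closed)
qed

lemma ev_cls: "u \<in> fp_words (pverts \<Gamma>) G \<Longrightarrow> ev u = gp_kernel \<Gamma> G #>\<^bsub>F\<^esub> cls u"
proof (induction u)
  interpret P: group P by (rule group_graph_product)
  interpret F: group F by (rule group_free_product)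
  interpret q: group_hom F P "\<lambda>x. gp_kernel \<Gamma> G #>\<^bsub>F\<^esub> x" by unfold_locales (rule quotient_hom)
  {
    case Nil
    show ?case using q.hom_one by (simp add: one_cls)
  next
    case (Cons s u)
    then have s: "[s] \<in> fp_words (pverts \<Gamma>) G" "u \<in> fp_words (pverts \<Gamma>) G" by (auto simp: fp_words_def)
    then have "cls [s] \<in> carrier F" "cls u \<in> carrier F" using carrier_cls by blast+
    moreover have "cls (s # u) = cls [s] \<otimes>\<^bsub>F\<^esub> cls u" using mult_cls[OF s] by simp
    ultimately show ?case using Cons.IH[OF s(2)] by (simp add: q.hom_mult gp_incl_def fp_incl_def)
  }
qed

lemma ev_surj: assumes "g \<in> carrier P" obtains u where "u \<in> fp_words (pverts \<Gamma>) G" "ev u = g"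
proof -
  obtain X where "X \<in> carrier F" "g = gp_kernel \<Gamma> G #>\<^bsub>F\<^esub> X"
    using assms by (auto simp: graph_product_def carrier_FactGroup)
  then obtain u where "u \<in> fp_words (pverts \<Gamma>) G" "X = cls u" using carrier_cls by blast
  then show thesis using that ev_cls \<open>g = _\<close> by simp
qed

text \<open>Uniqueness of normal forms: two words with the same value differ by an element of
  \<open>gp_kernel\<close>, which acts trivially up to \<open>shuffle\<close>.\<close>

lemma ev_eq_shuffle:
  assumes "ev w = ev w'" "w \<in> fp_words (pverts \<Gamma>) G" "w' \<in> fp_words (pverts \<Gamma>) G"
  shows "shuffle (act w []) (act w' [])"
proof -
  interpret F: group F by (rule group_free_product)
  interpret K: normal "gp_kernel \<Gamma> G" F by (rule gp_kernel_normal)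
  have c: "cls w \<in> carrier F" "cls w' \<in> carrier F" using assms carrier_cls by blast+
  have "cls w \<in> gp_kernel \<Gamma> G #>\<^bsub>F\<^esub> cls w'"
    using F.rcos_self[OF c(1) K.subgroup_axioms] assms ev_cls by simp
  then obtain k where k: "k \<in> gp_kernel \<Gamma> G" "cls w = k \<otimes>\<^bsub>F\<^esub> cls w'" by (auto simp: r_coset_def)
  then obtain d where d: "d \<in> fp_words (pverts \<Gamma>) G" "k = cls d" "cls d \<in> act_kernel"
    using gp_kernel_act_kernel unfolding act_kernel_def by blast
  have "cls w = cls (d @ w')" using k d assms by (simp add: mult_cls)
  then have "shuffle (act w []) (act d (act w' []))"
    using act_cls[of w "d @ w'" "[]"] assms d by (simp add: words_simps act_simps)
  moreover have "shuffle (act d (act w' [])) (act w' [])"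
    using act_kernel_cls d assms act_reduced[of w' "[]"] by simp
  ultimately show ?thesis by (rule shuffle_trans)
qed

text \<open>The choice of the word does not matter, because \<open>ev_eq_shuffle\<close> determines
  the reduced word up to \<open>shuffle\<close> and \<open>syllable\<close> is invariant under
  shuffles.\<close>

definition head :: "'v \<Rightarrow> ('v \<times> 'a) list set set \<Rightarrow> ('v \<times> 'a) list set set" where
  "head v g = gp_incl \<Gamma> G v (syllable v (act (SOME w. w \<in> fp_words (pverts \<Gamma>) G \<and> ev w = g) []))"

lemma head_ev:
  assumes "w \<in> fp_words (pverts \<Gamma>) G" shows "head v (ev w) = gp_incl \<Gamma> G v (syllable v (act w []))"
proof -
  let ?w = "SOME w'. w' \<in> fp_words (pverts \<Gamma>) G \<and> ev w' = ev w"
  have "?w \<in> fp_words (pverts \<Gamma>) G \<and> ev ?w = ev w" by (rule someI[of _ w]) (use assms in simp)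
  then have "shuffle (act ?w []) (act w [])" using ev_eq_shuffle assms by blast
  then have "syllable v (act ?w []) = syllable v (act w [])" by (rule syllable_shuffle)
  then show ?thesis by (simp add: head_def)
qed

text \<open>Existence of normal forms: letters are absorbed one by one with \<open>prepend\<close>,
  which multiplies the value as expected because shuffling the front syllable out preserves
  it.\<close>

lemma ev_act: "u \<in> fp_words (pverts \<Gamma>) G \<Longrightarrow> \<exists>u'. reduced u' \<and> ev u' = ev u"
proof -
  interpret P: group P by (rule group_graph_product)
  have sh: "u \<in> fp_words (pverts \<Gamma>) G \<Longrightarrow> ev u' = ev u" if "shuffle u u'" for u u' using that
  proof (induction rule: shuffle.induct)
    case (shuffle_trans u u' u'')
    then have "u' \<in> fp_words (pverts \<Gamma>) G"
    proof -
      have "set u' = set u" if "shuffle u u'" for u u' using that by (induction rule: shuffle.induct) auto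
      then show ?thesis using shuffle_trans by (simp add: fp_words_def lists_eq_set)
    qed
    then show ?case using shuffle_trans by simp
  next
    case (shuffle_Cons u u' s)
    then show ?case by (simp add: fp_words_def)
  next
    case (shuffle_swap s t u)
    then have s: "fst s \<in> pverts \<Gamma>" "snd s \<in> carrier (G (fst s))" "fst t \<in> pverts \<Gamma>" "snd t \<in> carrier (G (fst t))"
      "u \<in> fp_words (pverts \<Gamma>) G" by (auto simp: fp_words_def)
    then show ?case
      using gp_incl_commute[OF shuffle_swap(1), of "snd s" "snd t"]
      by (simp add: P.m_assoc[symmetric] gp_incl_closed ev_closed)
  qed simp
  show "u \<in> fp_words (pverts \<Gamma>) G \<Longrightarrow> \<exists>u'. reduced u' \<and> ev u' = ev u"
  proof (induction u)
    case Nil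
    then show ?case by (intro exI[of _ "[]"]) simp
  next
    case (Cons s u)
    obtain v a where va: "s = (v, a)" by force
    have s: "v \<in> pverts \<Gamma>" "a \<in> carrier (G v)" "u \<in> fp_words (pverts \<Gamma>) G"
      using Cons.prems va by (auto simp: fp_words_def)
    interpret i: group_hom "G v" P "gp_incl \<Gamma> G v"
      using s by (simp add: group_hom_def group_hom_axioms_def groups group_graph_product gp_incl_hom)
    obtain u' where u': "reduced u'" "ev u' = ev u" using Cons.IH s by blast
    let ?c = "syllable v u'" and ?r = "remainder v u'"
    have w: "u' \<in> fp_words (pverts \<Gamma>) G" "?r \<in> fp_words (pverts \<Gamma>) G" "?c \<in> carrier (G v)"
      using u' reduced_words remainder_words syllable_closed s by simp_all
    have e: "ev u' = gp_incl \<Gamma> G v ?c \<otimes>\<^bsub>P\<^esub> ev ?r"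
    proof (cases "?c = \<one>\<^bsub>G v\<^esub>")
      case True
      then show ?thesis using remainder_trivial[OF u'(1)] w by (simp add: ev_closed)
    next
      case False
      have "(v, ?c) # ?r \<in> fp_words (pverts \<Gamma>) G" using w s by (simp add: words_simps)
      then show ?thesis using sh[OF shuffle_front[OF False]] by simp
    qed
    have "ev (prepend v a u') = gp_incl \<Gamma> G v (a \<otimes>\<^bsub>G v\<^esub> ?c) \<otimes>\<^bsub>P\<^esub> ev ?r"
      using w by (auto simp: prepend_def Let_def ev_closed)
    also have "\<dots> = ev (s # u)" using w s e u' va by (simp add: P.m_assoc ev_closed gp_incl_closed)
    finally show ?case using prepend_reduced[OF u'(1) s(1,2)] by blast
  qed
qed

lemma gp_incl_link_commute:
  assumes "u \<in> fp_words (pverts \<Gamma>) G" "\<And>s. s \<in> set u \<Longrightarrow> (v, fst s) \<in> parcs \<Gamma>" "v \<in> pverts \<Gamma>" "b \<in> carrier (G v)"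
  shows "ev u \<otimes>\<^bsub>P\<^esub> gp_incl \<Gamma> G v b = gp_incl \<Gamma> G v b \<otimes>\<^bsub>P\<^esub> ev u"
  using assms(1,2)
proof (induction u)
  interpret P: group P by (rule group_graph_product)
  have b: "gp_incl \<Gamma> G v b \<in> carrier P" using gp_incl_closed assms by blast
  {
    case Nil
    show ?case using b by simp
  next
    case (Cons s u)
    then have s: "snd s \<in> carrier (G (fst s))" "fst s \<in> pverts \<Gamma>" "u \<in> fp_words (pverts \<Gamma>) G" by (auto simp: fp_words_def)
    have c: "gp_incl \<Gamma> G (fst s) (snd s) \<in> carrier P" "ev u \<in> carrier P" using s gp_incl_closed ev_closed by blast+
    have "gp_incl \<Gamma> G v b \<otimes>\<^bsub>P\<^esub> gp_incl \<Gamma> G (fst s) (snd s) = gp_incl \<Gamma> G (fst s) (snd s) \<otimes>\<^bsub>P\<^esub> gp_incl \<Gamma> G v b"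
      using gp_incl_commute[of v "fst s" b "snd s"] Cons.prems(2)[of s] assms(4) s by simp
    then show ?case using Cons.IH[OF s(3)] Cons.prems(2) b c by (simp add: P.m_assoc) (simp add: P.m_assoc[symmetric])
  }
qed

lemma syllable_absent: "v \<notin> fst ` set u \<Longrightarrow> syllable v u = \<one>\<^bsub>G v\<^esub>"
  by (induction u) auto

lemma syllable_star:
  "reduced u \<Longrightarrow> fst ` set u \<subseteq> insert v {w. (v, w) \<in> parcs \<Gamma>} \<Longrightarrow> syllable v u = \<one>\<^bsub>G v\<^esub> \<Longrightarrow> s \<in> set u
    \<Longrightarrow> (v, fst s) \<in> parcs \<Gamma>"
  using arc_irrefl by (induction u) (auto split: if_splits)

text \<open>Induction over the first letter \<open>(x, a)\<close> with \<open>v\<close> arbitrary.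
  If \<open>x\<close> is \<open>v\<close> or adjacent to it, the claim is inherited from the tail.
  Otherwise \<open>x\<close> blocks \<open>v\<close>, and the syllable remains trivial unless the
  appended letter cancels \<open>a\<close>. In that case the tail consists of neighbours of
  \<open>x\<close>, so \<open>v\<close> does not occur in it.\<close>

lemma syllable_right:
  assumes "reduced u" "v \<in> pverts \<Gamma>" "w \<in> pverts \<Gamma>" "b \<in> carrier (G w)"
  shows "syllable v (act (u @ [(w, b)]) []) = syllable v u \<or>
    w = v \<and> fst ` set u \<subseteq> insert v {w. (v, w) \<in> parcs \<Gamma>}"
  using assms(1,2)
proof (induction u arbitrary: v)
  case Nil
  then show ?case by (auto simp: act_simps prepend_def Let_def)
next
  case (Cons s u)
  obtain x a where s: "s = (x, a)" by force
  then have x: "x \<in> pverts \<Gamma>" "a \<in> carrier (G x)" "a \<noteq> \<one>\<^bsub>G x\<^esub>" "syllable x u = \<one>\<^bsub>G x\<^esub>" "reduced u"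
    using Cons.prems by auto
  define U where "U = act (u @ [(w, b)]) []"
  have wd: "u \<in> fp_words (pverts \<Gamma>) G" using x reduced_words by blast
  have U: "reduced U" unfolding U_def using act_reduced wd assms by (simp add: words_simps)
  have e: "act ((s # u) @ [(w, b)]) [] = prepend x a U" by (simp add: act_simps U_def s)
  interpret Gx: group "G x" by (rule groups) (rule x)
  show ?case
  proof (cases "x = v \<or> (v, x) \<in> parcs \<Gamma>")
    case True
    then show ?thesis
    proof
      assume "x = v"
      then show ?thesis using Cons.IH[OF x(5) x(1)] syllable_prepend[OF U] x Gx.r_one[OF x(2)] unfolding e unfolding U_def[symmetric] s by auto
    next
      assume "(v, x) \<in> parcs \<Gamma>"
      then show ?thesis
        using Cons.IH[OF x(5) Cons.prems(2)] syllable_prepend_adj[of v x a U] arc_irrefl unfolding e unfolding U_def[symmetric] s by auto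
    qed
  next
    case False
    then have 1: "syllable v (s # u) = \<one>\<^bsub>G v\<^esub>" by (simp add: s)
    have prepend: "syllable v (prepend x c u') = \<one>\<^bsub>G v\<^esub>"
      if "c \<otimes>\<^bsub>G x\<^esub> syllable x u' \<noteq> \<one>\<^bsub>G x\<^esub>" for c u'
      using that False by (simp add: prepend_def Let_def)
    consider "syllable x U = \<one>\<^bsub>G x\<^esub>" | "w = x" "fst ` set u \<subseteq> insert x {w. (x, w) \<in> parcs \<Gamma>}"
      using Cons.IH[OF x(5) x(1)] x(4) unfolding U_def[symmetric] by auto
    then show ?thesis
    proof cases
      case 1
      then show ?thesis using prepend[of a U] x 1 \<open>syllable v (s # u) = _\<close> unfolding e by simp
    next
      case 2
      have link: "(x, fst t) \<in> parcs \<Gamma>" if "t \<in> set u" for t using syllable_star[OF x(5) 2(2) x(4) that] .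
      interpret P: group P by (rule group_graph_product)
      interpret i: group_hom "G x" P "gp_incl \<Gamma> G x"
        using x by (simp add: group_hom_def group_hom_axioms_def groups group_graph_product gp_incl_hom)
      have b: "b \<in> carrier (G x)" using assms 2 by simp
      \<comment> \<open>The tail commutes with \<open>b\<close>, so the appended letter can be
        merged into the first one without changing the value.\<close>
      have "ev ((s # u) @ [(w, b)]) = ev ((x, a \<otimes>\<^bsub>G x\<^esub> b) # u)"
        using gp_incl_link_commute[OF wd link x(1) b] x b wd 2 s
        by (simp add: ev_append words_simps P.m_assoc gp_incl_closed ev_closed)
      then have "shuffle (prepend x a U) (act ((x, a \<otimes>\<^bsub>G x\<^esub> b) # u) [])"
        unfolding e[symmetric] using ev_eq_shuffle x b wd assms s 2 by (simp add: words_simps)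
      then have "syllable v (prepend x a U) = syllable v (prepend x (a \<otimes>\<^bsub>G x\<^esub> b) u)"
        using syllable_shuffle act_of_reduced[OF x(5)] by (simp add: act_simps)
      also have "\<dots> = \<one>\<^bsub>G v\<^esub>"
      proof (cases "a \<otimes>\<^bsub>G x\<^esub> b = \<one>\<^bsub>G x\<^esub>")
        case True
        have "v \<notin> fst ` set u"
        proof
          assume "v \<in> fst ` set u"
          then have "(x, v) \<in> parcs \<Gamma>" using link by blast
          then show False using arc_sym[of x v] \<open>\<not> (x = v \<or> (v, x) \<in> parcs \<Gamma>)\<close> by blast
        qed
        then show ?thesis
          using True x remainder_trivial[OF x(5) x(4)] syllable_absent by (simp add: prepend_def)
      next
        case False
        then show ?thesis using prepend x b by simp
      qed
      finally show ?thesis using 1 \<open>syllable v (s # u) = _\<close> unfolding e by simp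
    qed
  qed
qed

text \<open>Each rule is a computation with \<open>syllable\<close> on words acting on the empty
  word; the rule for right multiplication is \<open>syllable_right\<close>, applied to a reduced
  word for \<open>g\<close>.\<close>

lemma head_system_P: "head_system P (pverts \<Gamma>) (\<lambda>v w. (v, w) \<in> parcs \<Gamma>) (\<lambda>v. gp_incl \<Gamma> G v ` carrier (G v)) head"
proof -
  interpret P: group P by (rule group_graph_product)
  interpret \<Gamma>: pair_graph \<Gamma> by (rule graph_Gamma)
  have hom: "group_hom (G v) P (gp_incl \<Gamma> G v)" if "v \<in> pverts \<Gamma>" for v
    using that by (simp add: group_hom_def group_hom_axioms_def groups group_graph_product gp_incl_hom)
  show ?thesis
  proof (intro head_system.intro head_system_axioms.intro)
    show "group P" by (rule group_graph_product)
    show "finite (pverts \<Gamma>)" by (rule \<Gamma>.pair_finite_verts)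
    show "v \<in> pverts \<Gamma> \<and> w \<in> pverts \<Gamma>" if "(v, w) \<in> parcs \<Gamma>" for v w using that by (rule arc_pverts)
    show "(w, v) \<in> parcs \<Gamma>" if "(v, w) \<in> parcs \<Gamma>" for v w using that by (rule arc_sym)
    show "(v, v) \<notin> parcs \<Gamma>" for v by (rule arc_irrefl)
    show "subgroup (gp_incl \<Gamma> G v ` carrier (G v)) P" if "v \<in> pverts \<Gamma>" for v
      using group_hom.img_is_subgroup[OF hom[OF that]] .
    show "a \<otimes>\<^bsub>P\<^esub> b = b \<otimes>\<^bsub>P\<^esub> a" if "(v, w) \<in> parcs \<Gamma>" "a \<in> gp_incl \<Gamma> G v ` carrier (G v)"
      "b \<in> gp_incl \<Gamma> G w ` carrier (G w)" for v w a b
      using that gp_incl_commute[OF that(1)] by blast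
    show "generate P (\<Union>v\<in>pverts \<Gamma>. gp_incl \<Gamma> G v ` carrier (G v)) = carrier P"
    proof
      show "generate P (\<Union>v\<in>pverts \<Gamma>. gp_incl \<Gamma> G v ` carrier (G v)) \<subseteq> carrier P"
        by (rule P.generate_incl) (use gp_incl_closed in blast)
      have "carrier P = generate P (gp_generators \<Gamma> G S)" by (simp add: gp_generated)
      also have "\<dots> \<subseteq> generate P (\<Union>v\<in>pverts \<Gamma>. gp_incl \<Gamma> G v ` carrier (G v))"
        using generators_subset by (intro P.mono_generate) (auto simp: gp_generators_def)
      finally show "carrier P \<subseteq> generate P (\<Union>v\<in>pverts \<Gamma>. gp_incl \<Gamma> G v ` carrier (G v))" .
    qed
    show "head v g \<in> gp_incl \<Gamma> G v ` carrier (G v)" if v: "v \<in> pverts \<Gamma>" and g: "g \<in> carrier P" for v g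
    proof -
      obtain u where u: "u \<in> fp_words (pverts \<Gamma>) G" "ev u = g" using ev_surj g by blast
      have "syllable v (act u []) \<in> carrier (G v)" using syllable_closed reduced_words act_reduced u v by simp
      then show ?thesis using head_ev[OF u(1)] u by auto
    qed
    show "head v \<one>\<^bsub>P\<^esub> = \<one>\<^bsub>P\<^esub>" if v: "v \<in> pverts \<Gamma>" for v
      using head_ev[of "[]" v] group_hom.hom_one[OF hom[OF v]] by (simp add: words_simps act_simps)
    show "head v (a \<otimes>\<^bsub>P\<^esub> g) = a \<otimes>\<^bsub>P\<^esub> head v g"
      if v: "v \<in> pverts \<Gamma>" and a: "a \<in> gp_incl \<Gamma> G v ` carrier (G v)" and g: "g \<in> carrier P" for v a g
    proof -
      obtain u where u: "u \<in> fp_words (pverts \<Gamma>) G" "ev u = g" using ev_surj g by blast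
      obtain c where c: "c \<in> carrier (G v)" "a = gp_incl \<Gamma> G v c" using a by blast
      have r: "reduced (act u [])" using u act_reduced by simp
      have "head v (a \<otimes>\<^bsub>P\<^esub> g) = gp_incl \<Gamma> G v (c \<otimes>\<^bsub>G v\<^esub> syllable v (act u []))"
        using head_ev[of "(v, c) # u" v] u c v syllable_prepend[OF r] by (simp add: words_simps act_simps)
      then show ?thesis
        using group_hom.hom_mult[OF hom[OF v] c(1) syllable_closed[OF reduced_words[OF r] v]] head_ev[OF u(1)] u c by simp
    qed
    show "head v (b \<otimes>\<^bsub>P\<^esub> g) = head v g"
      if vw: "(v, w) \<in> parcs \<Gamma>" and b: "b \<in> gp_incl \<Gamma> G w ` carrier (G w)" and g: "g \<in> carrier P" for v w b g
    proof -
      obtain u where u: "u \<in> fp_words (pverts \<Gamma>) G" "ev u = g" using ev_surj g by blast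
      obtain c where c: "c \<in> carrier (G w)" "b = gp_incl \<Gamma> G w c" using b by blast
      show ?thesis
        using head_ev[of "(w, c) # u" v] head_ev[OF u(1), of v] u c arc_pverts[OF vw] syllable_prepend_adj[OF vw]
        by (simp add: words_simps act_simps)
    qed
    show "w = v \<and> g \<in> generate P (\<Union>u\<in>insert v {u. (v, u) \<in> parcs \<Gamma>}. gp_incl \<Gamma> G u ` carrier (G u))"
      if v: "v \<in> pverts \<Gamma>" and w: "w \<in> pverts \<Gamma>" and b: "b \<in> gp_incl \<Gamma> G w ` carrier (G w)" and g: "g \<in> carrier P"
        and ne: "head v (g \<otimes>\<^bsub>P\<^esub> b) \<noteq> head v g" for v w b g
    proof -
      obtain u0 where "u0 \<in> fp_words (pverts \<Gamma>) G" "ev u0 = g" using ev_surj g by blast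
      then obtain u where u: "reduced u" "ev u = g" using ev_act by blast
      obtain c where c: "c \<in> carrier (G w)" "b = gp_incl \<Gamma> G w c" using b by blast
      have wd: "u \<in> fp_words (pverts \<Gamma>) G" "u @ [(w, c)] \<in> fp_words (pverts \<Gamma>) G"
        using u reduced_words w c by (simp_all add: words_simps)
      have "ev (u @ [(w, c)]) = g \<otimes>\<^bsub>P\<^esub> b" using wd u c w by (simp add: ev_append words_simps gp_incl_closed)
      then have "syllable v (act (u @ [(w, c)]) []) \<noteq> syllable v u"
        using ne head_ev[OF wd(1), of v] head_ev[OF wd(2), of v] act_of_reduced[OF u(1)] u(2) by auto
      then have *: "w = v" "fst ` set u \<subseteq> insert v {u. (v, u) \<in> parcs \<Gamma>}"
        using syllable_right[OF u(1) v w c(1)] by auto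
      let ?H = "\<Union>u\<in>insert v {u. (v, u) \<in> parcs \<Gamma>}. gp_incl \<Gamma> G u ` carrier (G u)"
      have "ev u \<in> generate P ?H" using wd(1) *(2)
      proof (induction u)
        case (Cons s u)
        then have "gp_incl \<Gamma> G (fst s) (snd s) \<in> ?H" by (auto simp: fp_words_def)
        then have "gp_incl \<Gamma> G (fst s) (snd s) \<in> generate P ?H" by (rule generate.incl)
        moreover have "ev u \<in> generate P ?H" using Cons by (auto simp: fp_words_def)
        ultimately show ?case by (simp add: generate.eng)
      qed (simp add: generate.one)
      with * u show ?thesis by simp
    qed
  qed
qed

end

section \<open>Acylindricity\<close>

context graph_product_setup begin

section \<open>From points of the realization to vertices\<close>

definition vdist :: "('v \<times> 'a) list set set \<Rightarrow> ('v \<times> 'a) list set set \<Rightarrow> nat" where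
  "vdist x y = (LEAST n. (x, y) \<in> parcs C ^^ n)"

lemma vdist_path_dist:
  "x \<in> carrier P \<Longrightarrow> y \<in> carrier P \<Longrightarrow> path_dist C (vertex_point x) (vertex_point y) = real (vdist x y)"
  using C.path_dist_vertices by (simp add: vdist_def pverts_C)

lemma vdist_path: "x \<in> carrier P \<Longrightarrow> y \<in> carrier P \<Longrightarrow> (x, y) \<in> parcs C ^^ vdist x y"
  unfolding vdist_def by (rule LeastI_ex) (use C.connected[of x y] in \<open>simp add: pverts_C rtrancl_power\<close>)

lemma vdist_le: "(x, y) \<in> parcs C ^^ n \<Longrightarrow> vdist x y \<le> n"
  unfolding vdist_def by (rule Least_le)

lemma vdist_left:
  assumes "g \<in> carrier P" "x \<in> carrier P" "y \<in> carrier P"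
  shows "vdist (g \<otimes>\<^bsub>P\<^esub> x) (g \<otimes>\<^bsub>P\<^esub> y) = vdist x y"
proof -
  interpret P: group P by (rule group_graph_product)
  have r: "vertex_point x \<in> realization C" "vertex_point y \<in> realization C"
    using assms C.vertex_point_realization by (simp_all add: pverts_C)
  have "real (vdist (g \<otimes>\<^bsub>P\<^esub> x) (g \<otimes>\<^bsub>P\<^esub> y)) = real (vdist x y)"
    using left_mult_action_isometry[OF assms(1) r] assms
    by (simp add: left_mult_action_vertex vdist_path_dist)
  then show ?thesis by simp
qed

text \<open>Any vertex of a cell containing \<open>p\<close> will do: the coordinates of two points
  of a cell differ by at most 2 in total, and \<open>segment_length\<close> is half of that.\<close>

lemma near_vertex:
  assumes "p \<in> realization C"
  obtains x where "x \<in> carrier P" "path_dist C p (vertex_point x) \<le> 1"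
proof -
  obtain c where c: "c \<in> geom_cells C" "p \<in> cell_points c" using assms unfolding realization_def by blast
  have fc: "finite c" "c \<noteq> {}" "c \<subseteq> carrier P" using C.cell_facts[OF c(1)] by (simp_all add: pverts_C)
  then obtain x where x: "x \<in> c" "x \<in> carrier P" by blast
  let ?x = "vertex_point x"
  have xc: "?x \<in> cell_points c" by (rule vertex_point_cell[OF fc(1) x(1)])
  have "(\<Sum>z\<in>c. \<bar>p z - ?x z\<bar>) \<le> (\<Sum>z\<in>c. p z + ?x z)"
  proof (rule sum_mono)
    fix z
    have "0 \<le> p z" "0 \<le> ?x z" using c(2) xc by (simp_all add: cell_points_def)
    then show "\<bar>p z - ?x z\<bar> \<le> p z + ?x z" by simp
  qed
  also have "\<dots> = 2" using c(2) xc by (simp add: sum.distrib cell_points_def)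
  finally have "segment_length p ?x \<le> 1" using segment_length_eq[OF fc(1) c(2) xc] by simp
  moreover have "path_dist C p ?x \<le> segment_length p ?x"
    using C.chain_single[OF c xc] assms C.vertex_point_realization[of x] x
    by (auto simp: path_dist_def pverts_C intro!: cInf_lower C.bdd_below_chain)
  ultimately show thesis using that[OF x(2)] by simp
qed

definition vertex_stabilizer :: "nat \<Rightarrow> ('v \<times> 'a) list set set \<Rightarrow> ('v \<times> 'a) list set set set" where
  "vertex_stabilizer e y = {g \<in> carrier P. vdist \<one>\<^bsub>P\<^esub> g \<le> e \<and> vdist y (g \<otimes>\<^bsub>P\<^esub> y) \<le> e}"

text \<open>Replacing a point by a nearby vertex costs 1 at either end, so \<open>\<epsilon>\<close>
  becomes \<open>\<epsilon> + 2\<close> and the threshold grows by 2. Conjugation by the vertex near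
  \<open>x\<close> then moves that vertex to \<open>\<one>\<close> and maps the relevant elements
  injectively into a \<open>vertex_stabilizer\<close>.\<close>

lemma acylindrical_reduction:
  assumes "\<And>e. \<exists>R N. \<forall>y\<in>carrier P. R \<le> vdist \<one>\<^bsub>P\<^esub> y \<longrightarrow>
    finite (vertex_stabilizer e y) \<and> card (vertex_stabilizer e y) \<le> N"
  shows "acylindrical_action P (realization C) (path_dist C) (left_mult_action P C)"
  unfolding acylindrical_action_def
proof (intro allI impI)
  fix \<epsilon> :: real assume "0 \<le> \<epsilon>"
  interpret P: group P by (rule group_graph_product)
  interpret M: Metric_space "realization C" "path_dist C" by (rule Metric_space_C)
  define e where "e = nat \<lfloor>\<epsilon> + 2\<rfloor>"
  obtain R N where RN: "\<forall>y\<in>carrier P. R \<le> vdist \<one>\<^bsub>P\<^esub> y \<longrightarrow>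
    finite (vertex_stabilizer e y) \<and> card (vertex_stabilizer e y) \<le> N" using assms by blast
  let ?B = "\<lambda>x y. {g \<in> carrier P. path_dist C x (left_mult_action P C g x) \<le> \<epsilon>
    \<and> path_dist C y (left_mult_action P C g y) \<le> \<epsilon>}"
  have "finite (?B x y) \<and> card (?B x y) \<le> N"
    if xy: "x \<in> realization C" "y \<in> realization C" "real R + 2 \<le> path_dist C x y" for x y
  proof -
    obtain a where a: "a \<in> carrier P" "path_dist C x (vertex_point a) \<le> 1"
      by (rule near_vertex[OF xy(1)])
    obtain b where b: "b \<in> carrier P" "path_dist C y (vertex_point b) \<le> 1"
      by (rule near_vertex[OF xy(2)])
    have ab: "vertex_point a \<in> realization C" "vertex_point b \<in> realization C"
      using a b C.vertex_point_realization by (simp_all add: pverts_C)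
    have act: "left_mult_action P C g z \<in> realization C" if "g \<in> carrier P" "z \<in> realization C" for g z
      using that push_realization by (simp add: left_mult_action_eq)
    have move: "vdist c (g \<otimes>\<^bsub>P\<^esub> c) \<le> e"
      if g: "g \<in> carrier P" and z: "z \<in> realization C" "path_dist C z (left_mult_action P C g z) \<le> \<epsilon>"
        and c: "c \<in> carrier P" "path_dist C z (vertex_point c) \<le> 1" for g z c
    proof -
      let ?c = "vertex_point c" and ?g = "left_mult_action P C g"
      have cr: "?c \<in> realization C" using c C.vertex_point_realization by (simp add: pverts_C)
      have "path_dist C ?c (?g ?c) \<le> path_dist C ?c z + path_dist C z (?g z) + path_dist C (?g z) (?g ?c)"
        using M.triangle[of ?c z "?g ?c"] M.triangle[of z "?g z" "?g ?c"] act g z cr by simp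
      also have "\<dots> \<le> 1 + \<epsilon> + 1"
        using left_mult_action_isometry[OF g z(1) cr] z c M.commute[of ?c z] by simp
      finally have "real (vdist c (g \<otimes>\<^bsub>P\<^esub> c)) \<le> \<epsilon> + 2"
        using left_mult_action_vertex g c vdist_path_dist by simp
      then show ?thesis unfolding e_def by linarith
    qed
    define y' where "y' = inv\<^bsub>P\<^esub> a \<otimes>\<^bsub>P\<^esub> b"
    have y': "y' \<in> carrier P" using a b by (simp add: y'_def)
    have "path_dist C x y \<le> 1 + real (vdist a b) + 1"
      using M.triangle[of x "vertex_point a" y] M.triangle[of "vertex_point a" "vertex_point b" y]
        M.commute[of y "vertex_point b"] a b ab xy vdist_path_dist[OF a(1) b(1)] by simp
    then have "R \<le> vdist a b" using xy by simp
    also have "vdist a b = vdist \<one>\<^bsub>P\<^esub> y'"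
      using vdist_left[of "inv\<^bsub>P\<^esub> a" a b] a b by (simp add: y'_def)
    finally have fin: "finite (vertex_stabilizer e y')" "card (vertex_stabilizer e y') \<le> N" using RN y' by auto
    let ?f = "\<lambda>g. inv\<^bsub>P\<^esub> a \<otimes>\<^bsub>P\<^esub> g \<otimes>\<^bsub>P\<^esub> a"
    have "?f g \<in> vertex_stabilizer e y'" if g: "g \<in> ?B x y" for g
    proof -
      have gc: "g \<in> carrier P" using g by simp
      have 1: "vdist a (g \<otimes>\<^bsub>P\<^esub> a) \<le> e" "vdist b (g \<otimes>\<^bsub>P\<^esub> b) \<le> e" using move g xy a b by auto
      have "vdist \<one>\<^bsub>P\<^esub> (?f g) \<le> e"
        using vdist_left[of "inv\<^bsub>P\<^esub> a" a "g \<otimes>\<^bsub>P\<^esub> a"] 1 a gc by (simp add: P.m_assoc)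
      moreover have "?f g \<otimes>\<^bsub>P\<^esub> y' = inv\<^bsub>P\<^esub> a \<otimes>\<^bsub>P\<^esub> (g \<otimes>\<^bsub>P\<^esub> b)"
        using a b gc by (simp add: y'_def P.m_assoc)
      then have "vdist y' (?f g \<otimes>\<^bsub>P\<^esub> y') \<le> e"
        using vdist_left[of "inv\<^bsub>P\<^esub> a" b "g \<otimes>\<^bsub>P\<^esub> b"] 1 a b gc by (simp add: y'_def)
      ultimately show ?thesis using a gc by (simp add: vertex_stabilizer_def)
    qed
    then have sub: "?f ` ?B x y \<subseteq> vertex_stabilizer e y'" by blast
    have inj: "inj_on ?f (?B x y)"
    proof (rule inj_onI)
      fix g h assume "g \<in> ?B x y" "h \<in> ?B x y" and eq: "?f g = ?f h"
      then have gh: "g \<in> carrier P" "h \<in> carrier P" by auto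
      have "g = a \<otimes>\<^bsub>P\<^esub> ?f g \<otimes>\<^bsub>P\<^esub> inv\<^bsub>P\<^esub> a" using a gh by (simp add: P.m_assoc)
      also have "\<dots> = h" unfolding eq using a gh by (simp add: P.m_assoc)
      finally show "g = h" .
    qed
    show ?thesis
      using inj_on_finite[OF inj sub fin(1)] card_inj_on_le[OF inj sub fin(1)] fin(2) by simp
  qed
  then show "\<exists>R\<ge>0. \<exists>N. \<forall>x\<in>realization C. \<forall>y\<in>realization C. R \<le> path_dist C x y \<longrightarrow>
      finite (?B x y) \<and> card (?B x y) \<le> N"
    by (intro exI[of _ "real R + 2"] conjI exI[of _ N]) auto
qed

text \<open>A single vertex has no nonempty proper subgraph, so \<open>C\<close> is the Cayley graph
  of a finite generating set.\<close>

lemma finite_ball: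
  assumes "pverts \<Gamma> = {v}" "finite (S v)"
  shows "finite {g \<in> carrier P. vdist \<one>\<^bsub>P\<^esub> g \<le> e}"
proof -
  interpret P: group P by (rule group_graph_product)
  let ?T = "gp_generators \<Gamma> G S"
  have T: "finite ?T" using assms by (simp add: gp_generators_def)
  have "finite {g. (\<one>\<^bsub>P\<^esub>, g) \<in> parcs C ^^ n}" for n
  proof (induction n)
    case (Suc n)
    let ?X = "{g. (\<one>\<^bsub>P\<^esub>, g) \<in> parcs C ^^ n}"
    have "{g. (\<one>\<^bsub>P\<^esub>, g) \<in> parcs C ^^ Suc n} \<subseteq> (\<lambda>(h, t). h \<otimes>\<^bsub>P\<^esub> t) ` (?X \<times> (?T \<union> m_inv P ` ?T))"
    proof
      fix g assume "g \<in> {g. (\<one>\<^bsub>P\<^esub>, g) \<in> parcs C ^^ Suc n}"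
      then obtain h where h: "h \<in> ?X" "(h, g) \<in> parcs C" by auto
      then have hg: "h \<in> carrier P" "g \<in> carrier P" "C_step (inv\<^bsub>P\<^esub> h \<otimes>\<^bsub>P\<^esub> g)" by (auto simp: parcs_C)
      have "\<not> (W \<noteq> {} \<and> W \<subset> pverts \<Gamma>)" for W using assms by auto
      then have "inv\<^bsub>P\<^esub> h \<otimes>\<^bsub>P\<^esub> g \<in> ?T \<union> m_inv P ` ?T" using hg(3) unfolding C_step_def by blast
      moreover have "g = h \<otimes>\<^bsub>P\<^esub> (inv\<^bsub>P\<^esub> h \<otimes>\<^bsub>P\<^esub> g)" using hg by simp
      ultimately show "g \<in> (\<lambda>(h, t). h \<otimes>\<^bsub>P\<^esub> t) ` (?X \<times> (?T \<union> m_inv P ` ?T))" using h(1) by force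
    qed
    then show ?case by (rule finite_subset) (use Suc T in simp)
  qed simp
  then have "finite (\<Union>n\<in>{..e}. {g. (\<one>\<^bsub>P\<^esub>, g) \<in> parcs C ^^ n})" by simp
  moreover have "{g \<in> carrier P. vdist \<one>\<^bsub>P\<^esub> g \<le> e} \<subseteq> (\<Union>n\<in>{..e}. {g. (\<one>\<^bsub>P\<^esub>, g) \<in> parcs C ^^ n})"
    using vdist_path[of "\<one>\<^bsub>P\<^esub>"] by auto
  ultimately show ?thesis by (rule rev_finite_subset)
qed

text \<open>The subgroups of \<open>X\<close> and \<open>Y\<close> commute, so \<open>g\<close>
  splits as a product of one element of each, and each factor costs at most one edge.\<close>

lemma vdist_join:
  assumes V: "pverts \<Gamma> = X \<union> Y" "X \<inter> Y = {}" "X \<noteq> {}" "Y \<noteq> {}"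
    and join: "\<And>a b. a \<in> X \<Longrightarrow> b \<in> Y \<Longrightarrow> (a, b) \<in> parcs \<Gamma>"
    and g: "g \<in> carrier P"
  shows "vdist \<one>\<^bsub>P\<^esub> g \<le> 2"
proof -
  interpret HS: head_system P "pverts \<Gamma>" "\<lambda>v w. (v, w) \<in> parcs \<Gamma>" "\<lambda>v. gp_incl \<Gamma> G v ` carrier (G v)" head
    by (rule head_system_P)
  have XY: "X \<subseteq> pverts \<Gamma>" "Y \<subseteq> pverts \<Gamma>" "X \<subset> pverts \<Gamma>" "Y \<subset> pverts \<Gamma>" using V by auto
  obtain u where u: "u \<in> HS.words (pverts \<Gamma>)" "HS.wprod u = g" using HS.carrier_word g by blast
  have "\<exists>s\<in>HS.span X. \<exists>t\<in>HS.span Y. HS.wprod u = s \<otimes>\<^bsub>P\<^esub> t" using u(1)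
  proof (induction u)
    case Nil
    have "HS.wprod [] = \<one>\<^bsub>P\<^esub> \<otimes>\<^bsub>P\<^esub> \<one>\<^bsub>P\<^esub>" by simp
    then show ?case using HS.span_one by blast
  next
    case (Cons z u)
    then obtain s t where st: "s \<in> HS.span X" "t \<in> HS.span Y" "HS.wprod u = s \<otimes>\<^bsub>P\<^esub> t" by auto
    have z: "fst z \<in> pverts \<Gamma>" "snd z \<in> gp_incl \<Gamma> G (fst z) ` carrier (G (fst z))" using Cons.prems by auto
    have c: "s \<in> carrier P" "t \<in> carrier P" "snd z \<in> carrier P"
      using st XY HS.span_closed HS.A_closed[OF z] by blast+
    show ?case
    proof (cases "fst z \<in> X")
      case True
      then have "snd z \<in> HS.span X" using HS.A_span z by blast
      then have "snd z \<otimes>\<^bsub>P\<^esub> s \<in> HS.span X" using HS.span_mult st XY by blast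
      moreover have "HS.wprod (z # u) = (snd z \<otimes>\<^bsub>P\<^esub> s) \<otimes>\<^bsub>P\<^esub> t" using st c by (simp add: HS.m_assoc)
      ultimately show ?thesis using st by blast
    next
      case False
      then have zY: "fst z \<in> Y" using z V by blast
      then have "snd z \<in> HS.span Y" using HS.A_span z by blast
      then have "snd z \<otimes>\<^bsub>P\<^esub> t \<in> HS.span Y" using HS.span_mult st XY by blast
      moreover have "s \<in> HS.span (HS.link (fst z))"
      proof -
        have "X \<subseteq> HS.link (fst z)" using join zY arc_sym by (auto simp: HS.link_def)
        then show ?thesis using HS.span_mono st by blast
      qed
      then have "s \<otimes>\<^bsub>P\<^esub> snd z = snd z \<otimes>\<^bsub>P\<^esub> s" using HS.link_commute z by blast
      then have "HS.wprod (z # u) = s \<otimes>\<^bsub>P\<^esub> (snd z \<otimes>\<^bsub>P\<^esub> t)"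
        using st c by simp (simp add: HS.m_assoc[symmetric])
      ultimately show ?thesis using st by blast
    qed
  qed
  then obtain s t where st: "s \<in> HS.span X" "t \<in> HS.span Y" "g = s \<otimes>\<^bsub>P\<^esub> t" using u by blast
  have c: "s \<in> carrier P" "t \<in> carrier P" using st XY HS.span_closed by blast+
  have step: "vdist a (a \<otimes>\<^bsub>P\<^esub> b) \<le> 1" if "a \<in> carrier P" "b \<in> carrier P" "b \<in> HS.span W" "W \<noteq> {}" "W \<subset> pverts \<Gamma>" for a b W
  proof (cases "a \<otimes>\<^bsub>P\<^esub> b = a")
    case True
    then show ?thesis using vdist_le[of a a 0] by simp
  next
    case False
    have "C_step b" using that unfolding C_step_def gp_subgroup_def HS.span_def by blast
    then have "(a, a \<otimes>\<^bsub>P\<^esub> b) \<in> parcs C" using that False by (simp add: parcs_C)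
    then show ?thesis using vdist_le[of a "a \<otimes>\<^bsub>P\<^esub> b" 1] by simp
  qed
  have "vdist \<one>\<^bsub>P\<^esub> s \<le> 1" "vdist s g \<le> 1"
    using step[of "\<one>\<^bsub>P\<^esub>" s X] step[of s t Y] st c V XY by simp_all
  moreover have "(\<one>\<^bsub>P\<^esub>, g) \<in> parcs C ^^ (vdist \<one>\<^bsub>P\<^esub> s + vdist s g)"
    unfolding relpow_add using vdist_path c g by blast
  ultimately show ?thesis using vdist_le by fastforce
qed

text \<open>\<open>cstep\<close> and the edges of \<open>C\<close> agree off the diagonal, so
  \<open>vdist\<close> equals \<open>cdist\<close> and \<open>acylindrical_cdist\<close>
  applies.\<close>

lemma acylindrical_connected:
  assumes other: "\<And>v. \<exists>w\<in>pverts \<Gamma>. w \<noteq> v"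
    and connected: "\<And>v w. v \<in> pverts \<Gamma> \<Longrightarrow> w \<in> pverts \<Gamma> \<Longrightarrow>
      (v, w) \<in> {(a, b). a \<in> pverts \<Gamma> \<and> b \<in> pverts \<Gamma> \<and> a \<noteq> b \<and> (a, b) \<notin> parcs \<Gamma>}\<^sup>*"
  shows "\<exists>R N. \<forall>y\<in>carrier P. R \<le> vdist \<one>\<^bsub>P\<^esub> y \<longrightarrow>
    finite (vertex_stabilizer e y) \<and> card (vertex_stabilizer e y) \<le> N"
proof -
  interpret HS: connected_head_system P "pverts \<Gamma>" "\<lambda>v w. (v, w) \<in> parcs \<Gamma>" "\<lambda>v. gp_incl \<Gamma> G v ` carrier (G v)" head
    by (rule connected_head_system.intro[OF head_system_P connected_head_system_axioms.intro])
      (use other connected in auto)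
  have sub: "gp_subgroup \<Gamma> G W = HS.span W" for W by (simp add: gp_subgroup_def HS.span_def)
  have arcs: "(x, y) \<in> HS.cstep" if xy: "(x, y) \<in> parcs C" for x y
  proof -
    have c: "x \<in> carrier P" "y \<in> carrier P" "C_step (inv\<^bsub>P\<^esub> x \<otimes>\<^bsub>P\<^esub> y)" using xy by (auto simp: parcs_C)
    let ?h = "inv\<^bsub>P\<^esub> x \<otimes>\<^bsub>P\<^esub> y"
    have letter: ?thesis if "v \<in> pverts \<Gamma>" "?h \<in> gp_incl \<Gamma> G v ` carrier (G v)" for v
      using HS.cstep_letter[OF c(1) that] c by simp
    have gen: "\<exists>v\<in>pverts \<Gamma>. t \<in> gp_incl \<Gamma> G v ` carrier (G v)" if "t \<in> gp_generators \<Gamma> G S" for t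
      using that generators_subset by (auto simp: gp_generators_def)
    from c(3) consider W where "W \<subset> pverts \<Gamma>" "?h \<in> gp_subgroup \<Gamma> G W"
      | "?h \<in> gp_generators \<Gamma> G S" | t where "t \<in> gp_generators \<Gamma> G S" "?h = inv\<^bsub>P\<^esub> t"
      unfolding C_step_def by blast
    then show ?thesis
    proof cases
      case 1
      then obtain v where v: "v \<in> pverts \<Gamma>" "W \<subseteq> pverts \<Gamma> - {v}" by blast
      then have "?h \<in> HS.span (pverts \<Gamma> - {v})" using HS.span_mono 1 sub by blast
      then show ?thesis using c v unfolding HS.cstep_def by blast
    next
      case 2
      then show ?thesis using gen letter by blast
    next
      case 3
      then obtain v where "v \<in> pverts \<Gamma>" "t \<in> gp_incl \<Gamma> G v ` carrier (G v)" using gen by blast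
      then show ?thesis using letter HS.A_inv[of v t] 3 by simp
    qed
  qed
  have cstep: "(x, y) \<in> parcs C" if xy: "(x, y) \<in> HS.cstep" "x \<noteq> y" for x y
  proof -
    obtain v where v: "x \<in> carrier P" "y \<in> carrier P" "v \<in> pverts \<Gamma>" "inv\<^bsub>P\<^esub> x \<otimes>\<^bsub>P\<^esub> y \<in> HS.span (pverts \<Gamma> - {v})"
      using xy(1) by (auto simp: HS.cstep_def)
    have "pverts \<Gamma> - {v} \<noteq> {}" "pverts \<Gamma> - {v} \<subset> pverts \<Gamma>" using other[of v] v by auto
    moreover have "inv\<^bsub>P\<^esub> x \<otimes>\<^bsub>P\<^esub> y \<in> gp_subgroup \<Gamma> G (pverts \<Gamma> - {v})" using v(4) by (simp only: sub)
    ultimately have "C_step (inv\<^bsub>P\<^esub> x \<otimes>\<^bsub>P\<^esub> y)" unfolding C_step_def by (intro disjI1 exI conjI)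
    then show ?thesis using v xy by (simp add: parcs_C)
  qed
  \<comment> \<open>Idle steps of \<open>cstep\<close> are dropped, so the path can only become
    shorter.\<close>
  have le: "\<exists>m\<le>n. (x, y) \<in> parcs C ^^ m" if "(x, y) \<in> HS.cstep ^^ n" for x y n
    using that
  proof (induction n arbitrary: y)
    case (Suc n)
    then obtain z where z: "(x, z) \<in> HS.cstep ^^ n" "(z, y) \<in> HS.cstep" by auto
    then obtain m where m: "m \<le> n" "(x, z) \<in> parcs C ^^ m" using Suc.IH by blast
    show ?case
    proof (cases "z = y")
      case True
      then show ?thesis using m by (intro exI[of _ m]) simp
    next
      case False
      then have "(x, y) \<in> parcs C ^^ Suc m" using m cstep[OF z(2)] by (intro relpow_Suc_I)
      then show ?thesis using m by (intro exI[of _ "Suc m"]) simp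
    qed
  qed simp
  have eq: "vdist x y = HS.cdist x y" if xy: "x \<in> carrier P" "y \<in> carrier P" for x y
  proof (rule antisym)
    obtain m where "m \<le> HS.cdist x y" "(x, y) \<in> parcs C ^^ m" using le[OF HS.cdist_path[OF xy]] by blast
    then show "vdist x y \<le> HS.cdist x y" using vdist_le by fastforce
    have "parcs C ^^ n \<subseteq> HS.cstep ^^ n" for n
      by (induction n) (use arcs in \<open>auto intro!: relcomp_mono\<close>)
    then show "HS.cdist x y \<le> vdist x y" using HS.cdist_le vdist_path[OF xy] by blast
  qed
  have "vertex_stabilizer e y = HS.coarse_stabilizer e y" if "y \<in> carrier P" for y
    using that unfolding vertex_stabilizer_def HS.coarse_stabilizer_def by (auto simp: eq)
  moreover obtain N where "\<forall>y\<in>carrier P. 2 * e + 7 \<le> HS.cdist \<one>\<^bsub>P\<^esub> y \<longrightarrow>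
    finite (HS.coarse_stabilizer e y) \<and> card (HS.coarse_stabilizer e y) \<le> N"
    using HS.acylindrical_cdist[of e] by (rule exE)
  ultimately show ?thesis by (intro exI[of _ "2 * e + 7"] exI[of _ N]) (simp add: eq)
qed

end

theorem corollary4p24:
  fixes \<Gamma> :: "'v pair_pre_digraph"
    and G :: "'v \<Rightarrow> ('a, 'b) monoid_scheme"
    and S :: "'v \<Rightarrow> 'a set"
  assumes "pair_graph \<Gamma>" and "pverts \<Gamma> \<noteq> {}"
    and "\<And>v. v \<in> pverts \<Gamma> \<Longrightarrow> group (G v)"
    and "\<And>v. v \<in> pverts \<Gamma> \<Longrightarrow> carrier (G v) \<noteq> {\<one>\<^bsub>G v\<^esub>}"
    and "\<And>v. v \<in> pverts \<Gamma> \<Longrightarrow> finite (S v)"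
    and "\<And>v. v \<in> pverts \<Gamma> \<Longrightarrow> S v \<subseteq> carrier (G v)"
    and "\<And>v. v \<in> pverts \<Gamma> \<Longrightarrow> generate (G v) (S v) = carrier (G v)"
  shows "acylindrical_action (graph_product \<Gamma> G)
    (realization (C_graph \<Gamma> G S)) (path_dist (C_graph \<Gamma> G S))
    (left_mult_action (graph_product \<Gamma> G) (C_graph \<Gamma> G S))"
proof -
  have "graph_product_setup \<Gamma> G S"
  proof (rule graph_product_setup.intro)
    show "pair_graph \<Gamma>" by (rule assms)
    show "group (G v)" if "v \<in> pverts \<Gamma>" for v using that by (rule assms)
    show "S v \<subseteq> carrier (G v)" if "v \<in> pverts \<Gamma>" for v using that by (rule assms)
    show "generate (G v) (S v) = carrier (G v)" if "v \<in> pverts \<Gamma>" for v using that by (rule assms)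
  qed
  then interpret graph_product_setup \<Gamma> G S .
  let ?N = "{(a, b). a \<in> pverts \<Gamma> \<and> b \<in> pverts \<Gamma> \<and> a \<noteq> b \<and> (a, b) \<notin> parcs \<Gamma>}"
  show ?thesis
  proof (rule acylindrical_reduction)
    fix e :: nat
    \<comment> \<open>The cases concern the complement of the graph: a single vertex, disconnected,
      or connected with at least two vertices.\<close>
    consider (single) "\<exists>v. pverts \<Gamma> = {v}" | (join) "\<exists>v\<in>pverts \<Gamma>. \<exists>w\<in>pverts \<Gamma>. (v, w) \<notin> ?N\<^sup>*"
      | (irreducible) "\<forall>v. pverts \<Gamma> \<noteq> {v}" "\<forall>v\<in>pverts \<Gamma>. \<forall>w\<in>pverts \<Gamma>. (v, w) \<in> ?N\<^sup>*"
      by blast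
    then show "\<exists>R N. \<forall>y\<in>carrier P. R \<le> vdist \<one>\<^bsub>P\<^esub> y \<longrightarrow>
      finite (vertex_stabilizer e y) \<and> card (vertex_stabilizer e y) \<le> N"
    proof cases
      case single
      then obtain v where v: "pverts \<Gamma> = {v}" by (rule exE)
      let ?B = "{g \<in> carrier P. vdist \<one>\<^bsub>P\<^esub> g \<le> e}"
      have fin: "finite ?B" using finite_ball[OF v] assms(5)[of v] v by simp
      have sub: "vertex_stabilizer e y \<subseteq> ?B" for y unfolding vertex_stabilizer_def by blast
      show ?thesis
        using finite_subset[OF sub fin] card_mono[OF fin sub] by blast
    next
      case join
      then obtain v w where vw: "v \<in> pverts \<Gamma>" "w \<in> pverts \<Gamma>" "(v, w) \<notin> ?N\<^sup>*" by (elim bexE)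
      \<comment> \<open>\<open>X\<close> is the component of \<open>v\<close> in the complement, so
        each vertex outside \<open>X\<close> is adjacent to all of \<open>X\<close>.\<close>
      define X where "X = {a \<in> pverts \<Gamma>. (v, a) \<in> ?N\<^sup>*}"
      have "(a, b) \<in> parcs \<Gamma>" if ab: "a \<in> X" "b \<in> pverts \<Gamma> - X" for a b
      proof (rule ccontr)
        assume "(a, b) \<notin> parcs \<Gamma>"
        then have "(a, b) \<in> ?N" using ab by (auto simp: X_def)
        moreover have "(v, a) \<in> ?N\<^sup>*" using ab by (simp add: X_def)
        ultimately have "(v, b) \<in> ?N\<^sup>*" by (rule rtrancl_into_rtrancl[rotated])
        then show False using ab by (simp add: X_def)
      qed
      moreover have "v \<in> X" "w \<in> pverts \<Gamma> - X" "X \<subseteq> pverts \<Gamma>" using vw by (simp_all add: X_def)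
      ultimately have "vdist \<one>\<^bsub>P\<^esub> y \<le> 2" if "y \<in> carrier P" for y
        using vdist_join[of X "pverts \<Gamma> - X" y] that by blast
      \<comment> \<open>No element is at distance 3 from \<open>\<one>\<close>, so the condition is
        vacuous.\<close>
      then show ?thesis by (intro exI[of _ 3]) fastforce
    next
      case irreducible
      have "\<exists>w\<in>pverts \<Gamma>. w \<noteq> v" for v
      proof (rule ccontr)
        assume "\<not> ?thesis"
        then have "pverts \<Gamma> \<subseteq> {v}" by blast
        then show False using subset_singletonD irreducible(1) assms(2) by metis
      qed
      moreover have "(v, w) \<in> ?N\<^sup>*" if "v \<in> pverts \<Gamma>" "w \<in> pverts \<Gamma>" for v w using irreducible(2) that by simp
      ultimately show ?thesis by (rule acylindrical_connected)
    qed
  qed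
qed

end
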